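(* Let $T\subset\mathbb{C}^2$ be a smoothly embedded $2$-torus (a smooth compact submanifold diffeomorphic to $S^1\times S^1$) that is totally real and rationally convex. Then for every Hölder exponent $\alpha$ with $0\le\alpha<1$ there exists a $C^\alpha$-small perturbation of $T$ that is totally real and not rationally convex. That is, for every such $\alpha$ there exist a tubular neighbourhood $U_T$ of $T$ in $\mathbb{C}^2$, a smooth submersion $\pi:U_T\to T$ with $\pi|_T=\mathrm{id}_T$, and a sequence of smooth submanifolds $T_j\subset U_T$, $j\in\mathbb{N}$, such that each $T_j$ is totally real and not rationally convex, $\pi|_{T_j}:T_j\to T$ is a diffeomorphism for every $j$, and $T_j$ converges to $T$ in the $C^\alpha$-topology as $j\to\infty$.
   Context: Smooth means $C^\infty$. A smooth submanifold of $\mathbb{C}^n$ is called totally real if it is not tangent to any complex line, i.e. none of its (real) tangent spaces contains a complex line (a one-dimensional complex subspace of $\mathbb{C}^n$). A compact set $K\subset\mathbb{C}^n$ is rationally convex if for every point $z\in\mathbb{C}^n\setminus K$ there is a complex polynomial $P$ on $\mathbb{C}^n$ with $P(z)\notin P(K)$ (equivalently, $K$ equals its rationally convex hull). Definition ($C^\alpha$-small perturbation). A smooth submanifold $M\subset\mathbb{C}^n$ admits a $C^\alpha$-small perturbation with a certain property if there exist (i) a submersion $\pi:U_M\to M$ from a tubular neighbourhood $U_M$ of $M$ onto $M$, and (ii) a sequence of smooth submanifolds $M_j\subset U_M$, $j\in\mathbb{N}$, each having that property, such that $M_j$ converge to $M$ in the $C^\alpha$-topology as $j\to\infty$ and $\pi:M_j\to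 M$ is a diffeomorphism for all $j$. In other words, a neighbourhood of $M$ in $\mathbb{C}^n$ can be identified with a neighbourhood of the zero section in the normal bundle of $M$ so that all the $M_j$ correspond to graphs of $C^\alpha$-small sections of that bundle. For compact $M$, the $C^\alpha$-convergence means that the maps $\sigma_j=(\pi|_{M_j})^{-1}:M\to\mathbb{C}^n$ converge to the inclusion $M\hookrightarrow\mathbb{C}^n$ in the Hölder norm $C^\alpha(M,\mathbb{C}^n)$ (the uniform norm if $\alpha=0$). *)

theory Defs
  imports "HOL-Analysis.Analysis"
begin

section \<open>Smooth maps, submanifolds and tangent spaces\<close>

text \<open>\<open>Ck_on k f U\<close> and \<open>smooth_on f U\<close> are only meant for open \<open>U\<close>.\<close>

primrec Ck_on :: "nat \<Rightarrow> ('a::euclidean_space \<Rightarrow> 'b::euclidean_space) \<Rightarrow> 'a set \<Rightarrow> bool" where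
  "Ck_on 0 f U \<longleftrightarrow> continuous_on U f"
| "Ck_on (Suc k) f U \<longleftrightarrow>
     (\<forall>x\<in>U. f differentiable (at x)) \<and> (\<forall>v. Ck_on k (\<lambda>x. frechet_derivative f (at x) v) U)"

definition smooth_on :: "('a::euclidean_space \<Rightarrow> 'b::euclidean_space) \<Rightarrow> 'a set \<Rightarrow> bool" where
  "smooth_on f U \<longleftrightarrow> (\<forall>k. Ck_on k f U)"

text \<open>Smoothness on an arbitrary subset \<open>S\<close>: local extendability to smooth maps on open sets.
  For maps between embedded submanifolds this is smoothness in the sense of manifolds.\<close>

definition smooth_map :: "('a::euclidean_space \<Rightarrow> 'b::euclidean_space) \<Rightarrow> 'a set \<Rightarrow> bool" where
  "smooth_map f S \<longleftrightarrow>
     (\<forall>p\<in>S. \<exists>U g. open U \<and> p \<in> U \<and> smooth_on g U \<and> (\<forall>x\<in>S \<inter> U. g x = f x))"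

definition diffeomorphism ::
  "'a::euclidean_space set \<Rightarrow> 'b::euclidean_space set \<Rightarrow> ('a \<Rightarrow> 'b) \<Rightarrow> ('b \<Rightarrow> 'a) \<Rightarrow> bool" where
  "diffeomorphism S T f g \<longleftrightarrow>
     smooth_map f S \<and> f ` S = T \<and> (\<forall>x\<in>S. g (f x) = x) \<and>
     smooth_map g T \<and> g ` T = S \<and> (\<forall>y\<in>T. f (g y) = y)"

definition diffeomorphic :: "'a::euclidean_space set \<Rightarrow> 'b::euclidean_space set \<Rightarrow> bool" where
  "diffeomorphic S T \<longleftrightarrow> (\<exists>f g. diffeomorphism S T f g)"

definition smooth_submanifold :: "nat \<Rightarrow> 'a::euclidean_space set \<Rightarrow> bool" where
  "smooth_submanifold d M \<longleftrightarrow>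
     (\<forall>p\<in>M. \<exists>U V L (\<phi> :: 'a \<Rightarrow> 'a) \<psi>.
        open U \<and> p \<in> U \<and> open V \<and> diffeomorphism U V \<phi> \<psi> \<and>
        subspace L \<and> dim L = d \<and> \<phi> ` (M \<inter> U) = L \<inter> V)"

definition tangent_space :: "'a::euclidean_space set \<Rightarrow> 'a \<Rightarrow> 'a set" where
  "tangent_space M p =
     {v. \<exists>e>0. \<exists>\<gamma>::real \<Rightarrow> 'a. smooth_on \<gamma> {-e<..<e} \<and> \<gamma> ` {-e<..<e} \<subseteq> M \<and>
           \<gamma> 0 = p \<and> (\<gamma> has_vector_derivative v) (at 0)}"

definition smooth_submersion :: "'a::euclidean_space set \<Rightarrow> 'a set \<Rightarrow> ('a \<Rightarrow> 'a) \<Rightarrow> bool" where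
  "smooth_submersion U M \<pi> \<longleftrightarrow>
     open U \<and> smooth_on \<pi> U \<and> \<pi> ` U \<subseteq> M \<and>
     (\<forall>x\<in>U. range (frechet_derivative \<pi> (at x)) = tangent_space M (\<pi> x))"

section \<open>Tubular neighbourhoods\<close>

definition normal_bundle :: "'a::euclidean_space set \<Rightarrow> ('a \<times> 'a) set" where
  "normal_bundle M = {(p, v). p \<in> M \<and> v \<in> orthogonal_comp (tangent_space M p)}"

text \<open>An open set \<open>U\<close> identified, by a diffeomorphism restricting to the identity on \<open>M\<close>, with an
  open, fibrewise star-shaped neighbourhood \<open>W\<close> of the zero section in the normal bundle.\<close>

definition tubular_neighbourhood :: "'a::euclidean_space set \<Rightarrow> 'a set \<Rightarrow> bool" where
  "tubular_neighbourhood M U \<longleftrightarrow>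
     open U \<and>
     (\<exists>W \<Phi> \<Psi>. openin (top_of_set (normal_bundle M)) W \<and>
        (\<forall>p\<in>M. (p, 0) \<in> W) \<and>
        (\<forall>p v. \<forall>t\<in>{0..1::real}. (p, v) \<in> W \<longrightarrow> (p, t *\<^sub>R v) \<in> W) \<and>
        diffeomorphism W U \<Phi> \<Psi> \<and> (\<forall>p\<in>M. \<Phi> (p, 0) = p))"

section \<open>Small perturbations\<close>

text \<open>Values lie in \<^typ>\<open>ennreal\<close>, so unbounded suprema are \<open>\<infinity>\<close>. The Euclidean distance is used; on
  a compact submanifold it yields a norm equivalent to the one from the intrinsic distance.\<close>

definition hoelder_norm ::
  "real \<Rightarrow> 'a::euclidean_space set \<Rightarrow> ('a \<Rightarrow> 'b::euclidean_space) \<Rightarrow> ennreal" where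
  "hoelder_norm \<alpha> M f =
     (SUP x\<in>M. ennreal (norm (f x))) +
     (if \<alpha> = 0 then 0
      else (SUP (x, y)\<in>{(x, y). x \<in> M \<and> y \<in> M \<and> x \<noteq> y}.
              ennreal (norm (f x - f y) / dist x y powr \<alpha>)))"

text \<open>For compact \<open>M\<close> of dimension \<open>d\<close>. The map \<open>\<sigma> j\<close> is the inverse of the restriction of \<open>\<pi>\<close>
  to \<open>N j\<close>.\<close>

definition admits_small_perturbation ::
  "real \<Rightarrow> nat \<Rightarrow> 'a::euclidean_space set \<Rightarrow> ('a set \<Rightarrow> bool) \<Rightarrow> bool" where
  "admits_small_perturbation \<alpha> d M P \<longleftrightarrow>
     (\<exists>U \<pi> (N :: nat \<Rightarrow> 'a set) (\<sigma> :: nat \<Rightarrow> 'a \<Rightarrow> 'a).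
        tubular_neighbourhood M U \<and>
        smooth_submersion U M \<pi> \<and> (\<forall>x\<in>M. \<pi> x = x) \<and>
        (\<forall>j. smooth_submanifold d (N j) \<and> N j \<subseteq> U \<and> P (N j) \<and>
             diffeomorphism (N j) M \<pi> (\<sigma> j)) \<and>
        (\<lambda>j. hoelder_norm \<alpha> M (\<lambda>x. \<sigma> j x - x)) \<longlonglongrightarrow> 0)"

section \<open>Totally real and rationally convex sets\<close>

text \<open>\<open>vec.subspace\<close> and \<open>vec.dim\<close> refer to the structure of a complex vector space, whereas
  \<^const>\<open>tangent_space\<close> is a real subspace.\<close>

definition totally_real :: "(complex ^ 'n::finite) set \<Rightarrow> bool" where
  "totally_real M \<longleftrightarrow>
     (\<forall>p\<in>M. \<not> (\<exists>L :: (complex ^ 'n) set. vec.subspace L \<and> vec.dim L = 1 \<and> L \<subseteq> tangent_space M p))"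

definition complex_polynomial :: "(complex ^ 'n::finite \<Rightarrow> complex) \<Rightarrow> bool" where
  "complex_polynomial P \<longleftrightarrow>
     (\<exists>(A :: ('n \<Rightarrow> nat) set) c. finite A \<and> (\<forall>z. P z = (\<Sum>m\<in>A. c m * (\<Prod>i\<in>UNIV. (z $ i) ^ m i))))"

text \<open>Only meant for compact \<open>K\<close>; compactness is deliberately not part of the predicate, so that its
  negation is not satisfied merely by a failure of compactness.\<close>

definition rationally_convex :: "(complex ^ 'n::finite) set \<Rightarrow> bool" where
  "rationally_convex K \<longleftrightarrow> (\<forall>z. z \<notin> K \<longrightarrow> (\<exists>P. complex_polynomial P \<and> P z \<notin> P ` K))"

end

(*
  A totally real surface is, at a small scale and after a complex affine change of coordinates,
  close to the real plane R^2 in C^2. There is an explicit compactly supported map g from R^2 to R^2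
  such that the graph u + i g(u) is totally real and contains the circle {(z, -iz) : |z| = 1}, which
  bounds a holomorphic disc in C^2 as well as a disc in the graph. If a polynomial P had a zero on the
  holomorphic disc and none on the graph, its winding number along the circle would be positive by
  the argument principle and zero because the circle is contractible in the graph. Hence a surface
  containing a piece of this graph is not rationally convex. Grafting the graph scaled by a factor
  epsilon into the torus, along a tubular neighbourhood whose fibres are parallel near the chosen
  point, changes the torus by O(epsilon) in the uniform norm and by O(1) in the Lipschitz norm, thus
  by O(epsilon^(1 - alpha)) in the Hoelder norm; total reality survives since it is an open condition.
*)

theory Submission
  imports Defs "HOL-Complex_Analysis.Residue_Theorem"
begin

section \<open>Calculus of smooth maps\<close>

text \<open>The radial term of \<open>g\<close> answers an obstacle: the graph of the plain rotation
  \<open>u \<mapsto> - J u\<close> contains the boundary circle too, but it is the complex line of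
  all \<open>(z, - i z)\<close>. A graph whose map has derivative \<open>A\<close> is totally real
  iff \<open>1 - det A + i tr A\<close> is nonzero, and the term \<open>(1 - |u|^2) u\<close>, which
  vanishes on the circle, keeps the trace away from 0 wherever the determinant is 1. The point of
  the holomorphic disc off the surface, needed to contradict rational convexity, comes for free: a
  totally real surface contains no holomorphic disc. The torus enters through a periodic immersion
  \<open>G\<close> of the plane, which provides global tangent fields \<open>X 1\<close>,
  \<open>X 2\<close>. Total reality makes them independent over the complex numbers, so
  \<open>i X 1\<close>, \<open>i X 2\<close> complement the tangent planes and give explicit global
  tube coordinates. The perturbation is defined on all of C^2 and then restricted, so no periodicity
  has to be checked for it. The frame along which it moves points is not orthogonal, while tubular
  neighbourhoods refer to the normal bundle; hence two frames are used side by side.\<close>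

lemma Ck_on_cong:
  assumes "open U" and "\<And>x. x \<in> U \<Longrightarrow> f x = g x" and "Ck_on k f U"
  shows "Ck_on k g U"
  using assms(2,3)
proof (induction k arbitrary: f g)
  case 0
  then show ?case by (metis Ck_on.simps(1) continuous_on_cong)
next
  case (Suc k)
  have d: "(g has_derivative frechet_derivative f (at x)) (at x)" if "x \<in> U" for x
    by (rule has_derivative_transform_within_open[of f _ x UNIV U])
      (use Suc.prems that \<open>open U\<close> in \<open>auto simp: frechet_derivative_works\<close>)
  have e: "frechet_derivative g (at x) = frechet_derivative f (at x)" if "x \<in> U" for x
    using frechet_derivative_at[OF d[OF that]] by simp
  have "Ck_on k (\<lambda>x. frechet_derivative g (at x) v) U" for v
    by (rule Suc.IH[of "\<lambda>x. frechet_derivative f (at x) v"]) (use e Suc.prems in auto)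
  then show ?case
    using d by (auto simp: differentiable_def)
qed

lemma Ck_onI:
  assumes "open U" and "\<And>x. x \<in> U \<Longrightarrow> (f has_derivative f' x) (at x)"
    and "\<And>v. Ck_on k (\<lambda>x. f' x v) U"
  shows "Ck_on (Suc k) f U"
proof -
  have "Ck_on k (\<lambda>x. frechet_derivative f (at x) v) U" for v
    by (rule Ck_on_cong[OF assms(1) _ assms(3)[of v]]) (simp add: frechet_derivative_at[OF assms(2)])
  then show ?thesis
    using assms(2) by (auto simp: differentiable_def)
qed

lemma Ck_on_has_derivative:
  assumes "Ck_on (Suc k) f U" "x \<in> U"
  shows "(f has_derivative frechet_derivative f (at x)) (at x)"
  using assms by (simp add: frechet_derivative_works)

lemma Ck_on_Suc: "Ck_on (Suc k) f U \<Longrightarrow> Ck_on k f U"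
proof (induction k arbitrary: f)
  case 0
  then show ?case
    by (auto intro!: continuous_at_imp_continuous_on differentiable_imp_continuous_within)
next
  case (Suc k)
  then show ?case by auto
qed

lemma Ck_on_subset: "Ck_on k f U \<Longrightarrow> V \<subseteq> U \<Longrightarrow> Ck_on k f V"
  by (induction k arbitrary: f) (auto intro: continuous_on_subset)

lemma Ck_on_local:
  assumes "\<And>x. x \<in> U \<Longrightarrow> \<exists>V. open V \<and> x \<in> V \<and> Ck_on k f V"
  shows "Ck_on k f U"
  using assms
proof (induction k arbitrary: f)
  case 0
  then show ?case
    by (auto intro!: continuous_at_imp_continuous_on simp: continuous_on_eq_continuous_at) 
      (metis continuous_on_eq_continuous_at)
next
  case (Suc k)
  then show ?case by (auto, meson)
qed

lemma Ck_on_const: "Ck_on k (\<lambda>x. c) U"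
  by (induction k arbitrary: c) auto

lemma Ck_on_bounded_linear:
  assumes "bounded_linear L" and "Ck_on k f U" and "open U"
  shows "Ck_on k (\<lambda>x. L (f x)) U"
  using assms(2)
proof (induction k arbitrary: f)
  case 0
  then show ?case using assms(1) by (auto intro: bounded_linear.continuous_on)
next
  case (Suc k)
  have d: "((\<lambda>x. L (f x)) has_derivative (\<lambda>v. L (frechet_derivative f (at x) v))) (at x)" if "x \<in> U" for x
    using bounded_linear.has_derivative[OF assms(1) Ck_on_has_derivative[OF Suc.prems that]] .
  show ?case
    by (rule Ck_onI[OF \<open>open U\<close> d]) (use Suc in auto)
qed

lemma Ck_on_ident: "open U \<Longrightarrow> Ck_on k (\<lambda>x. x) U"
proof (cases k)
  case (Suc n)
  assume "open U"
  then show ?thesis unfolding Suc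
    by (rule Ck_onI[where f' = "\<lambda>x v. v"]) (auto intro: has_derivative_ident Ck_on_const)
qed auto

lemma Ck_on_add:
  assumes "open U" and "Ck_on k f U" and "Ck_on k g U"
  shows "Ck_on k (\<lambda>x. f x + g x) U"
  using assms(2,3)
proof (induction k arbitrary: f g)
  case 0
  then show ?case by (auto intro: continuous_intros)
next
  case (Suc k)
  show ?case
    by (rule Ck_onI[OF \<open>open U\<close> has_derivative_add]) 
       (use Suc in \<open>auto simp: frechet_derivative_works\<close>)
qed

lemma Ck_on_bilinear:
  assumes "bounded_bilinear B" and "open U" and "Ck_on k f U" and "Ck_on k g U"
  shows "Ck_on k (\<lambda>x. B (f x) (g x)) U"
  using assms(3,4)
proof (induction k arbitrary: f g)
  case 0
  then show ?case using assms(1) by (auto intro: bounded_bilinear.continuous_on)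
next
  case (Suc k)
  show ?case
    by (rule Ck_onI[OF \<open>open U\<close> bounded_bilinear.FDERIV[OF assms(1)]]) 
       (use Suc Ck_on_Suc[OF Suc.prems(1)] Ck_on_Suc[OF Suc.prems(2)] in
         \<open>auto simp: frechet_derivative_works intro!: Ck_on_add[OF \<open>open U\<close>]\<close>)
qed

lemma Ck_on_sum:
  assumes "open U" and "\<And>i. i \<in> I \<Longrightarrow> Ck_on k (f i) U"
  shows "Ck_on k (\<lambda>x. \<Sum>i\<in>I. f i x) U"
  using assms(2) by (induction I rule: infinite_finite_induct) (auto intro: Ck_on_const Ck_on_add \<open>open U\<close>)

lemma linear_expand: 
  fixes f :: "'a::euclidean_space \<Rightarrow> 'b::real_vector"
  assumes "linear f" shows "f v = (\<Sum>b\<in>Basis. (v \<bullet> b) *\<^sub>R f b)"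
  by (metis (no_types, lifting) assms euclidean_representation linear_scale linear_sum sum.cong)

text \<open>The derivative of \<open>g\<close> is taken in the direction \<open>?f' x v\<close>,
  which moves with \<open>x\<close>, while \<open>Ck_on\<close> speaks only of derivatives in fixed
  directions. Expanding in the basis gives a finite sum of products in which every direction is
  fixed, and the induction applies to each of them.\<close>

lemma Ck_on_compose:
  assumes "open U" and "open V" and "f ` U \<subseteq> V" and "Ck_on k f U" and "Ck_on k g V"
  shows "Ck_on k (\<lambda>x. g (f x)) U"
  using assms(4,5)
proof (induction k arbitrary: g)
  case 0
  then show ?case using assms(3) continuous_on_compose2[of V g U f] by simp
next
  case (Suc k)
  let ?f' = "\<lambda>x. frechet_derivative f (at x)" and ?g' = "\<lambda>y. frechet_derivative g (at y)"
  have d: "((\<lambda>x. g (f x)) has_derivative (\<lambda>v. \<Sum>b\<in>Basis. (?f' x v \<bullet> b) *\<^sub>R ?g' (f x) b)) (at x)"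
    if "x \<in> U" for x
  proof -
    have g: "(g has_derivative ?g' (f x)) (at (f x))"
      using Ck_on_has_derivative[OF Suc.prems(2)] that assms(3) by blast
    have "((\<lambda>x. g (f x)) has_derivative (\<lambda>v. ?g' (f x) (?f' x v))) (at x)"
      by (rule has_derivative_compose[OF Ck_on_has_derivative[OF Suc.prems(1) that] g])
    moreover have "?g' (f x) (?f' x v) = (\<Sum>b\<in>Basis. (?f' x v \<bullet> b) *\<^sub>R ?g' (f x) b)" for v
      by (rule linear_expand) (rule has_derivative_linear[OF g])
    ultimately show ?thesis by simp
  qed
  show ?case
  proof (rule Ck_onI[OF \<open>open U\<close> d])
    fix v
    have "Ck_on k (\<lambda>x. ?f' x v \<bullet> b) U" for b
      by (rule Ck_on_bounded_linear[OF bounded_linear_inner_left]) (use Suc.prems \<open>open U\<close> in auto)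
    moreover have "Ck_on k (\<lambda>x. ?g' (f x) b) U" for b
      by (rule Suc.IH) (use Suc.prems Ck_on_Suc in auto)
    ultimately show "Ck_on k (\<lambda>x. \<Sum>b\<in>Basis. (?f' x v \<bullet> b) *\<^sub>R ?g' (f x) b) U"
      by (intro Ck_on_sum Ck_on_bilinear[OF bounded_bilinear_scaleR] \<open>open U\<close>)
  qed
qed

text \<open>Since \<open>f\<close> vanishes at \<open>x\<close> and grows at most linearly from
  there, \<open>(c y - c x) *\<^sub>R f y\<close> is of lower order than \<open>y - x\<close>, so
  continuity of \<open>c\<close> is enough. In the next lemma \<open>c\<close> is a coefficient of
  an inverse whose differentiability is still to be shown.\<close>

lemma has_derivative_scaleR_continuous:
  fixes f :: "'a::euclidean_space \<Rightarrow> 'b::euclidean_space"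
  assumes f: "(f has_derivative f') (at x)" and "f x = 0" and c: "isCont c x"
  shows "((\<lambda>y. c y *\<^sub>R f y) has_derivative (\<lambda>h. c x *\<^sub>R f' h)) (at x)"
proof -
  obtain K where K: "\<And>h. norm (f' h) \<le> norm h * K"
    using bounded_linear.bounded[OF has_derivative_bounded_linear[OF f]] by blast
  have lim: "((\<lambda>y. norm (f y - f x - f' (y - x)) / norm (y - x)) \<longlongrightarrow> 0) (at x)"
    using f by (simp add: has_derivative_iff_norm)
  have "((\<lambda>y. \<bar>c y - c x\<bar> * (norm (f y - f x - f' (y - x)) / norm (y - x) + K)) \<longlongrightarrow> 0 * (0 + K)) (at x)"
    using c by (intro tendsto_intros lim) (auto simp: isCont_def LIM_zero tendsto_rabs_zero)
  then have l0: "((\<lambda>y. \<bar>c y - c x\<bar> * (norm (f y - f x - f' (y - x)) / norm (y - x) + K)) \<longlongrightarrow> 0) (at x)"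
    by simp
  have "((\<lambda>y. norm ((c y - c x) *\<^sub>R f y) / norm (y - x)) \<longlongrightarrow> 0) (at x)"
  proof (rule Lim_null_comparison[OF _ l0]) 
    show "\<forall>\<^sub>F y in at x. norm (norm ((c y - c x) *\<^sub>R f y) / norm (y - x))
       \<le> \<bar>c y - c x\<bar> * (norm (f y - f x - f' (y - x)) / norm (y - x) + K)"
    proof (rule eventually_at_topological[THEN iffD2], intro exI[of _ UNIV] conjI ballI impI)
      fix y assume "y \<noteq> x"
      then have n: "norm (y - x) > 0" by simp
      have "norm (f y) \<le> norm (f y - f x - f' (y - x)) + norm (f' (y - x))"
        using \<open>f x = 0\<close> norm_triangle_sub[of "f y" "f' (y - x)"] by simp
      also have "\<dots> \<le> norm (f y - f x - f' (y - x)) + norm (y - x) * K"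
        using K by simp
      finally have "norm (f y) / norm (y - x) \<le> norm (f y - f x - f' (y - x)) / norm (y - x) + K"
        using n by (simp add: field_simps)
      from mult_left_mono[OF this, of "\<bar>c y - c x\<bar>"]
      show "norm (norm ((c y - c x) *\<^sub>R f y) / norm (y - x))
       \<le> \<bar>c y - c x\<bar> * (norm (f y - f x - f' (y - x)) / norm (y - x) + K)"
        by simp
    qed auto
  qed
  then have "((\<lambda>y. (c y - c x) *\<^sub>R f y) has_derivative (\<lambda>h. 0)) (at x)"
    using \<open>f x = 0\<close> by (simp add: has_derivative_iff_norm)
  from has_derivative_add[OF has_derivative_scaleR_right[OF f, of "c x"] this] show ?thesis
    by (simp add: algebra_simps)
qed

text \<open>Everything follows from the resolvent identity
  \<open>B y - B x = - B x (A y - A x) B y\<close>: continuity of the inverses, their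
  differentiability, and a formula for the derivative in terms of \<open>B\<close> and the
  derivative of \<open>A\<close>, through which each order of smoothness passes from
  \<open>A\<close> to \<open>B\<close>.\<close>

lemma Ck_on_inverse_family:
  fixes A :: "'e::euclidean_space \<Rightarrow> 'a::euclidean_space \<Rightarrow> 'b::euclidean_space"
  assumes "open U" and lin: "\<And>y. y \<in> U \<Longrightarrow> linear (A y)"
    and AB: "\<And>y w. y \<in> U \<Longrightarrow> A y (B y w) = w" and BA: "\<And>y u. y \<in> U \<Longrightarrow> B y (A y u) = u"
    and "\<And>b. Ck_on k (\<lambda>y. A y b) U"
  shows "Ck_on k (\<lambda>y. B y v) U"
proof -
  have linB: "linear (B x)" if "x \<in> U" for x
  proof (rule linearI)
    fix a b c
    have "A x (B x a + B x b) = a + b" "A x (c *\<^sub>R B x a) = c *\<^sub>R a"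
      using AB[OF that] linear_add[OF lin[OF that]] linear_scale[OF lin[OF that]] by simp_all
    then show "B x (a + b) = B x a + B x b" "B x (c *\<^sub>R a) = c *\<^sub>R B x a"
      using BA[OF that] by metis+
  qed
  have bl: "bounded_linear (B x)" if "x \<in> U" for x
    using linB[OF that] linear_conv_bounded_linear by blast
  have eq: "B y v - B x v = - B x (\<Sum>b\<in>Basis. (B y v \<bullet> b) *\<^sub>R (A y b - A x b))" if "x \<in> U" "y \<in> U" for x y v
  proof -
    have "(\<Sum>b\<in>Basis. (B y v \<bullet> b) *\<^sub>R (A y b - A x b)) = A y (B y v) - A x (B y v)"
      using linear_expand[OF lin[OF that(1)], of "B y v"] linear_expand[OF lin[OF that(2)], of "B y v"]
      by (simp add: algebra_simps sum_subtractf)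
    then show ?thesis
      using AB BA linear_diff[OF linB] that by simp
  qed
  have cont: "isCont (\<lambda>y. B y v) x" if x: "x \<in> U" and cA: "\<And>b. isCont (\<lambda>y. A y b) x" for x v
  proof -
    obtain C0 where C0: "\<And>w. norm (B x w) \<le> norm w * C0" "C0 > 0"
      using bounded_linear.pos_bounded[OF bl[OF x]] by blast
    define \<eta> where "\<eta> y = C0 * (\<Sum>b\<in>Basis. norm (A y b - A x b))" for y
    have \<eta>0: "(\<eta> \<longlongrightarrow> 0) (at x)"
    proof -
      have "(\<eta> \<longlongrightarrow> C0 * (\<Sum>b\<in>(Basis::'a set). 0)) (at x)"
        unfolding \<eta>_def using cA by (intro tendsto_intros) (auto simp: isCont_def LIM_zero tendsto_norm_zero)
      then show ?thesis by simp
    qed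
    have bd: "norm (B y v - B x v) \<le> norm (B y v) * \<eta> y" if "y \<in> U" for y
    proof -
      have "norm (B y v - B x v) \<le> norm (\<Sum>b\<in>Basis. (B y v \<bullet> b) *\<^sub>R (A y b - A x b)) * C0"
        using eq[OF x that] C0(1) by simp
      also have "\<dots> \<le> (\<Sum>b\<in>Basis. norm (B y v) * norm (A y b - A x b)) * C0"
        using C0(2) by (intro mult_right_mono order_trans[OF norm_sum] sum_mono)
           (auto intro!: mult_right_mono simp: Basis_le_norm)
      finally show ?thesis by (simp add: \<eta>_def sum_distrib_left mult_ac)
    qed
    \<comment> \<open>The bound \<open>bd\<close> has the unknown \<open>B y v\<close> on its
      right-hand side; once \<open>\<eta> y < 1/2\<close>, it is absorbed on the left and only
      \<open>B x v\<close> remains.\<close>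
    have ev: "\<forall>\<^sub>F y in at x. norm (B y v - B x v) \<le> 2 * norm (B x v) * \<eta> y"
    proof -
      have "\<forall>\<^sub>F y in at x. y \<in> U"
        using \<open>open U\<close> x by (rule eventually_at_in_open')
      moreover have "\<forall>\<^sub>F y in at x. \<eta> y < 1/2"
        by (rule order_tendstoD(2)[OF \<eta>0]) simp
      ultimately show ?thesis
      proof eventually_elim
        case (elim y)
        have e0: "\<eta> y \<ge> 0" unfolding \<eta>_def using C0(2) by (intro mult_nonneg_nonneg sum_nonneg) auto
        have "norm (B y v) \<le> norm (B x v) + norm (B y v - B x v)"
          by (metis norm_triangle_sub)
        also have "\<dots> \<le> norm (B x v) + norm (B y v) * (1/2)"
          using bd[OF elim(1)] mult_left_mono[of "\<eta> y" "1/2" "norm (B y v)"] elim(2) by simp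
        finally have "norm (B y v) \<le> 2 * norm (B x v)" by simp
        from mult_right_mono[OF this e0] show ?case using bd[OF elim(1)] by linarith
      qed
    qed
    have "((\<lambda>y. 2 * norm (B x v) * \<eta> y) \<longlongrightarrow> 2 * norm (B x v) * 0) (at x)"
      by (intro tendsto_intros \<eta>0)
    then have "((\<lambda>y. B y v - B x v) \<longlongrightarrow> 0) (at x)"
      using Lim_null_comparison[OF ev] by simp
    then show ?thesis using LIM_zero_iff isCont_def by blast
  qed
  show ?thesis
    using assms(5)
  proof (induction k arbitrary: v)
    case 0
    then show ?case
      using \<open>open U\<close> cont by (auto simp: continuous_on_eq_continuous_at)
  next
    case (Suc k)
    let ?A' = "\<lambda>x b. frechet_derivative (\<lambda>y. A y b) (at x)"
    have cA: "isCont (\<lambda>y. A y b) x" if "x \<in> U" for x b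
      using Ck_on_has_derivative[OF Suc.prems that] has_derivative_continuous by blast
    have IH: "Ck_on k (\<lambda>y. B y v) U" for v
      using Suc.IH Suc.prems Ck_on_Suc by blast
    have d: "((\<lambda>y. B y v) has_derivative 
       (\<lambda>h. \<Sum>b\<in>Basis. \<Sum>c\<in>Basis. - ((B x v \<bullet> b) * (?A' x b h \<bullet> c)) *\<^sub>R B x c)) (at x)" if x: "x \<in> U" for x
    proof -
      have "((\<lambda>y. (B y v \<bullet> b) *\<^sub>R (A y b - A x b)) has_derivative (\<lambda>h. (B x v \<bullet> b) *\<^sub>R ?A' x b h)) (at x)" for b
      proof (rule has_derivative_scaleR_continuous)
        show "((\<lambda>y. A y b - A x b) has_derivative ?A' x b) (at x)"
          using has_derivative_diff[OF Ck_on_has_derivative[OF Suc.prems x] has_derivative_const] by simp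
        show "isCont (\<lambda>y. B y v \<bullet> b) x"
          using cont[OF x cA[OF x]] by (intro continuous_intros)
      qed auto
      then have "((\<lambda>y. \<Sum>b\<in>Basis. (B y v \<bullet> b) *\<^sub>R (A y b - A x b)) has_derivative 
                   (\<lambda>h. \<Sum>b\<in>Basis. (B x v \<bullet> b) *\<^sub>R ?A' x b h)) (at x)"
        by (intro has_derivative_sum)
      then have "((\<lambda>y. B x v + - B x (\<Sum>b\<in>Basis. (B y v \<bullet> b) *\<^sub>R (A y b - A x b))) has_derivative 
                   (\<lambda>h. 0 + - B x (\<Sum>b\<in>Basis. (B x v \<bullet> b) *\<^sub>R ?A' x b h))) (at x)"
        by (intro has_derivative_add has_derivative_const has_derivative_minus bounded_linear.has_derivative[OF bl[OF x]])
      then have "((\<lambda>y. B y v) has_derivative 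
                   (\<lambda>h. 0 + - B x (\<Sum>b\<in>Basis. (B x v \<bullet> b) *\<^sub>R ?A' x b h))) (at x)"
        by (rule has_derivative_transform_within_open[OF _ \<open>open U\<close> x]) (simp add: eq[OF x, symmetric])
      moreover have "0 + - B x (\<Sum>b\<in>Basis. (B x v \<bullet> b) *\<^sub>R ?A' x b h) =
           (\<Sum>b\<in>Basis. \<Sum>c\<in>Basis. - ((B x v \<bullet> b) * (?A' x b h \<bullet> c)) *\<^sub>R B x c)" for h
      proof -
        have "B x (?A' x b h) = (\<Sum>c\<in>Basis. (?A' x b h \<bullet> c) *\<^sub>R B x c)" for b
          by (rule linear_expand[OF linB[OF x]])
        then show ?thesis
          by (simp add: linear_sum[OF linB[OF x]] linear_scale[OF linB[OF x]] scaleR_sum_right sum_negf)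
      qed
      ultimately show ?thesis by simp
    qed
    show ?case
    proof (rule Ck_onI[OF \<open>open U\<close> d])
      fix h
      have "Ck_on k (\<lambda>x. ?A' x b h) U" for b using Suc.prems by simp
      then show "Ck_on k (\<lambda>x. \<Sum>b\<in>Basis. \<Sum>c\<in>Basis. - ((B x v \<bullet> b) * (?A' x b h \<bullet> c)) *\<^sub>R B x c) U"
        by (intro Ck_on_sum \<open>open U\<close> Ck_on_bilinear[OF bounded_bilinear_scaleR] IH
          Ck_on_bounded_linear[OF bounded_linear_minus[OF bounded_linear_ident]]
          Ck_on_bilinear[OF bounded_bilinear_mult] Ck_on_bounded_linear[OF bounded_linear_inner_left])
    qed
  qed
qed

text \<open>The derivative of \<open>g\<close> at \<open>y\<close> inverts that of \<open>f\<close>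
  at \<open>g y\<close>, so smoothness of \<open>g\<close> of one order makes this family of
  inverses smooth of the same order and thereby \<open>g\<close> smooth of the next. Losing one
  order against \<open>f\<close> is harmless, as the result is used for smooth
  \<open>f\<close>.\<close>

lemma Ck_on_local_inverse:
  fixes f :: "'a::euclidean_space \<Rightarrow> 'b::euclidean_space"
  assumes "open U" and "open V" and f: "Ck_on (Suc k) f U"
    and g: "\<And>y. y \<in> V \<Longrightarrow> (g has_derivative g' y) (at y)" and gV: "g ` V \<subseteq> U"
    and inv: "\<And>y w. y \<in> V \<Longrightarrow> frechet_derivative f (at (g y)) (g' y w) = w"
             "\<And>y u. y \<in> V \<Longrightarrow> g' y (frechet_derivative f (at (g y)) u) = u"
  shows "Ck_on k g V"
  using f
proof (induction k)
  case 0
  then show ?case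
    using has_derivative_continuous[OF g] by (simp add: continuous_at_imp_continuous_on)
next
  case (Suc k)
  have IH: "Ck_on k g V"
    by (rule Suc.IH[OF Ck_on_Suc[OF Suc.prems]])
  show ?case
  proof (rule Ck_onI[OF \<open>open V\<close> g])
    fix v
    show "Ck_on k (\<lambda>y. g' y v) V"
    proof (rule Ck_on_inverse_family[where A="\<lambda>y. frechet_derivative f (at (g y))"])
      show "linear (frechet_derivative f (at (g y)))" if "y \<in> V" for y
        by (rule has_derivative_linear[OF Ck_on_has_derivative[OF Ck_on_Suc[OF Suc.prems]]]) (use gV that in auto)
      show "Ck_on k (\<lambda>y. frechet_derivative f (at (g y)) b) V" for b
        by (rule Ck_on_compose[where g="\<lambda>x. frechet_derivative f (at x) b", OF \<open>open V\<close> \<open>open U\<close> gV IH])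
          (use Ck_on_Suc[OF Suc.prems] in simp)
    qed (use assms in auto)
  qed
qed

lemma smooth_on_has_derivative:
  "smooth_on f U \<Longrightarrow> x \<in> U \<Longrightarrow> (f has_derivative frechet_derivative f (at x)) (at x)"
  unfolding smooth_on_def using Ck_on_has_derivative by blast

lemma smooth_on_imp_continuous_on: "smooth_on f U \<Longrightarrow> continuous_on U f"
  unfolding smooth_on_def by (metis Ck_on.simps(1))

lemma smooth_on_derivative: "smooth_on f U \<Longrightarrow> smooth_on (\<lambda>x. frechet_derivative f (at x) v) U"
  unfolding smooth_on_def by (metis Ck_on.simps(2))

lemma smooth_on_inverse_function:
  fixes f :: "'a::euclidean_space \<Rightarrow> 'b::euclidean_space"
  assumes "open U" and "open V" and "smooth_on f U"
    and "\<And>y. y \<in> V \<Longrightarrow> (g has_derivative g' y) (at y)" and "g ` V \<subseteq> U"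
    and "\<And>y w. y \<in> V \<Longrightarrow> frechet_derivative f (at (g y)) (g' y w) = w"
        "\<And>y u. y \<in> V \<Longrightarrow> g' y (frechet_derivative f (at (g y)) u) = u"
  shows "smooth_on g V"
  using Ck_on_local_inverse[OF assms(1,2) _ assms(4-7)] assms(3) unfolding smooth_on_def by blast

lemma smooth_on_cong: "open U \<Longrightarrow> (\<And>x. x \<in> U \<Longrightarrow> f x = g x) \<Longrightarrow> smooth_on f U \<Longrightarrow> smooth_on g U"
  unfolding smooth_on_def using Ck_on_cong by blast

lemma smooth_on_subset: "smooth_on f U \<Longrightarrow> V \<subseteq> U \<Longrightarrow> smooth_on f V"
  unfolding smooth_on_def using Ck_on_subset by blast

lemma smooth_on_local: "(\<And>x. x \<in> U \<Longrightarrow> \<exists>V. open V \<and> x \<in> V \<and> smooth_on f V) \<Longrightarrow> smooth_on f U"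
  unfolding smooth_on_def by (metis Ck_on_local)

lemma smooth_on_const: "smooth_on (\<lambda>x. c) U"
  unfolding smooth_on_def using Ck_on_const by blast

lemma smooth_on_ident: "open U \<Longrightarrow> smooth_on (\<lambda>x. x) U"
  unfolding smooth_on_def using Ck_on_ident by blast

lemma smooth_on_bounded_linear:
  "bounded_linear L \<Longrightarrow> open U \<Longrightarrow> smooth_on f U \<Longrightarrow> smooth_on (\<lambda>x. L (f x)) U"
  by (simp add: smooth_on_def Ck_on_bounded_linear)

lemma smooth_on_linear:
  fixes L :: "'b::euclidean_space \<Rightarrow> 'c::euclidean_space"
  shows "linear L \<Longrightarrow> open U \<Longrightarrow> smooth_on f U \<Longrightarrow> smooth_on (\<lambda>x. L (f x)) U"
  by (simp add: smooth_on_bounded_linear linear_conv_bounded_linear)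

lemma smooth_on_add:
  "open U \<Longrightarrow> smooth_on f U \<Longrightarrow> smooth_on g U \<Longrightarrow> smooth_on (\<lambda>x. f x + g x) U"
  unfolding smooth_on_def using Ck_on_add by blast

lemma smooth_on_minus: "open U \<Longrightarrow> smooth_on f U \<Longrightarrow> smooth_on (\<lambda>x. - f x) U"
  by (rule smooth_on_bounded_linear[OF bounded_linear_minus[OF bounded_linear_ident]])

lemma smooth_on_diff:
  "open U \<Longrightarrow> smooth_on f U \<Longrightarrow> smooth_on g U \<Longrightarrow> smooth_on (\<lambda>x. f x - g x) U"
  using smooth_on_add[of U f "\<lambda>x. - g x"] smooth_on_minus[of U g] by simp

lemma smooth_on_sum:
  "open U \<Longrightarrow> (\<And>i. i \<in> I \<Longrightarrow> smooth_on (f i) U) \<Longrightarrow> smooth_on (\<lambda>x. \<Sum>i\<in>I. f i x) U"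
  by (simp add: smooth_on_def Ck_on_sum)

lemma smooth_on_bilinear:
  "bounded_bilinear B \<Longrightarrow> open U \<Longrightarrow> smooth_on f U \<Longrightarrow> smooth_on g U \<Longrightarrow> smooth_on (\<lambda>x. B (f x) (g x)) U"
  by (simp add: smooth_on_def Ck_on_bilinear)

lemmas smooth_on_scaleR = smooth_on_bilinear[OF bounded_bilinear_scaleR]
lemmas smooth_on_inner = smooth_on_bilinear[OF bounded_bilinear_inner]

lemma smooth_on_mult:
  fixes f g :: "'a::euclidean_space \<Rightarrow> 'b::{euclidean_space, real_normed_algebra}"
  shows "open U \<Longrightarrow> smooth_on f U \<Longrightarrow> smooth_on g U \<Longrightarrow> smooth_on (\<lambda>x. f x * g x) U"
  by (rule smooth_on_bilinear[OF bounded_bilinear_mult])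

lemma smooth_on_power2:
  fixes f :: "'a::euclidean_space \<Rightarrow> real"
  shows "open U \<Longrightarrow> smooth_on f U \<Longrightarrow> smooth_on (\<lambda>x. (f x)\<^sup>2) U"
  unfolding power2_eq_square by (rule smooth_on_mult)

lemma smooth_on_compose:
  assumes "open U" and "open V" and "f ` U \<subseteq> V" and "smooth_on f U" and "smooth_on g V"
  shows "smooth_on (\<lambda>x. g (f x)) U"
  using assms Ck_on_compose unfolding smooth_on_def by blast

lemma smooth_on_compose_UNIV:
  "open U \<Longrightarrow> smooth_on g UNIV \<Longrightarrow> smooth_on f U \<Longrightarrow> smooth_on (\<lambda>x. g (f x)) U"
  by (rule smooth_on_compose[of U UNIV]) auto

lemma smooth_on_euclidean:
  fixes f :: "'a::euclidean_space \<Rightarrow> 'b::euclidean_space"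
  assumes "open U" and "\<And>b. b \<in> Basis \<Longrightarrow> smooth_on (\<lambda>x. f x \<bullet> b) U"
  shows "smooth_on f U"
proof -
  have "smooth_on (\<lambda>x. \<Sum>b\<in>Basis. (f x \<bullet> b) *\<^sub>R b) U"
    by (intro smooth_on_sum smooth_on_scaleR smooth_on_const assms)
  then show ?thesis by (simp add: euclidean_representation)
qed

lemma smooth_on_vec_nth: "open U \<Longrightarrow> smooth_on f U \<Longrightarrow> smooth_on (\<lambda>x. f x $ i) U"
  by (rule smooth_on_bounded_linear[OF bounded_linear_vec_nth])

lemma smooth_on_vec_lambda:
  fixes f :: "'n::finite \<Rightarrow> 'a::euclidean_space \<Rightarrow> 'b::euclidean_space"
  assumes "open U" and f: "\<And>i. smooth_on (f i) U"
  shows "smooth_on (\<lambda>x. \<chi> i. f i x) U"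
proof (rule smooth_on_euclidean[OF \<open>open U\<close>])
  fix b :: "'b ^ 'n" assume "b \<in> Basis"
  then obtain i u where "b = axis i u" by (auto simp: Basis_vec_def)
  then show "smooth_on (\<lambda>x. (\<chi> i. f i x) \<bullet> b) U"
    by (simp add: inner_axis smooth_on_inner smooth_on_const assms)
qed

lemma smooth_on_Pair:
  assumes "open U" and "smooth_on f U" and "smooth_on g U"
  shows "smooth_on (\<lambda>x. (f x, g x)) U"
proof -
  have l: "bounded_linear (\<lambda>y. (y, 0::'c))" "bounded_linear (\<lambda>z. (0::'b, z))"
    by (intro bounded_linear_Pair bounded_linear_ident bounded_linear_zero)+
  show ?thesis
    using smooth_on_add[OF assms(1) smooth_on_bounded_linear[OF l(1) assms(1,2)]
        smooth_on_bounded_linear[OF l(2) assms(1,3)]] by simp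
qed

lemma smooth_on_fst: "open U \<Longrightarrow> smooth_on f U \<Longrightarrow> smooth_on (\<lambda>x. fst (f x)) U"
  by (rule smooth_on_bounded_linear[OF bounded_linear_fst])

lemma smooth_on_snd: "open U \<Longrightarrow> smooth_on f U \<Longrightarrow> smooth_on (\<lambda>x. snd (f x)) U"
  by (rule smooth_on_bounded_linear[OF bounded_linear_snd])

lemma smooth_on_inverse_real: "smooth_on inverse {x::real. x \<noteq> 0}"
proof -
  have o: "open {x::real. x \<noteq> 0}" by (simp add: open_Collect_neq)
  have "Ck_on k inverse {x::real. x \<noteq> 0}" for k
  proof (induction k)
    case 0
    then show ?case by (auto intro: continuous_intros)
  next
    case (Suc k)
    have d: "(inverse has_derivative (\<lambda>v. - (inverse x * v * inverse x))) (at x)" if "x \<in> {x::real. x \<noteq> 0}" for x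
      using that by (intro has_derivative_inverse') simp
    show ?case
    proof (rule Ck_onI[OF o d])
      fix v :: real
      have "Ck_on k (\<lambda>x. inverse x * v * inverse x) {x::real. x \<noteq> 0}"
        by (intro Ck_on_bilinear[OF bounded_bilinear_mult] Ck_on_const o Suc)
      then show "Ck_on k (\<lambda>x. - (inverse x * v * inverse x)) {x::real. x \<noteq> 0}"
        by (rule Ck_on_bounded_linear[OF bounded_linear_minus[OF bounded_linear_ident] _ o])
    qed
  qed
  then show ?thesis unfolding smooth_on_def by blast
qed

lemma smooth_on_divide:
  fixes f g :: "'a::euclidean_space \<Rightarrow> real"
  assumes "open U" and "smooth_on f U" and "smooth_on g U" and "\<And>x. x \<in> U \<Longrightarrow> g x \<noteq> 0"
  shows "smooth_on (\<lambda>x. f x / g x) U"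
proof -
  have "smooth_on (\<lambda>x. inverse (g x)) U"
    by (rule smooth_on_compose[OF assms(1) _ _ assms(3) smooth_on_inverse_real])
      (use assms(4) in \<open>auto simp: open_Collect_neq\<close>)
  then show ?thesis
    using assms by (simp add: divide_inverse smooth_on_mult)
qed

lemma has_derivative_cis: "(cis has_derivative (\<lambda>v. v *\<^sub>R (\<i> * cis x))) (at x)"
proof -
  have "((\<lambda>x. \<i> * of_real x) has_vector_derivative \<i>) (at x)"
    by (auto intro!: derivative_eq_intros simp: has_vector_derivative_def scaleR_conv_of_real)
  from field_vector_diff_chain_at[OF this DERIV_exp] show ?thesis
    by (simp add: has_vector_derivative_def cis_conv_exp[abs_def] o_def)
qed

lemma smooth_on_cis: "smooth_on cis UNIV"
proof -
  have "Ck_on k cis UNIV" for k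
  proof (induction k)
    case 0
    then show ?case by (simp add: cis_conv_exp continuous_intros)
  next
    case (Suc k)
    show ?case
      by (rule Ck_onI[OF open_UNIV has_derivative_cis])
        (intro Ck_on_bilinear[OF bounded_bilinear_scaleR] Ck_on_const Ck_on_bilinear[OF bounded_bilinear_mult] Suc open_UNIV)
  qed
  then show ?thesis unfolding smooth_on_def by blast
qed

text \<open>The inverse function theorem asks for a derivative that is continuous as an operator; in
  finite dimension this follows from continuity in each basis direction. It returns a differentiable
  inverse, whose smoothness comes from the preceding bootstrap.\<close>

lemma smooth_local_inverse:
  fixes f :: "'a::euclidean_space \<Rightarrow> 'a"
  assumes "open U" and "smooth_on f U" and "x \<in> U" and inj: "inj (frechet_derivative f (at x))"
  obtains U' V g where "open U'" "U' \<subseteq> U" "x \<in> U'" "open V" "f x \<in> V" "homeomorphism U' V f g" "smooth_on g V"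
proof -
  let ?D = "\<lambda>x. frechet_derivative f (at x)"
  have D: "(f has_derivative ?D x) (at x)" if "x \<in> U" for x
    using smooth_on_has_derivative assms that by blast
  define f' where "f' x = Blinfun (?D x)" for x
  have f': "blinfun_apply (f' x) = ?D x" if "x \<in> U" for x
    unfolding f'_def by (rule bounded_linear_Blinfun_apply) (rule has_derivative_bounded_linear[OF D[OF that]])
  have c: "continuous_on U f'"
  proof (rule continuous_on_blinfun_componentwise)
    fix i :: 'a
    have "continuous_on U (\<lambda>x. ?D x i)"
      using smooth_on_imp_continuous_on[OF smooth_on_derivative[OF assms(2)]] .
    then show "continuous_on U (\<lambda>x. blinfun_apply (f' x) i)"
      using f' by (simp cong: continuous_on_cong)
  qed
  obtain h where h: "linear h" "h \<circ> ?D x = id"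
    using linear_injective_left_inverse[OF has_derivative_linear[OF D[OF assms(3)]] inj] by blast
  have bh: "blinfun_apply (Blinfun h) = h"
    using h(1) by (simp add: bounded_linear_Blinfun_apply linear_conv_bounded_linear)
  have i: "Blinfun h o\<^sub>L f' x = id_blinfun"
    by (rule blinfun_eqI) (use h(2) in \<open>simp add: bh f'[OF assms(3)] fun_eq_iff\<close>)
  have dd: "(f has_derivative blinfun_apply (f' x)) (at x)" if "x \<in> U" for x
    using D[OF that] f'[OF that] by simp
  obtain U' V g g' where r: "open U'" "U' \<subseteq> U" "x \<in> U'" "open V" "f x \<in> V" "homeomorphism U' V f g"
    "\<And>y. y \<in> V \<Longrightarrow> (g has_derivative (g' y)) (at y)"
    "\<And>y. y \<in> V \<Longrightarrow> g' y = inv (blinfun_apply (f'(g y)))"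
    "\<And>y. y \<in> V \<Longrightarrow> bij (blinfun_apply (f'(g y)))"
    using inverse_function_theorem[OF assms(1) dd c assms(3) i] by metis
  have gU: "g ` V \<subseteq> U" using r by (auto simp: homeomorphism_def)
  have "smooth_on g V"
  proof (rule smooth_on_inverse_function[OF assms(1) r(4) assms(2) r(7) gU])
    fix y w assume y: "y \<in> V"
    have "g y \<in> U" using gU y by auto
    show "?D (g y) (g' y w) = w" "g' y (?D (g y) w) = w"
      unfolding r(8)[OF y] using r(9)[OF y] f'[OF \<open>g y \<in> U\<close>] 
      by (auto simp: bij_is_surj surj_f_inv_f bij_is_inj)
  qed auto
  then show ?thesis using that r by blast
qed

section \<open>A smooth cutoff function\<close>

text \<open>The extra power makes the family closed, up to linear combinations, under
  differentiation, so one induction over all \<open>k\<close> proves that \<open>exp(-1/t)\<close>,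
  extended by 0, is smooth.\<close>

definition exp_recip :: "nat \<Rightarrow> real \<Rightarrow> real" where
  "exp_recip k t = (if t > 0 then exp (- inverse t) * inverse t ^ k else 0)"

text \<open>A single term of the exponential series, the one of order \<open>k + 2\<close>, bounds
  \<open>exp (inverse t)\<close> from below. The quadratic factor that is gained forces a vanishing
  derivative at 0.\<close>

lemma exp_recip_bound: "\<bar>exp_recip k t\<bar> \<le> fact (k + 2) * t\<^sup>2"
proof (cases "t > 0")
  case True
  have "inverse t ^ (k + 2) / fact (k + 2) \<le> exp (inverse t)"
  proof -
    have "(\<Sum>n\<in>{k+2}. inverse (fact n) * inverse t ^ n) \<le> (\<Sum>n. inverse (fact n) * inverse t ^ n)"
      using True by (intro sum_le_suminf summable_exp) auto
    also have "\<dots> = exp (inverse t)"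
      by (simp add: exp_def scaleR_conv_of_real field_simps)
    finally show ?thesis by (simp add: divide_inverse mult_ac)
  qed
  then have "inverse t ^ (k + 2) \<le> fact (k + 2) * exp (inverse t)"
    by (simp only: divide_le_eq fact_gt_zero if_True mult.commute)
  then have "exp (- inverse t) * inverse t ^ (k + 2) \<le> exp (- inverse t) * (fact (k + 2) * exp (inverse t))"
    by (rule mult_left_mono) simp
  also have "\<dots> = fact (k + 2) * (exp (- inverse t) * exp (inverse t))"
    by (simp only: mult_ac)
  also have "\<dots> = fact (k + 2)"
    by (simp only: exp_minus_inverse mult.commute mult_1_left)
  finally have "exp (- inverse t) * inverse t ^ (k + 2) \<le> fact (k + 2)" .
  from mult_right_mono[OF this, of "t\<^sup>2"]
  have "exp (- inverse t) * inverse t ^ k * (inverse t * t)\<^sup>2 \<le> fact (k + 2) * t\<^sup>2"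
    by (simp add: power_add power2_eq_square mult_ac del: fact_Suc)
  then show ?thesis
    using True by (simp add: exp_recip_def del: fact_Suc)
qed (simp add: exp_recip_def)

lemma has_derivative_exp_recip:
  "(exp_recip k has_derivative (\<lambda>v. v * (exp_recip (k + 2) t - k * exp_recip (k + 1) t))) (at t)"
proof -
  consider "t > 0" | "t < 0" | "t = 0" by linarith
  then show ?thesis
  proof cases
    case 1
    have "((\<lambda>t. exp (- inverse t) * inverse t ^ k) has_real_derivative
        exp_recip (k + 2) t - k * exp_recip (k + 1) t) (at t)"
    proof -
      have "real k * inverse t ^ (k - 1) * inverse t = real k * inverse t ^ k"
        by (cases k) auto
      then have *: "real k * (inverse t ^ (k - Suc 0) * (inverse t * inverse t)) = real k * inverse t ^ (k + 1)"
        by (cases k) (simp_all add: mult_ac)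
      have "((\<lambda>t. exp (- inverse t) * inverse t ^ k) has_real_derivative
         exp (- inverse t) * (inverse t * inverse t) * inverse t ^ k
         + - (real k * (inverse t ^ (k - Suc 0) * (inverse t * inverse t))) * exp (- inverse t)) (at t)"
        using 1 by (auto intro!: derivative_eq_intros simp: algebra_simps)
      also have "exp (- inverse t) * (inverse t * inverse t) * inverse t ^ k
         + - (real k * (inverse t ^ (k - Suc 0) * (inverse t * inverse t))) * exp (- inverse t)
         = exp_recip (k + 2) t - k * exp_recip (k + 1) t"
        unfolding * using 1 by (simp add: exp_recip_def power_add power2_eq_square mult_ac)
      finally show ?thesis .
    qed
    then have "(exp_recip k has_real_derivative exp_recip (k + 2) t - k * exp_recip (k + 1) t) (at t)"
      by (rule has_field_derivative_transform_within_open[OF _ open_greaterThan[of 0]])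
         (use 1 in \<open>auto simp: exp_recip_def\<close>)
    then show ?thesis by (simp add: has_field_derivative_def mult_commute_abs)
  next
    case 2
    have "((\<lambda>_. 0) has_real_derivative 0) (at t)" by simp
    then have "(exp_recip k has_real_derivative 0) (at t)"
      by (rule has_field_derivative_transform_within_open[OF _ open_lessThan[of 0]])
         (use 2 in \<open>auto simp: exp_recip_def\<close>)
    then show ?thesis using 2 by (simp add: has_field_derivative_def exp_recip_def flip: lambda_zero)
  next
    case 3
    have "((\<lambda>y. norm (exp_recip k y - exp_recip k 0) / norm y) \<longlongrightarrow> 0) (at 0)"
    proof (rule Lim_null_comparison)
      show "\<forall>\<^sub>F y in at 0. norm (norm (exp_recip k y - exp_recip k 0) / norm y) \<le> fact (k + 2) * \<bar>y\<bar>"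
      proof (rule eventually_at_topological[THEN iffD2], intro exI[of _ UNIV] conjI ballI impI)
        fix y :: real assume "y \<noteq> 0"
        then show "norm (norm (exp_recip k y - exp_recip k 0) / norm y) \<le> fact (k + 2) * \<bar>y\<bar>"
          using exp_recip_bound[of k y] 
          by (simp add: exp_recip_def[of k 0] divide_le_eq power2_eq_square mult.assoc flip: abs_mult)
      qed auto
      have "((\<lambda>y::real. fact (k + 2) * \<bar>y\<bar>) \<longlongrightarrow> fact (k + 2) * \<bar>0\<bar>) (at 0)"
        by (intro tendsto_intros)
      then show "((\<lambda>y::real. fact (k + 2) * \<bar>y\<bar>) \<longlongrightarrow> 0) (at 0)" by simp
    qed
    then show ?thesis using 3 by (simp add: has_derivative_iff_norm exp_recip_def[of _ 0])
  qed
qed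

lemma smooth_on_exp_recip: "smooth_on (exp_recip k) UNIV"
proof -
  have "Ck_on n (exp_recip k) UNIV" for n
  proof (induction n arbitrary: k)
    case 0
    then show ?case
      using has_derivative_continuous[OF has_derivative_exp_recip] by (simp add: continuous_at_imp_continuous_on)
  next
    case (Suc n)
    have "Ck_on n (\<lambda>t. exp_recip (k + 2) t + (- k) * exp_recip (k + 1) t) UNIV"
      by (intro Ck_on_add Ck_on_bilinear[OF bounded_bilinear_mult] Ck_on_const Suc open_UNIV)
    then have "Ck_on n (\<lambda>t. v * (exp_recip (k + 2) t - k * exp_recip (k + 1) t)) UNIV" for v
      by (intro Ck_on_bilinear[OF bounded_bilinear_mult] Ck_on_const open_UNIV) simp
    then show ?case
      by (intro Ck_onI[OF open_UNIV has_derivative_exp_recip]) blast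
  qed
  then show ?thesis by (simp add: smooth_on_def)
qed

text \<open>The argument will always be a squared length. The value 1 is kept up to 2 so that
  vectors whose real and imaginary parts both have norm at most 1 are not cut off.\<close>

definition cutoff :: "real \<Rightarrow> real" where
  "cutoff s = exp_recip 0 (3 - s) / (exp_recip 0 (3 - s) + exp_recip 0 (s - 2))"

lemma cutoff_eq_1: "s \<le> 2 \<Longrightarrow> cutoff s = 1"
  by (simp add: cutoff_def exp_recip_def)

lemma cutoff_eq_0: "s \<ge> 3 \<Longrightarrow> cutoff s = 0"
  by (simp add: cutoff_def exp_recip_def)

lemma cutoff_01: "0 \<le> cutoff s" "cutoff s \<le> 1"
proof -
  have "0 \<le> exp_recip 0 t" for t by (simp add: exp_recip_def)
  then show "0 \<le> cutoff s" "cutoff s \<le> 1"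
    unfolding cutoff_def by (auto simp: divide_le_eq_1 intro: divide_nonneg_nonneg)
      (meson add_increasing add_nonneg_nonneg linorder_not_le order_le_imp_less_or_eq)+
qed

lemma smooth_on_cutoff: "smooth_on cutoff UNIV"
proof -
  have "exp_recip 0 (3 - s) + exp_recip 0 (s - 2) \<noteq> 0" for s
  proof -
    have "exp_recip 0 (3 - s) + exp_recip 0 (s - 2) > 0"
      by (auto simp: exp_recip_def add_pos_pos)
    then show ?thesis by simp
  qed
  moreover have e: "smooth_on (\<lambda>s. exp_recip 0 (3 - s)) UNIV" "smooth_on (\<lambda>s. exp_recip 0 (s - 2)) UNIV"
    by (intro smooth_on_compose_UNIV[OF _ smooth_on_exp_recip] smooth_on_diff smooth_on_ident smooth_on_const open_UNIV)+
  ultimately have "smooth_on (\<lambda>s. exp_recip 0 (3 - s) / (exp_recip 0 (3 - s) + exp_recip 0 (s - 2))) UNIV"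
    by (intro smooth_on_divide smooth_on_add e open_UNIV)
  then show ?thesis by (simp add: cutoff_def[abs_def])
qed

section \<open>Local diffeomorphisms\<close>

text \<open>Injectivity on \<open>S\<close> is not demanded: the tube map of a periodic
  parametrisation identifies parameters that differ by a period.\<close>

definition local_diffeo_on :: "('a::euclidean_space \<Rightarrow> 'a) \<Rightarrow> 'a set \<Rightarrow> bool" where
  "local_diffeo_on H S \<longleftrightarrow> open S \<and> smooth_on H S \<and> (\<forall>x\<in>S. inj (frechet_derivative H (at x)))"

lemma local_diffeo_on_subset: "local_diffeo_on H S \<Longrightarrow> open S' \<Longrightarrow> S' \<subseteq> S \<Longrightarrow> local_diffeo_on H S'"
  unfolding local_diffeo_on_def using smooth_on_subset by blast

lemma local_diffeo_on_local_inverse: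
  assumes "local_diffeo_on H S" and "x \<in> S"
  obtains U V h where "open U" "U \<subseteq> S" "x \<in> U" "open V" "H x \<in> V" "V \<subseteq> H ` S"
    "smooth_on h V" "h ` V \<subseteq> U" "\<And>y. y \<in> V \<Longrightarrow> H (h y) = y" "\<And>x. x \<in> U \<Longrightarrow> H x \<in> V \<and> h (H x) = x"
proof -
  obtain U V h where *: "open U" "U \<subseteq> S" "x \<in> U" "open V" "H x \<in> V" "homeomorphism U V H h" "smooth_on h V"
    using smooth_local_inverse[of S H x] assms unfolding local_diffeo_on_def by blast
  show ?thesis
    by (rule that[OF *(1-5) _ *(7)]) (use *(2,6) in \<open>auto simp: homeomorphism_def\<close>)
qed

lemma open_local_diffeo_image:
  assumes "local_diffeo_on H S"
  shows "open (H ` S)"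
proof (rule openI)
  fix y assume "y \<in> H ` S"
  then obtain x where x: "x \<in> S" "y = H x" by blast
  obtain U V h where "open U" "U \<subseteq> S" "x \<in> U" "open V" "H x \<in> V" "V \<subseteq> H ` S"
    "smooth_on h V" "h ` V \<subseteq> U" "\<And>y. y \<in> V \<Longrightarrow> H (h y) = y" "\<And>x. x \<in> U \<Longrightarrow> H x \<in> V \<and> h (H x) = x"
    by (rule local_diffeo_on_local_inverse[OF assms x(1)]) blast
  then show "\<exists>e>0. ball y e \<subseteq> H ` S"
    using x by (meson open_contains_ball subset_trans)
qed

text \<open>Near each point of the image the descended map is \<open>f\<close> composed with a local
  inverse of \<open>H\<close>, hence smooth; constancy on fibres makes the choice of preimage
  irrelevant. The projection and both tube diffeomorphisms are obtained in this way.\<close>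

lemma smooth_descent:
  fixes H :: "'a::euclidean_space \<Rightarrow> 'a" and f :: "'a \<Rightarrow> 'b::euclidean_space"
  assumes H: "local_diffeo_on H S" and f: "smooth_on f S"
    and fib: "\<And>x y. x \<in> S \<Longrightarrow> y \<in> S \<Longrightarrow> H x = H y \<Longrightarrow> f x = f y"
  obtains g where "smooth_on g (H ` S)" "\<And>x. x \<in> S \<Longrightarrow> g (H x) = f x"
proof -
  define g where "g y = f (SOME x. x \<in> S \<and> H x = y)" for y
  have g: "g (H x) = f x" if "x \<in> S" for x
    unfolding g_def using fib that by (metis (mono_tags, lifting) someI_ex)
  have "smooth_on g (H ` S)"
  proof (rule smooth_on_local)
    fix y assume "y \<in> H ` S"
    then obtain x where x: "x \<in> S" "y = H x" by blast
    obtain U V h where *: "open U" "U \<subseteq> S" "x \<in> U" "open V" "H x \<in> V" "V \<subseteq> H ` S"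
      "smooth_on h V" "h ` V \<subseteq> U" "\<And>y. y \<in> V \<Longrightarrow> H (h y) = y" "\<And>x. x \<in> U \<Longrightarrow> H x \<in> V \<and> h (H x) = x"
      by (rule local_diffeo_on_local_inverse[OF H x(1)]) blast
    have "smooth_on (\<lambda>y. f (h y)) V"
      by (rule smooth_on_compose[OF *(4) _ _ *(7) f]) (use H * in \<open>auto simp: local_diffeo_on_def\<close>)
    then have "smooth_on g V"
      by (rule smooth_on_cong[OF *(4), rotated]) (use * g in \<open>metis image_subset_iff subsetD\<close>)
    then show "\<exists>V. open V \<and> y \<in> V \<and> smooth_on g V"
      using * x by blast
  qed
  then show ?thesis using that g by blast
qed

text \<open>Differentiating \<open>h (H x) = x\<close> at every point near \<open>c\<close>, where
  \<open>h\<close> is the smooth local inverse, gives a left inverse of the derivative of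
  \<open>H\<close> there.\<close>

lemma inj_frechet_derivative_local:
  assumes "open V" and "smooth_on H V" "c \<in> V" "inj (frechet_derivative H (at c))"
  obtains U where "open U" "c \<in> U" "U \<subseteq> V" "local_diffeo_on (H :: 'a::euclidean_space \<Rightarrow> 'a) U" "inj_on H U"
proof -
  obtain U V' h where *: "open U" "U \<subseteq> V" "c \<in> U" "open V'" "homeomorphism U V' H h" "smooth_on h V'"
    using smooth_local_inverse[OF assms] by metis
  have "inj (frechet_derivative H (at x))" if x: "x \<in> U" for x
  proof -
    have dH: "(H has_derivative frechet_derivative H (at x)) (at x)"
      using smooth_on_has_derivative assms(2) * x by blast
    have "(h has_derivative frechet_derivative h (at (H x))) (at (H x))"
      using smooth_on_has_derivative[OF *(6)] *(5) x by (auto simp: homeomorphism_def)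
    from has_derivative_compose[OF dH this]
    have "((\<lambda>x. x) has_derivative (\<lambda>v. frechet_derivative h (at (H x)) (frechet_derivative H (at x) v))) (at x)"
      by (rule has_derivative_transform_within_open[OF _ *(1) x]) (use *(5) in \<open>auto simp: homeomorphism_def\<close>)
    then have "(\<lambda>v. frechet_derivative h (at (H x)) (frechet_derivative H (at x) v)) = (\<lambda>v. v)"
      using has_derivative_unique[OF _ has_derivative_ident] by blast
    then show ?thesis by (metis injI)
  qed
  moreover have "inj_on H U"
    using *(5) by (metis homeomorphism_def inj_on_def)
  ultimately show ?thesis
    using that[of U] * smooth_on_subset[OF assms(2)] unfolding local_diffeo_on_def by blast
qed

section \<open>The local model\<close>

definition det2 :: "complex ^ 2 \<Rightarrow> complex ^ 2 \<Rightarrow> complex" where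
  "det2 x y = x $ 1 * y $ 2 - x $ 2 * y $ 1"

lemma det2_eq_0_iff:
  assumes "det2 x y \<noteq> 0" shows "a *s x + b *s y = 0 \<longleftrightarrow> a = 0 \<and> b = 0"
proof
  assume "a *s x + b *s y = 0"
  then have e: "a * x $ 1 + b * y $ 1 = 0" "a * x $ 2 + b * y $ 2 = 0"
    by (simp_all add: vec_eq_iff forall_2)
  have d: "a * det2 x y = y $ 2 * (a * x $ 1 + b * y $ 1) - y $ 1 * (a * x $ 2 + b * y $ 2)"
    "b * det2 x y = x $ 1 * (a * x $ 2 + b * y $ 2) - x $ 2 * (a * x $ 1 + b * y $ 1)"
    by (simp_all add: det2_def algebra_simps)
  have "a * det2 x y = 0" "b * det2 x y = 0"
    unfolding d e by simp_all
  then show "a = 0 \<and> b = 0" using assms by simp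
qed simp

lemma scaleR_eq_vector_smult: "r *\<^sub>R (x :: complex ^ 'n) = complex_of_real r *s x"
  unfolding vec_eq_iff vector_scaleR_component vector_smult_component by (simp add: scaleR_conv_of_real)

text \<open>A complex line contains \<open>\<i> *s v\<close> along with \<open>v\<close>. If both
  are real combinations of \<open>x\<close> and \<open>y\<close>, complex independence of
  \<open>x\<close> and \<open>y\<close> forces all coefficients to vanish.\<close>

lemma no_complex_line:
  assumes d: "det2 x y \<noteq> 0" and S: "\<And>v. v \<in> S \<Longrightarrow> \<exists>a b. v = a *\<^sub>R x + b *\<^sub>R y"
  shows "\<not> (\<exists>L. vec.subspace L \<and> vec.dim L = 1 \<and> L \<subseteq> S)"
proof
  assume "\<exists>L. vec.subspace L \<and> vec.dim L = 1 \<and> L \<subseteq> S"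
  then obtain L where L: "vec.subspace L" "vec.dim L = 1" "L \<subseteq> S" by blast
  have "\<not> L \<subseteq> {0}"
    using L(2) vec.dim_eq_0[of L] by simp
  then obtain v where v: "v \<in> L" "v \<noteq> 0" by blast
  have "\<i> *s v \<in> L" using L(1) v(1) by (rule vec.subspace_scale)
  then obtain a b c e where ab: "v = a *\<^sub>R x + b *\<^sub>R y" and ce: "\<i> *s v = c *\<^sub>R x + e *\<^sub>R y"
    using S L(3) v(1) by (meson subsetD)
  have "(\<i> * of_real a - of_real c) *s x + (\<i> * of_real b - of_real e) *s y = \<i> *s v - (c *\<^sub>R x + e *\<^sub>R y)"
    unfolding ab scaleR_eq_vector_smult by (simp add: vec_eq_iff algebra_simps)
  also have "\<dots> = 0" using ce by simp
  finally have "\<i> * of_real a - of_real c = 0 \<and> \<i> * of_real b - of_real e = 0"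
    by (rule det2_eq_0_iff[OF d, THEN iffD1])
  then have "a = 0" "b = 0" by (auto simp: complex_eq_iff)
  then show False using v(2) ab by simp
qed

text \<open>Vectors that are dependent over the complex numbers but not over the reals satisfy
  \<open>y = l *s x\<close> with non-real \<open>l\<close>. Then 1 and \<open>l\<close> span the
  complex numbers over the reals, so the real span of \<open>x\<close> and \<open>y\<close> is a
  complex line.\<close>

lemma det2_nonzero_if_no_complex_line:
  assumes "x \<noteq> 0" and ind: "\<And>a. y \<noteq> a *\<^sub>R x" and S: "\<And>a b. a *\<^sub>R x + b *\<^sub>R y \<in> S"
    and no: "\<not> (\<exists>L. vec.subspace L \<and> vec.dim L = 1 \<and> L \<subseteq> S)"
  shows "det2 x y \<noteq> 0"
proof
  assume d: "det2 x y = 0"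
  have "\<exists>l. y = l *s x"
  proof (cases "x $ 1 = 0")
    case False
    then have "y = (y $ 1 / x $ 1) *s x" using d by (simp add: vec_eq_iff forall_2 det2_def field_simps)
    then show ?thesis by blast
  next
    case True
    then have "x $ 2 \<noteq> 0" using \<open>x \<noteq> 0\<close> by (simp add: vec_eq_iff forall_2)
    then have "y = (y $ 2 / x $ 2) *s x" using d True by (simp add: vec_eq_iff forall_2 det2_def field_simps)
    then show ?thesis by blast
  qed
  then obtain l where l: "y = l *s x" by blast
  have Im: "Im l \<noteq> 0"
  proof
    assume "Im l = 0"
    then have "l = of_real (Re l)" by (simp add: complex_eq_iff)
    then show False using ind[of "Re l"] l scaleR_eq_vector_smult by metis
  qed
  have "z *s x \<in> S" for z
  proof -
    define b where "b = Im z / Im l"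
    define a where "a = Re z - b * Re l"
    have "z = of_real a + of_real b * l"
      using Im by (simp add: complex_eq_iff a_def b_def)
    then have "z *s x = a *\<^sub>R x + b *\<^sub>R y"
      by (simp add: l scaleR_eq_vector_smult vec_eq_iff algebra_simps)
    then show ?thesis using S by simp
  qed
  then have "vec.span {x} \<subseteq> S"
    by (auto simp: vec.span_singleton)
  moreover have "vec.dim (vec.span {x}) = 1"
    using \<open>x \<noteq> 0\<close> by (simp add: vec.dim_span vec.dim_eq_card_independent)
  ultimately show False using no vec.subspace_span by blast
qed

text \<open>Write \<open>c = u + i w\<close> with real \<open>u\<close>, \<open>w\<close>, and let \<open>J\<close> be the rotation by a right angle. Where the cutoff is
  \<open>1\<close>, the map \<open>c \<mapsto> c + twist c\<close> discards \<open>w\<close> and lands on the graph of \<open>g(u) = (1 - |u|\<^sup>2) u - J u\<close>. On the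
  unit circle \<open>g(u) = - J u\<close>, so this part of the graph is the boundary of the disc \<open>\<zeta> \<mapsto> (\<zeta>, - i \<zeta>)\<close>.\<close>

definition twist :: "complex ^ 2 \<Rightarrow> complex ^ 2" where
  "twist c = (let x = Re (c $ 1); y = Re (c $ 2); s = x\<^sup>2 + y\<^sup>2 in
     cutoff (c \<bullet> c) *\<^sub>R
       (\<chi> k. if k = 1 then (((1 - s) * x + y) - Im (c $ 1)) *\<^sub>R \<i> else (((1 - s) * y - x) - Im (c $ 2)) *\<^sub>R \<i>))"

lemma smooth_on_twist: "smooth_on twist UNIV"
proof -
  have l: "smooth_on (\<lambda>c::complex^2. Re (c $ k)) UNIV" "smooth_on (\<lambda>c::complex^2. Im (c $ k)) UNIV" for k
    by (intro smooth_on_bounded_linear[OF bounded_linear_Re] smooth_on_bounded_linear[OF bounded_linear_Im] 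
         smooth_on_vec_nth smooth_on_ident open_UNIV)+
  have i: "smooth_on (\<lambda>c. if (k::2) = 1 then f c else (g c :: complex)) (UNIV :: (complex^2) set)"
    if "smooth_on f UNIV" "smooth_on g UNIV" for f g k
    using that by (cases "k = 1") auto
  show ?thesis
    unfolding twist_def[abs_def] Let_def
    by (intro smooth_on_scaleR smooth_on_compose_UNIV[OF _ smooth_on_cutoff] smooth_on_inner smooth_on_ident open_UNIV
        smooth_on_vec_lambda i smooth_on_diff smooth_on_add smooth_on_mult smooth_on_power2 smooth_on_const l)
qed

lemma twist_eq_0: "3 \<le> c \<bullet> c \<Longrightarrow> twist c = 0"
  by (simp add: twist_def cutoff_eq_0 Let_def)

lemma Re_twist: "Re (twist c $ k) = 0"
  by (simp add: twist_def Let_def)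

lemma twist_eq:
  assumes "c \<bullet> c \<le> 2" and s: "s = (Re (c $ 1))\<^sup>2 + (Re (c $ 2))\<^sup>2"
  shows "(c + twist c) $ 1 = Complex (Re (c $ 1)) ((1 - s) * Re (c $ 1) + Re (c $ 2))"
    "(c + twist c) $ 2 = Complex (Re (c $ 2)) ((1 - s) * Re (c $ 2) - Re (c $ 1))"
  using assms by (auto simp: twist_def Let_def cutoff_eq_1 complex_eq_iff)

text \<open>Put \<open>s = |u|\<^sup>2\<close>, \<open>\<beta> = cutoff s\<close>, \<open>p = s \<beta> (1 - s)\<close> and \<open>q = s \<beta>\<^sup>2 ((1 - s)\<^sup>2 + 1) - s\<close>. The derivative of
  \<open>\<beta> g\<close> has trace \<open>2 p'\<close> and determinant \<open>q' + 1\<close>, and its graph is totally real iff \<open>p'\<close> and \<open>q'\<close> have no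
  common zero. For \<open>s > 1\<close> this holds whatever the cutoff is: \<open>q + s = p\<^sup>2 \<rho>\<close> with
  \<open>\<rho> = 1 / s + 1 / (s (s - 1)\<^sup>2)\<close> decreasing, so \<open>p' = 0\<close> implies \<open>q' < 0\<close>.\<close>

lemma twist_trace_det:
  fixes s \<beta> \<beta>' :: real
  assumes s: "s \<ge> 0" and one: "s < 2 \<Longrightarrow> \<beta> = 1 \<and> \<beta>' = 0"
    and tr: "\<beta>' * s * (1 - s) + \<beta> * (1 - 2 * s) = 0"
  shows "\<beta>\<^sup>2 * ((1 - s)\<^sup>2 + 1) + 2 * s * \<beta> * \<beta>' * ((1 - s)\<^sup>2 + 1) - 2 * s * \<beta>\<^sup>2 * (1 - s) \<noteq> 1"
    (is "?d \<noteq> 1")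
proof (cases "s \<le> 1")
  case True
  \<comment> \<open>Here the cutoff is locally constant, so half the trace is
    \<open>1 - 2 * s\<close>; it vanishes only at \<open>s = 1 / 2\<close>, where the determinant is
    3/4.\<close>
  then have "\<beta> = 1" "\<beta>' = 0" using one by auto
  moreover from this have "s = 1 / 2" using tr by simp
  ultimately show ?thesis by (simp add: power2_eq_square)
next
  case False
  define t where "t = s - 1"
  have t: "t > 0" "s = t + 1" using False by (auto simp: t_def)
  \<comment> \<open>The trace condition solved for \<open>\<beta>'\<close>, kept multiplied by
    \<open>t\<close>. Substituting it eliminates the derivative of the cutoff, and what is left of
    the determinant is \<open>- \<beta>\<^sup>2\<close> times a polynomial with positive
    coefficients.\<close>
  have e: "t * (s * \<beta>') = \<beta> * (1 - 2 * s)" using tr by (simp add: t algebra_simps)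
  have "t * ?d = t * (\<beta>\<^sup>2 * (t\<^sup>2 + 1)) + 2 * \<beta> * (t * (s * \<beta>')) * (t\<^sup>2 + 1) + 2 * s * \<beta>\<^sup>2 * t\<^sup>2"
    by (simp add: t algebra_simps power2_eq_square)
  also have "\<dots> = - (\<beta>\<^sup>2 * (2 + 3 * t + t ^ 3))"
    unfolding e by (simp add: t algebra_simps power2_eq_square power3_eq_cube)
  also have "\<dots> \<le> 0" using t by simp
  finally have "?d \<le> 0" using t(1) by (simp add: mult_le_0_iff)
  then show ?thesis by linarith
qed


definition real_vec2 :: "real \<Rightarrow> real \<Rightarrow> complex ^ 2" where
  "real_vec2 x y = (\<chi> k. if k = 1 then of_real x else of_real y)"

lemma real_vec2_nth [simp]: "real_vec2 x y $ 1 = of_real x" "real_vec2 x y $ 2 = of_real y"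
  by (simp_all add: real_vec2_def)

text \<open>For a real matrix \<open>A\<close> of size two,
  \<open>det (1 + i A) = (1 - det A) + i tr A\<close>. With \<open>A\<close> the imaginary part of
  the derivative in real directions, non-vanishing is the statement about trace and determinant just
  proved.\<close>

lemma det2_twist:
  fixes x y :: real
  defines "D \<equiv> frechet_derivative twist (at (real_vec2 x y))"
  shows "det2 (axis 1 1 + D (axis 1 1)) (axis 2 1 + D (axis 2 1)) \<noteq> 0"
proof -
  define s where "s = x\<^sup>2 + y\<^sup>2"
  define \<beta> where "\<beta> = cutoff s"
  define \<beta>' where "\<beta>' = frechet_derivative cutoff (at s) 1"
  have D: "(twist has_derivative D) (at (real_vec2 x y))"
    unfolding D_def by (rule smooth_on_has_derivative[OF smooth_on_twist]) simp
  have cut: "(cutoff has_real_derivative \<beta>') (at s)"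
  proof -
    have d: "(cutoff has_derivative frechet_derivative cutoff (at s)) (at s)"
      by (rule smooth_on_has_derivative[OF smooth_on_cutoff]) simp
    have "frechet_derivative cutoff (at s) h = \<beta>' * h" for h
      using linear_scale[OF has_derivative_linear[OF d], of h 1] by (simp add: \<beta>'_def mult.commute)
    then have "frechet_derivative cutoff (at s) = (*) \<beta>'" by blast
    then show ?thesis using d by (simp add: has_field_derivative_def)
  qed
  have one: "s < 2 \<Longrightarrow> \<beta> = 1 \<and> \<beta>' = 0"
  proof -
    assume s2: "s < 2"
    have "((\<lambda>_. 1) has_real_derivative 0) (at s)" by simp
    then have "(cutoff has_real_derivative 0) (at s)"
      by (rule has_field_derivative_transform_within_open[OF _ open_lessThan[of 2]])
        (use s2 in \<open>auto simp: cutoff_eq_1\<close>)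
    then show "\<beta> = 1 \<and> \<beta>' = 0"
      using DERIV_unique[OF cut] s2 by (simp add: \<beta>_def cutoff_eq_1)
  qed
  have Im: "Im (twist (real_vec2 x y) $ 1) = cutoff (x\<^sup>2 + y\<^sup>2) * ((1 - (x\<^sup>2 + y\<^sup>2)) * x + y)"
    "Im (twist (real_vec2 x y) $ 2) = cutoff (x\<^sup>2 + y\<^sup>2) * ((1 - (x\<^sup>2 + y\<^sup>2)) * y - x)" for x y
    by (simp_all add: twist_def Let_def inner_vec_def sum_2 inner_complex_def power2_eq_square)
  \<comment> \<open>The entries of \<open>D\<close> are found as derivatives in one real variable.
    Along the two axes the lines stay among real vectors, where \<open>twist\<close> has the
    explicit form \<open>Im\<close>.\<close>
  have lin: "((\<lambda>t. Im (twist (real_vec2 x y + t *\<^sub>R v) $ j)) has_real_derivative Im (D v $ j)) (at 0)" for v j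
  proof -
    have "((\<lambda>t. real_vec2 x y + t *\<^sub>R v) has_derivative (\<lambda>h. h *\<^sub>R v)) (at 0)"
      by (auto intro!: derivative_eq_intros)
    then have "((\<lambda>t. twist (real_vec2 x y + t *\<^sub>R v)) has_derivative (\<lambda>h. D (h *\<^sub>R v))) (at 0)"
      by (rule has_derivative_compose) (use D in simp)
    then have "((\<lambda>t. Im (twist (real_vec2 x y + t *\<^sub>R v) $ j)) has_derivative (\<lambda>h. Im (D (h *\<^sub>R v) $ j))) (at 0)"
      by (intro bounded_linear.has_derivative[OF bounded_linear_Im] bounded_linear.has_derivative[OF bounded_linear_vec_nth])
    moreover have "Im (D (h *\<^sub>R v) $ j) = Im (D v $ j) * h" for h
      using linear_scale[OF has_derivative_linear[OF D]] by simp
    ultimately show ?thesis by (simp add: has_field_derivative_def)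
  qed
  have Re: "Re (D v $ j) = 0" for v j
  proof -
    have "((\<lambda>c. Re (twist c $ j)) has_derivative (\<lambda>h. Re (D h $ j))) (at (real_vec2 x y))"
      by (intro bounded_linear.has_derivative[OF bounded_linear_Re] bounded_linear.has_derivative[OF bounded_linear_vec_nth] D)
    then have "((\<lambda>c. 0) has_derivative (\<lambda>h. Re (D h $ j))) (at (real_vec2 x y))" by (simp add: Re_twist)
    then have "(\<lambda>h. Re (D h $ j)) = (\<lambda>h. 0)"
      using has_derivative_unique has_derivative_const by blast
    then show ?thesis by meson
  qed
  have e: "real_vec2 x y + t *\<^sub>R axis 1 1 = real_vec2 (x + t) y"
    "real_vec2 x y + t *\<^sub>R axis 2 1 = real_vec2 x (y + t)" for t
    by (simp_all add: vec_eq_iff forall_2 axis_def complex_eq_iff)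
  have c0: "((\<lambda>t. cutoff ((x + t)\<^sup>2 + y\<^sup>2)) has_real_derivative \<beta>' * (2 * x)) (at 0)"
    "((\<lambda>t. cutoff (x\<^sup>2 + (y + t)\<^sup>2)) has_real_derivative \<beta>' * (2 * y)) (at 0)"
    by (rule DERIV_chain2[where f=cutoff]; use cut in \<open>auto intro!: derivative_eq_intros simp: s_def\<close>)+
  have d: "Im (D (axis 1 1) $ 1) = 2 * x * \<beta>' * ((1 - s) * x + y) + \<beta> * ((1 - s) - 2 * x\<^sup>2)"
    "Im (D (axis 2 1) $ 1) = 2 * y * \<beta>' * ((1 - s) * x + y) + \<beta> * (1 - 2 * x * y)"
    "Im (D (axis 1 1) $ 2) = 2 * x * \<beta>' * ((1 - s) * y - x) + \<beta> * (- 1 - 2 * x * y)"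
    "Im (D (axis 2 1) $ 2) = 2 * y * \<beta>' * ((1 - s) * y - x) + \<beta> * ((1 - s) - 2 * y\<^sup>2)"
    by (rule DERIV_unique[OF lin], unfold e Im,
        (rule derivative_eq_intros c0 refl)+,
        simp add: s_def \<beta>_def algebra_simps power2_eq_square power3_eq_cube)+
  define T where "T = \<beta>' * s * (1 - s) + \<beta> * (1 - 2 * s)"
  define E where "E = \<beta>\<^sup>2 * ((1 - s)\<^sup>2 + 1) + 2 * s * \<beta> * \<beta>' * ((1 - s)\<^sup>2 + 1) - 2 * s * \<beta>\<^sup>2 * (1 - s)"
  have T: "Im (D (axis 1 1) $ 1) + Im (D (axis 2 1) $ 2) = 2 * T"
    unfolding d T_def by (simp add: s_def algebra_simps power2_eq_square)
  have E: "Im (D (axis 1 1) $ 1) * Im (D (axis 2 1) $ 2) - Im (D (axis 2 1) $ 1) * Im (D (axis 1 1) $ 2) = E"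
  proof -
    define q where "q = 1 - s"
    have s: "x * x = s - y * y" by (simp add: s_def power2_eq_square)
    show ?thesis
      unfolding d E_def q_def[symmetric] unfolding s_def by algebra
  qed
  have "\<not> (T = 0 \<and> E = 1)"
    using twist_trace_det[of s \<beta> \<beta>'] one unfolding T_def E_def by (auto simp: s_def)
  have "det2 (axis 1 1 + D (axis 1 1)) (axis 2 1 + D (axis 2 1)) = Complex (1 - E) (2 * T)"
    unfolding det2_def T[symmetric] E[symmetric] vector_add_component
    by (simp add: complex_eq_iff axis_def Re algebra_simps)
  then show ?thesis
    using \<open>\<not> (T = 0 \<and> E = 1)\<close> by (auto simp: complex_eq_iff)
qed

text \<open>The derivative is bounded on the compact ball and zero outside it, so the mean value
  inequality on the whole space gives a global Lipschitz constant. One constant serves for the size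
  as well, which keeps the later estimates uniform.\<close>

lemma compact_support_Lipschitz:
  fixes f :: "'a::euclidean_space \<Rightarrow> 'b::euclidean_space"
  assumes f: "smooth_on f UNIV" and 0: "\<And>x. norm x > r \<Longrightarrow> f x = 0"
  obtains C where "C > 0" "\<And>x. norm (f x) \<le> C" "\<And>x y. norm (f x - f y) \<le> C * norm (x - y)"
proof -
  let ?D = "\<lambda>x. frechet_derivative f (at x)"
  have D: "(f has_derivative ?D x) (at x)" for x
    using smooth_on_has_derivative[OF f] by simp
  have "continuous_on (cball 0 r) (\<lambda>x. \<Sum>b\<in>Basis. norm (?D x b))"
    by (intro continuous_intros continuous_on_subset[OF smooth_on_imp_continuous_on[OF smooth_on_derivative[OF f]]]) auto
  then have "bounded ((\<lambda>x. \<Sum>b\<in>Basis. norm (?D x b)) ` cball 0 r)"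
    by (intro compact_imp_bounded compact_continuous_image) auto
  then obtain K where "\<And>x. x \<in> cball 0 r \<Longrightarrow> norm (\<Sum>b\<in>Basis. norm (?D x b)) \<le> K"
    unfolding bounded_iff by (meson imageI)
  then have K: "(\<Sum>b\<in>Basis. norm (?D x b)) \<le> K" if "norm x \<le> r" for x
    using that by (metis abs_le_D1 mem_cball_0 real_norm_def)
  have Dz: "?D x = (\<lambda>_. 0)" if "norm x > r" for x
  proof -
    have "((\<lambda>_. 0) has_derivative (\<lambda>_. 0)) (at x)" by simp
    then have "(f has_derivative (\<lambda>_. 0)) (at x)"
      by (rule has_derivative_transform_within_open[of _ _ _ _ "{x. norm x > r}"])
        (use that 0 in \<open>auto intro: open_Collect_less continuous_intros\<close>)
    then show ?thesis using has_derivative_unique[OF D] by blast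
  qed
  have on: "onorm (?D x) \<le> \<bar>K\<bar>" for x
  proof (rule onorm_le)
    fix v
    have "norm (?D x v) \<le> (\<Sum>b\<in>Basis. norm ((v \<bullet> b) *\<^sub>R ?D x b))"
      unfolding linear_expand[OF has_derivative_linear[OF D], of x v] by (rule norm_sum)
    also have "\<dots> \<le> (\<Sum>b\<in>Basis. norm v * norm (?D x b))"
      by (intro sum_mono) (auto intro!: mult_right_mono simp: Basis_le_norm)
    also have "\<dots> = (\<Sum>b\<in>Basis. norm (?D x b)) * norm v"
      by (simp add: sum_distrib_left mult.commute)
    also have "\<dots> \<le> \<bar>K\<bar> * norm v"
    proof (intro mult_right_mono)
      show "(\<Sum>b\<in>Basis. norm (?D x b)) \<le> \<bar>K\<bar>"
      proof (cases "norm x \<le> r")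
        case True
        show ?thesis using K[OF True] by linarith
      next
        case False
        then show ?thesis by (simp add: Dz)
      qed
    qed simp
    finally show "norm (?D x v) \<le> \<bar>K\<bar> * norm v" .
  qed
  have lip: "norm (f x - f y) \<le> \<bar>K\<bar> * norm (x - y)" for x y
    by (rule differentiable_bound[of UNIV f ?D]) (use D on in auto)
  have "bounded (f ` cball 0 r)"
    by (intro compact_imp_bounded compact_continuous_image continuous_on_subset[OF smooth_on_imp_continuous_on[OF f]]) auto
  then obtain B where B: "\<And>x. norm x \<le> r \<Longrightarrow> norm (f x) \<le> B" unfolding bounded_iff by (metis imageI mem_cball_0)
  have B': "norm (f x) \<le> \<bar>B\<bar>" for x
    using B[of x] 0[of x] by (cases "norm x \<le> r") auto
  show ?thesis
  proof (rule that[of "\<bar>K\<bar> + \<bar>B\<bar> + 1"])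
    show "norm (f x) \<le> \<bar>K\<bar> + \<bar>B\<bar> + 1" for x using B'[of x] by linarith
    have "\<bar>K\<bar> * norm (x - y) \<le> (\<bar>K\<bar> + \<bar>B\<bar> + 1) * norm (x - y)" for x y by (intro mult_right_mono) auto
    then show "norm (f x - f y) \<le> (\<bar>K\<bar> + \<bar>B\<bar> + 1) * norm (x - y)" for x y
      using lip[of x y] by (meson order_trans)
  qed simp
qed

section \<open>An obstruction to rational convexity\<close>

lemma complex_polynomial_along_line:
  fixes P :: "complex ^ 'n::finite \<Rightarrow> complex"
  assumes "complex_polynomial P"
  shows "(\<lambda>w. P (a + w *s b)) holomorphic_on UNIV" and "continuous_on UNIV P"
proof -
  obtain A c where P: "finite A" "P = (\<lambda>z. \<Sum>m\<in>A. c m * (\<Prod>i\<in>UNIV. (z $ i) ^ m i))"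
    using assms unfolding complex_polynomial_def by blast
  show "(\<lambda>w. P (a + w *s b)) holomorphic_on UNIV"
    unfolding P by (simp, intro holomorphic_intros)
  show "continuous_on UNIV P"
    unfolding P by (intro continuous_intros)
qed

lemma holomorphic_no_zero_if_boundary_extends:
  fixes f g :: "complex \<Rightarrow> complex"
  assumes f: "f holomorphic_on UNIV" and g: "continuous_on (cball 0 1) g"
    and g0: "\<And>w. w \<in> cball 0 1 \<Longrightarrow> g w \<noteq> 0" and fg: "\<And>w. norm w = 1 \<Longrightarrow> f w = g w"
    and "norm w0 < 1"
  shows "f w0 \<noteq> 0"
proof
  assume z: "f w0 = 0"
  let ?c = "circlepath 0 1"
  \<comment> \<open>The radius 2 leaves an open domain around the closed unit disc; zeros outside
    the unit circle have winding number 0 and drop out of the count. The empty set stands for the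
    absent poles.\<close>
  define Z where "Z = {w \<in> ball 0 2. f w = 0 \<or> w \<in> {}}"
  have f1: "f 1 \<noteq> 0" using fg[of 1] g0[of 1] by simp
  have "finite Z"
  proof (rule ccontr)
    assume inf: "infinite Z"
    have "Z \<subseteq> cball 0 2" by (auto simp: Z_def)
    then obtain l where "l islimpt Z"
      using Heine_Borel_imp_Bolzano_Weierstrass[OF compact_cball inf] by blast
    then have "f 1 = 0"
      by (intro analytic_continuation[OF f, of Z l 1]) (auto simp: Z_def)
    then show False using f1 by simp
  qed
  have img: "path_image ?c \<subseteq> ball 0 2 - Z"
    using fg g0 by (auto simp: Z_def path_image_circlepath_nonneg)
  have "contour_integral ?c (\<lambda>x. deriv f x * 1 / f x) = 2 * pi * \<i> *
          (\<Sum>p\<in>Z. winding_number ?c p * 1 * zorder f p)"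
    unfolding Z_def
    by (rule argument_principle)
      (use img \<open>finite Z\<close> in \<open>auto simp: Z_def intro: holomorphic_on_subset[OF f] winding_number_zero_outside[of _ "cball 0 1"] simp: path_image_circlepath_nonneg\<close>)
  moreover have "contour_integral ?c (\<lambda>x. deriv f x * 1 / f x) = 2 * pi * \<i> * winding_number (f \<circ> ?c) 0"
  proof -
    have df: "f field_differentiable (at w)" for w
      using f holomorphic_on_imp_differentiable_at by blast
    have "valid_path (f \<circ> ?c)"
      by (rule valid_path_compose_holomorphic[OF _ f]) auto
    moreover have "0 \<notin> path_image (f \<circ> ?c)"
      using img by (auto simp: path_image_compose Z_def)
    ultimately have "2 * pi * \<i> * winding_number (f \<circ> ?c) 0 = contour_integral (f \<circ> ?c) (\<lambda>w. 1 / (w - 0))"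
      by (simp add: winding_number_valid_path)
    also have "\<dots> = integral {0..1} (\<lambda>t. 1 / (f (?c t) - 0) * vector_derivative (f \<circ> ?c) (at t))"
      by (simp add: contour_integral_integral)
    also have "\<dots> = integral {0..1} (\<lambda>t. deriv f (?c t) * 1 / f (?c t) * vector_derivative ?c (at t))"
    proof (rule integral_cong)
      fix t :: real
      have "?c differentiable (at t)"
        using has_vector_derivative_circlepath differentiableI_vector by blast
      from vector_derivative_chain_at_general[OF this df]
      show "1 / (f (?c t) - 0) * vector_derivative (f \<circ> ?c) (at t)
         = deriv f (?c t) * 1 / f (?c t) * vector_derivative ?c (at t)"
        by simp
    qed
    finally show ?thesis by (simp add: contour_integral_integral)
  qed
  moreover have "winding_number (f \<circ> ?c) 0 = 0"
  proof -
    \<comment> \<open>The circle is contracted inside the disc to the constant loop at 0;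
      \<open>g\<close> carries this contraction to one that avoids 0.\<close>
    have "homotopic_loops (cball 0 1) ?c (linepath 0 0)"
    proof (rule homotopic_loops_linear)
      fix t :: real
      have "?c t \<in> cball 0 1" by (simp add: circlepath)
      moreover have "linepath 0 0 t \<in> cball (0::complex) 1" by (simp add: linepath_def)
      ultimately show "closed_segment (?c t) (linepath 0 0 t) \<subseteq> cball 0 1"
        by (rule closed_segment_subset) simp
    qed simp_all
    then have "homotopic_loops (- {0}) (g \<circ> ?c) (g \<circ> linepath 0 0)"
      by (rule homotopic_loops_continuous_image[OF _ g]) (use g0 in auto)
    then have "winding_number (g \<circ> ?c) 0 = winding_number (g \<circ> linepath 0 0) 0"
      by (rule winding_number_homotopic_loops)
    moreover have "g \<circ> linepath 0 0 = linepath (g 0) (g 0)"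
      by (auto simp: linepath_def algebra_simps simp flip: scaleR_left_distrib)
    moreover have "f \<circ> ?c = g \<circ> ?c"
      using fg by (auto simp: circlepath fun_eq_iff)
    ultimately show ?thesis using g0[of 0] by simp
  qed
  ultimately have "(\<Sum>p\<in>Z. winding_number ?c p * zorder f p) = 0"
    by simp
  moreover have "(\<Sum>p\<in>Z. winding_number ?c p * zorder f p) = (\<Sum>p\<in>Z. of_int (if norm p < 1 then zorder f p else 0))"
  proof (rule sum.cong)
    fix p assume p: "p \<in> Z"
    then have "norm p \<noteq> 1" using img by (auto simp: path_image_circlepath_nonneg)
    then show "winding_number ?c p * zorder f p = of_int (if norm p < 1 then zorder f p else 0)"
      using winding_number_circlepath[of p 0 1] winding_number_zero_outside[of ?c "cball 0 1" p]
      by (auto simp: path_image_circlepath_nonneg)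
  qed simp
  ultimately have "(\<Sum>p\<in>Z. if norm p < 1 then zorder f p else 0) = 0"
    by (metis (no_types, lifting) of_int_eq_0_iff of_int_sum sum.cong)
  moreover have "(\<Sum>p\<in>Z. if norm p < 1 then zorder f p else 0) > 0"
  proof (rule sum_pos2[OF \<open>finite Z\<close>, of w0])
    have pos: "zorder f p > 0" if "p \<in> Z" for p
      using zorder_exist_zero[OF f, of p] that f1 by (auto simp: Z_def)
    show "w0 \<in> Z" using z \<open>norm w0 < 1\<close> by (simp add: Z_def)
    then show "0 < (if norm w0 < 1 then zorder f w0 else 0)" using pos \<open>norm w0 < 1\<close> by simp
    show "0 \<le> (if norm p < 1 then zorder f p else 0)" if "p \<in> Z" for p
      using pos[OF that] by simp
  qed
  ultimately show False by linarith
qed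

text \<open>Here \<open>\<phi>\<close> is a continuous disc in \<open>K\<close> with the same
  boundary as the holomorphic disc \<open>w \<mapsto> a + w *s b\<close>. A polynomial that
  separates one point of the latter from \<open>K\<close>, minus its value there, would have a zero
  on the holomorphic disc and none on \<open>K\<close>.\<close>

lemma not_rationally_convex_if_disc:
  fixes K :: "(complex ^ 'n::finite) set"
  assumes D: "continuous_on (cball 0 1) \<phi>" and K: "\<phi> ` cball 0 1 \<subseteq> K"
    and bd: "\<And>w. norm w = 1 \<Longrightarrow> \<phi> w = a + w *s b"
    and "norm w0 < 1" and out: "a + w0 *s b \<notin> K"
  shows "\<not> rationally_convex K"
proof
  assume "rationally_convex K"
  then obtain P where P: "complex_polynomial P" "P (a + w0 *s b) \<notin> P ` K"
    using out unfolding rationally_convex_def by blast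
  define z where "z = P (a + w0 *s b)"
  have "P (a + w0 *s b) - z \<noteq> 0"
  proof (rule holomorphic_no_zero_if_boundary_extends[where f="\<lambda>w. P (a + w *s b) - z" and g="\<lambda>w. P (\<phi> w) - z"])
    show "(\<lambda>w. P (a + w *s b) - z) holomorphic_on UNIV"
      by (intro holomorphic_intros complex_polynomial_along_line P)
    show "continuous_on (cball 0 1) (\<lambda>w. P (\<phi> w) - z)"
      by (intro continuous_intros continuous_on_compose2[OF complex_polynomial_along_line(2)[OF P(1)] D]) auto
    show "P (\<phi> w) - z \<noteq> 0" if "w \<in> cball 0 1" for w
    proof -
      have "P (\<phi> w) \<in> P ` K" using K that by blast
      then show ?thesis using P(2) by (metis eq_iff_diff_eq_0 z_def)
    qed
    show "P (a + w *s b) - z = P (\<phi> w) - z" if "norm w = 1" for w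
      using bd[OF that] by simp
  qed fact
  then show False by (simp add: z_def)
qed

section \<open>Tubular neighbourhoods of framed periodic surfaces\<close>

text \<open>A base parameter \<open>\<theta>\<close> and fibre coordinates \<open>b\<close> are
  packed into the one complex vector \<open>\<theta> + i b\<close>. The tube map becomes a map of
  C^2 to itself, to which the local inverse lemma for self-maps applies.\<close>

definition rev2 :: "complex ^ 2 \<Rightarrow> real ^ 2" where "rev2 c = (\<chi> k. Re (c $ k))"
definition imv2 :: "complex ^ 2 \<Rightarrow> real ^ 2" where "imv2 c = (\<chi> k. Im (c $ k))"
definition cv2 :: "real ^ 2 \<Rightarrow> real ^ 2 \<Rightarrow> complex ^ 2" where "cv2 a b = (\<chi> k. Complex (a $ k) (b $ k))"

lemma rev2_cv2 [simp]: "rev2 (cv2 a b) = a" and imv2_cv2 [simp]: "imv2 (cv2 a b) = b"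
  and cv2_rev2_imv2 [simp]: "cv2 (rev2 c) (imv2 c) = c"
  by (simp_all add: rev2_def imv2_def cv2_def vec_eq_iff)

lemma rev2_add [simp]: "rev2 (c + d) = rev2 c + rev2 d" and imv2_add [simp]: "imv2 (c + d) = imv2 c + imv2 d"
  by (simp_all add: rev2_def imv2_def vec_eq_iff)

lemma linear_rev2: "linear rev2" and linear_imv2: "linear imv2"
  by (auto intro!: linearI simp: rev2_def imv2_def vec_eq_iff)

lemmas bounded_linear_rev2 = linear_rev2[unfolded linear_conv_bounded_linear]
lemmas bounded_linear_imv2 = linear_imv2[unfolded linear_conv_bounded_linear]

lemma norm_complex_vec2: "(norm c)\<^sup>2 = (norm (rev2 c))\<^sup>2 + (norm (imv2 c))\<^sup>2"
  by (simp add: rev2_def imv2_def norm_vec_def L2_set_def sum_2 cmod_power2)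

lemma norm_rev2_imv2_le: "norm (rev2 c) \<le> norm c" "norm (imv2 c) \<le> norm c"
  by (rule power2_le_imp_le; simp add: norm_complex_vec2[of c])+

definition frame_sum :: "(2 \<Rightarrow> real ^ 2 \<Rightarrow> complex ^ 2) \<Rightarrow> real ^ 2 \<Rightarrow> real ^ 2 \<Rightarrow> complex ^ 2" where
  "frame_sum Y \<theta> b = (\<Sum>k\<in>UNIV. b $ k *\<^sub>R Y k \<theta>)"

definition frame_map :: "(real ^ 2 \<Rightarrow> complex ^ 2) \<Rightarrow> (2 \<Rightarrow> real ^ 2 \<Rightarrow> complex ^ 2) \<Rightarrow> complex ^ 2 \<Rightarrow> complex ^ 2" where
  "frame_map G Y c = G (rev2 c) + frame_sum Y (rev2 c) (imv2 c)"

text \<open>By dimension, a trivial kernel means that \<open>G\<close> is immersive at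
  \<open>\<theta>\<close> and that the frame spans a complement of the tangent plane.\<close>

definition complementary :: "(real ^ 2 \<Rightarrow> complex ^ 2) \<Rightarrow> (2 \<Rightarrow> real ^ 2 \<Rightarrow> complex ^ 2) \<Rightarrow> real ^ 2 \<Rightarrow> bool" where
  "complementary G Y \<theta> \<longleftrightarrow>
     (\<forall>a b. frechet_derivative G (at \<theta>) a + frame_sum Y \<theta> b = 0 \<longrightarrow> a = 0 \<and> b = 0)"

lemma linear_frame_sum: "linear (frame_sum Y \<theta>)"
  by (auto intro!: linearI simp: frame_sum_def scaleR_left_distrib sum.distrib scaleR_sum_right)

lemma frame_sum_0 [simp]: "frame_sum Y \<theta> 0 = 0"
  by (simp add: frame_sum_def)

lemma smooth_on_frame_sum:
  assumes "open U" and "\<And>k. smooth_on (Y k) UNIV" and "smooth_on f U" and "smooth_on g U"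
  shows "smooth_on (\<lambda>x. frame_sum Y (f x) (g x)) U"
  unfolding frame_sum_def
  by (intro smooth_on_sum smooth_on_scaleR smooth_on_vec_nth smooth_on_compose_UNIV[OF _ assms(2)] assms)

lemma smooth_on_rev2: "smooth_on rev2 UNIV" and smooth_on_imv2: "smooth_on imv2 UNIV"
  using smooth_on_linear[OF linear_rev2 open_UNIV smooth_on_ident] smooth_on_linear[OF linear_imv2 open_UNIV smooth_on_ident] by simp_all

lemma smooth_on_frame_map:
  assumes "smooth_on G UNIV" and "\<And>k. smooth_on (Y k) UNIV"
  shows "smooth_on (frame_map G Y) UNIV"
  unfolding frame_map_def[abs_def]
  by (intro smooth_on_add smooth_on_frame_sum smooth_on_compose_UNIV[OF _ assms(1)] assms smooth_on_rev2 smooth_on_imv2 open_UNIV)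

text \<open>The derivatives of \<open>Y\<close> are multiplied by the fibre coordinates, which
  vanish on the zero section.\<close>

lemma frechet_derivative_frame_map:
  assumes G: "smooth_on G UNIV" and Y: "\<And>k. smooth_on (Y k) UNIV"
  shows "frechet_derivative (frame_map G Y) (at (cv2 \<theta> 0)) v
    = frechet_derivative G (at \<theta>) (rev2 v) + frame_sum Y \<theta> (imv2 v)"
proof -
  have dG: "(G has_derivative frechet_derivative G (at (rev2 (cv2 \<theta> 0)))) (at (rev2 (cv2 \<theta> 0)))"
    by (rule smooth_on_has_derivative[OF G]) simp
  have dY: "(Y k has_derivative frechet_derivative (Y k) (at (rev2 (cv2 \<theta> 0)))) (at (rev2 (cv2 \<theta> 0)))" for k
    by (rule smooth_on_has_derivative[OF Y]) simp
  have dr: "(rev2 has_derivative rev2) (at (cv2 \<theta> 0))"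
    by (rule bounded_linear_imp_has_derivative[OF bounded_linear_rev2])
  have di: "((\<lambda>c. imv2 c $ k) has_derivative (\<lambda>v. imv2 v $ k)) (at (cv2 \<theta> 0))" for k
    by (rule bounded_linear_imp_has_derivative[OF bounded_linear_compose[OF bounded_linear_vec_nth bounded_linear_imv2]])
  have "(frame_map G Y has_derivative (\<lambda>v. frechet_derivative G (at \<theta>) (rev2 v) +
     (\<Sum>k\<in>UNIV. imv2 (cv2 \<theta> 0) $ k *\<^sub>R frechet_derivative (Y k) (at \<theta>) (rev2 v) + imv2 v $ k *\<^sub>R Y k (rev2 (cv2 \<theta> 0))))) (at (cv2 \<theta> 0))"
    unfolding frame_map_def[abs_def] frame_sum_def
    using has_derivative_compose[OF dr dG] has_derivative_compose[OF dr dY]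
    by (intro has_derivative_add has_derivative_sum has_derivative_scaleR di) simp_all
  then have "(frame_map G Y has_derivative (\<lambda>v. frechet_derivative G (at \<theta>) (rev2 v) + frame_sum Y \<theta> (imv2 v))) (at (cv2 \<theta> 0))"
    by (simp add: frame_sum_def)
  from frechet_derivative_at[OF this] show ?thesis by metis
qed

lemma complementary_imp_inj:
  assumes "smooth_on G UNIV" and "\<And>k. smooth_on (Y k) UNIV" and "complementary G Y \<theta>"
  shows "inj (frechet_derivative (frame_map G Y) (at (cv2 \<theta> 0)))"
proof -
  have "linear (frechet_derivative (frame_map G Y) (at (cv2 \<theta> 0)))"
    by (rule has_derivative_linear[OF smooth_on_has_derivative[OF smooth_on_frame_map[OF assms(1,2)] UNIV_I]])
  then show ?thesis
  proof (subst linear_injective_0, assumption, intro allI impI)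
    fix v assume "frechet_derivative (frame_map G Y) (at (cv2 \<theta> 0)) v = 0"
    then have "rev2 v = 0" "imv2 v = 0"
      using assms(3) unfolding frechet_derivative_frame_map[OF assms(1,2)] complementary_def by auto
    then show "v = 0" by (simp add: rev2_def imv2_def vec_eq_iff complex_eq_iff)
  qed
qed

text \<open>The parametrisation \<open>G\<close> of the torus is only injective up to periods; \<open>f\<close> is periodic with
  respect to \<open>G\<close> if every translation identifying two points with the same image preserves \<open>f\<close>.\<close>

definition periodic_wrt :: "('a::euclidean_space \<Rightarrow> 'b) \<Rightarrow> ('a \<Rightarrow> 'c) \<Rightarrow> bool" where
  "periodic_wrt G f \<longleftrightarrow> (\<forall>\<theta> \<theta>' x. G \<theta> = G \<theta>' \<longrightarrow> f (x + (\<theta>' - \<theta>)) = f x)"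

lemma periodic_wrt_eq: "periodic_wrt G f \<Longrightarrow> G \<theta> = G \<theta>' \<Longrightarrow> f \<theta> = f \<theta>'"
  unfolding periodic_wrt_def by (metis add.commute diff_add_cancel)

lemma frechet_derivative_shift:
  assumes "f differentiable (at (x + l))"
  shows "frechet_derivative (\<lambda>x. f (x + l)) (at x) = frechet_derivative f (at (x + l))"
proof -
  have "((\<lambda>x. x + l) has_derivative (\<lambda>v. v)) (at x)"
    by (auto intro!: derivative_eq_intros)
  from has_derivative_compose[OF this] assms
  have "((\<lambda>x. f (x + l)) has_derivative frechet_derivative f (at (x + l))) (at x)"
    by (simp add: frechet_derivative_works)
  from frechet_derivative_at[OF this] show ?thesis by simp
qed

lemma periodic_frechet_derivative:
  assumes "periodic_wrt G f" and "smooth_on f UNIV"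
  shows "periodic_wrt G (\<lambda>x. frechet_derivative f (at x) v)"
  unfolding periodic_wrt_def
proof (intro allI impI)
  fix \<theta> \<theta>' x assume "G \<theta> = G \<theta>'"
  then have "(\<lambda>x. f (x + (\<theta>' - \<theta>))) = f"
    using assms(1) unfolding periodic_wrt_def by blast
  then show "frechet_derivative f (at (x + (\<theta>' - \<theta>))) v = frechet_derivative f (at x) v"
    using frechet_derivative_shift[of f x "\<theta>' - \<theta>"] smooth_on_has_derivative[OF assms(2)]
    by (metis UNIV_I differentiable_def)
qed

text \<open>Because \<open>Q\<close> is compact and meets every fibre of \<open>G\<close>, sequences
  of parameters can be moved into a compact set without changing their images. This carries the
  compactness of the torus over to the plane of parameters.\<close>

locale periodic_surface =
  fixes G :: "real ^ 2 \<Rightarrow> complex ^ 2" and Q :: "(real ^ 2) set"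
  assumes smooth_G: "smooth_on G UNIV" and per_G: "periodic_wrt G G"
    and compact_Q: "compact Q" and cover_Q: "\<And>\<theta>. \<exists>\<theta>'\<in>Q. G \<theta>' = G \<theta>"

locale framed_surface = periodic_surface +
  fixes Y :: "2 \<Rightarrow> real ^ 2 \<Rightarrow> complex ^ 2"
  assumes smooth_Y: "\<And>k. smooth_on (Y k) UNIV" and per_Y: "\<And>k. periodic_wrt G (Y k)"
    and compl: "\<And>\<theta>. complementary G Y \<theta>"
begin

abbreviation "H \<equiv> frame_map G Y"

lemma smooth_H: "smooth_on H UNIV"
  by (rule smooth_on_frame_map[OF smooth_G smooth_Y])

lemma frame_sum_eq: "G \<theta> = G \<theta>' \<Longrightarrow> frame_sum Y \<theta> b = frame_sum Y \<theta>' b"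
  unfolding frame_sum_def using periodic_wrt_eq[OF per_Y] by (metis (mono_tags, lifting) sum.cong)

lemma H_shift: "G \<theta> = G \<theta>' \<Longrightarrow> H (c + cv2 (\<theta>' - \<theta>) 0) = H c"
  using per_G per_Y unfolding periodic_wrt_def frame_map_def frame_sum_def by simp

lemma move_to_Q:
  obtains l where "rev2 (c + cv2 l 0) \<in> Q" "imv2 (c + cv2 l 0) = imv2 c" "\<And>d. H (d + cv2 l 0) = H d"
    "G (rev2 (c + cv2 l 0)) = G (rev2 c)"
proof -
  obtain \<theta> where "\<theta> \<in> Q" "G \<theta> = G (rev2 c)" using cover_Q by blast
  then show ?thesis
    by (intro that[of "\<theta> - rev2 c"] H_shift) (simp_all add: algebra_simps)
qed

text \<open>The bound on the fibre coordinates gives compactness in all four real directions and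
  places the limit on the zero section, where \<open>H\<close> is known to be a local
  diffeomorphism.\<close>

lemma limit_point:
  assumes "\<And>n. rev2 (d n) \<in> Q" and "\<And>n. norm (imv2 (d n)) < 1 / Suc n"
  obtains s \<theta> where "strict_mono (s :: nat \<Rightarrow> nat)" "(d \<circ> s) \<longlonglongrightarrow> cv2 \<theta> 0"
proof -
  have "bounded {c. rev2 c \<in> Q \<and> norm (imv2 c) \<le> 1}"
  proof -
    obtain B where B: "\<And>x. x \<in> Q \<Longrightarrow> norm x \<le> B"
      using compact_imp_bounded[OF compact_Q] unfolding bounded_iff by blast
    have "(norm c)\<^sup>2 \<le> (\<bar>B\<bar> + 1)\<^sup>2" if "rev2 c \<in> Q" "norm (imv2 c) \<le> 1" for c
    proof -
      have "(norm (rev2 c))\<^sup>2 \<le> B\<^sup>2" using B[OF that(1)] by (intro power_mono) auto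
      moreover have "(norm (imv2 c))\<^sup>2 \<le> 1" using that(2) by (simp add: power_le_one)
      ultimately show ?thesis unfolding norm_complex_vec2 by (simp add: power2_eq_square algebra_simps)
    qed
    then have "norm c \<le> \<bar>B\<bar> + 1" if "rev2 c \<in> Q" "norm (imv2 c) \<le> 1" for c
      using that by (meson abs_ge_zero add_nonneg_nonneg power2_le_imp_le zero_le_one)
    then show ?thesis unfolding bounded_iff by blast
  qed
  moreover have "closed {c. rev2 c \<in> Q \<and> norm (imv2 c) \<le> 1}"
  proof -
    have "closed (rev2 -` Q)"
      by (intro closed_vimage compact_imp_closed[OF compact_Q] linear_continuous_on[OF bounded_linear_rev2])
    moreover have "closed {c. norm (imv2 c) \<le> 1}"
      by (intro closed_Collect_le continuous_intros linear_continuous_on[OF bounded_linear_imv2])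
    ultimately have "closed (rev2 -` Q \<inter> {c. norm (imv2 c) \<le> 1})" by blast
    moreover have "rev2 -` Q \<inter> {c. norm (imv2 c) \<le> 1} = {c. rev2 c \<in> Q \<and> norm (imv2 c) \<le> 1}" by auto
    ultimately show ?thesis by simp
  qed
  ultimately have "compact {c. rev2 c \<in> Q \<and> norm (imv2 c) \<le> 1}" (is "compact ?C")
    by (simp add: compact_eq_bounded_closed)
  moreover have "\<forall>n. d n \<in> ?C"
  proof
    fix n
    have "1 / real (Suc n) \<le> 1" by simp
    then have "norm (imv2 (d n)) \<le> 1" using assms(2)[of n] by linarith
    then show "d n \<in> ?C" using assms(1)[of n] by simp
  qed
  ultimately have "\<exists>x\<in>?C. \<exists>s. strict_mono (s :: nat \<Rightarrow> nat) \<and> (d \<circ> s) \<longlonglongrightarrow> x"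
    unfolding compact_def by (elim allE[of _ d]) (erule mp)
  then obtain x s where s: "strict_mono (s :: nat \<Rightarrow> nat)" "(d \<circ> s) \<longlonglongrightarrow> x"
    by blast
  have "(\<lambda>n. imv2 (d n)) \<longlonglongrightarrow> 0"
  proof (rule Lim_null_comparison)
    show "\<forall>\<^sub>F n in sequentially. norm (imv2 (d n)) \<le> 1 / Suc n"
      using less_imp_le[OF assms(2)] by (intro always_eventually allI)
    show "(\<lambda>n. 1 / real (Suc n)) \<longlonglongrightarrow> 0" by (rule LIMSEQ_Suc[OF lim_1_over_n])
  qed
  then have "(\<lambda>n. imv2 ((d \<circ> s) n)) \<longlonglongrightarrow> 0"
    using LIMSEQ_subseq_LIMSEQ[OF _ s(1)] by (simp add: o_def)
  moreover have "(\<lambda>n. imv2 ((d \<circ> s) n)) \<longlonglongrightarrow> imv2 x"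
    by (rule bounded_linear.tendsto[OF bounded_linear_imv2 s(2)])
  ultimately have "x = cv2 (rev2 x) 0" using LIMSEQ_unique by (metis cv2_rev2_imv2)
  then show ?thesis using that s by metis
qed

lemma H_local:
  obtains V where "open V" "cv2 \<theta> 0 \<in> V" "local_diffeo_on H V" "inj_on H V"
  using inj_frechet_derivative_local[OF open_UNIV smooth_H UNIV_I complementary_imp_inj[OF smooth_G smooth_Y compl]]
  by metis

text \<open>A uniform radius by contradiction: points with singular derivative and fibre coordinates
  tending to 0, shifted into \<open>Q\<close>, accumulate at a point of the zero section, near which
  no derivative is singular.\<close>

lemma H_local_diffeo: "\<exists>r>0. local_diffeo_on H {c. norm (imv2 c) < r}"
proof -
  have "\<exists>n. \<forall>c. norm (imv2 c) < 1 / real (Suc n) \<longrightarrow> inj (frechet_derivative H (at c))"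
  proof (rule ccontr)
    assume "\<not> ?thesis"
    then obtain c where c: "\<And>n. norm (imv2 (c n)) < 1 / real (Suc n)" "\<And>n. \<not> inj (frechet_derivative H (at (c n)))"
      by metis
    have "\<exists>d. rev2 d \<in> Q \<and> norm (imv2 d) < 1 / real (Suc n) \<and> \<not> inj (frechet_derivative H (at d))" for n
    proof -
      obtain l where l: "rev2 (c n + cv2 l 0) \<in> Q" "imv2 (c n + cv2 l 0) = imv2 (c n)" "\<And>d. H (d + cv2 l 0) = H d"
        using move_to_Q[of "c n"] by metis
      have "frechet_derivative H (at (c n + cv2 l 0)) = frechet_derivative H (at (c n))"
      proof -
        have "H differentiable (at (c n + cv2 l 0))"
          unfolding differentiable_def by (rule exI, rule smooth_on_has_derivative[OF smooth_H UNIV_I])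
        from frechet_derivative_shift[OF this] show ?thesis using l(3) by simp
      qed
      then show ?thesis using l c by metis
    qed
    then obtain d where d: "\<And>n. rev2 (d n) \<in> Q" "\<And>n. norm (imv2 (d n)) < 1 / real (Suc n)"
        "\<And>n. \<not> inj (frechet_derivative H (at (d n)))" by metis
    obtain s \<theta> where s: "strict_mono (s :: nat \<Rightarrow> nat)" "(d \<circ> s) \<longlonglongrightarrow> cv2 \<theta> 0"
      using limit_point[OF d(1,2)] by metis
    obtain V where V: "open V" "cv2 \<theta> 0 \<in> V" "local_diffeo_on H V" by (rule H_local)
    have "\<forall>\<^sub>F n in sequentially. (d \<circ> s) n \<in> V"
      using topological_tendstoD[OF s(2) V(1,2)] .
    then obtain n where "(d \<circ> s) n \<in> V" using eventually_happens' sequentially_bot by blast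
    then show False using V(3) d(3) unfolding local_diffeo_on_def by auto
  qed
  then obtain n where n: "\<And>c. norm (imv2 c) < 1 / real (Suc n) \<Longrightarrow> inj (frechet_derivative H (at c))"
    by blast
  have "open {c. norm (imv2 c) < 1 / real (Suc n)}"
    by (intro open_Collect_less continuous_intros linear_continuous_on[OF bounded_linear_imv2])
  then show ?thesis
    using n smooth_on_subset[OF smooth_H] by (intro exI[of _ "1 / real (Suc n)"]) (auto simp: local_diffeo_on_def)
qed

text \<open>Again by compactness, for pairs of points with the same image. Both sequences converge
  to the zero section and their limits have the same image under \<open>G\<close>, so a period takes
  one limit to the other; local injectivity there gives the contradiction.\<close>

lemma H_inj: "\<exists>r>0. \<forall>c c'. norm (imv2 c) < r \<longrightarrow> norm (imv2 c') < r \<longrightarrow> H c = H c' \<longrightarrow>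
    G (rev2 c) = G (rev2 c') \<and> imv2 c = imv2 c'"
proof -
  let ?bad = "\<lambda>r c c'. norm (imv2 c) < r \<and> norm (imv2 c') < r \<and> H c = H c' \<and>
    \<not> (G (rev2 c) = G (rev2 c') \<and> imv2 c = imv2 c')"
  have "\<exists>n. \<forall>c c'. \<not> ?bad (1 / real (Suc n)) c c'"
  proof (rule ccontr)
    assume "\<not> ?thesis"
    then have ex: "\<exists>c c'. ?bad (1 / real (Suc n)) c c'" for n by blast
    have "\<exists>d d'. rev2 d \<in> Q \<and> rev2 d' \<in> Q \<and> ?bad (1 / real (Suc n)) d d'" for n
    proof -
      obtain c c' where c: "?bad (1 / real (Suc n)) c c'" using ex by blast
      obtain l where l: "rev2 (c + cv2 l 0) \<in> Q" "imv2 (c + cv2 l 0) = imv2 c" "H (c + cv2 l 0) = H c"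
        "G (rev2 (c + cv2 l 0)) = G (rev2 c)" using move_to_Q[of c] by metis
      obtain l' where l': "rev2 (c' + cv2 l' 0) \<in> Q" "imv2 (c' + cv2 l' 0) = imv2 c'" "H (c' + cv2 l' 0) = H c'"
        "G (rev2 (c' + cv2 l' 0)) = G (rev2 c')" using move_to_Q[of c'] by metis
      have "?bad (1 / real (Suc n)) (c + cv2 l 0) (c' + cv2 l' 0)"
        unfolding l l' using c by blast
      then show ?thesis using l(1) l'(1) by blast
    qed
    then obtain d d' where d: "\<And>n. rev2 (d n) \<in> Q" "\<And>n. rev2 (d' n) \<in> Q" "\<And>n. ?bad (1 / real (Suc n)) (d n) (d' n)"
      by metis
    obtain s \<theta> where s: "strict_mono (s :: nat \<Rightarrow> nat)" "(d \<circ> s) \<longlonglongrightarrow> cv2 \<theta> 0"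
      using limit_point[of d] d by metis
    \<comment> \<open>The second extraction needs the bound with index \<open>n\<close> instead of
      \<open>s n\<close>; it follows from \<open>n \<le> s n\<close>.\<close>
    have b: "norm (imv2 ((d' \<circ> s) n)) < 1 / real (Suc n)" for n
    proof -
      have "norm (imv2 (d' (s n))) < 1 / real (Suc (s n))" using d(3) by blast
      also have "\<dots> \<le> 1 / real (Suc n)" using seq_suble[OF s(1)] by (simp add: frac_le)
      finally show ?thesis by simp
    qed
    obtain s' \<theta>' where s': "strict_mono (s' :: nat \<Rightarrow> nat)" "((d' \<circ> s) \<circ> s') \<longlonglongrightarrow> cv2 \<theta>' 0"
      using limit_point[of "d' \<circ> s"] d(2) b by (metis comp_apply)
    have l1: "(d \<circ> s \<circ> s') \<longlonglongrightarrow> cv2 \<theta> 0" using LIMSEQ_subseq_LIMSEQ[OF s(2) s'(1)] .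
    have contH: "isCont H x" for x
      using smooth_on_imp_continuous_on[OF smooth_H] continuous_on_eq_continuous_at by blast
    have "(\<lambda>n. H ((d \<circ> s \<circ> s') n)) \<longlonglongrightarrow> H (cv2 \<theta> 0)" using isCont_tendsto_compose[OF contH l1] .
    moreover have "(\<lambda>n. H ((d \<circ> s \<circ> s') n)) \<longlonglongrightarrow> H (cv2 \<theta>' 0)"
      using isCont_tendsto_compose[OF contH s'(2)] d(3) by simp
    ultimately have "H (cv2 \<theta> 0) = H (cv2 \<theta>' 0)" using LIMSEQ_unique by blast
    then have G: "G \<theta>' = G \<theta>" by (simp add: frame_map_def)
    \<comment> \<open>The limits may be different parameters of one point. Shifting by their
      difference, which is a period, brings the second sequence into the neighbourhood of the first
      limit.\<close>
    have l2: "(\<lambda>n. (d' \<circ> s \<circ> s') n + cv2 (\<theta> - \<theta>') 0) \<longlonglongrightarrow> cv2 \<theta> 0"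
    proof -
      have "cv2 \<theta>' 0 + cv2 (\<theta> - \<theta>') 0 = cv2 \<theta> 0" by (simp add: cv2_def vec_eq_iff complex_eq_iff)
      then show ?thesis using tendsto_add[OF s'(2) tendsto_const[of "cv2 (\<theta> - \<theta>') 0"]] by simp
    qed
    obtain V where V: "open V" "cv2 \<theta> 0 \<in> V" "inj_on H V" by (rule H_local)
    have "\<forall>\<^sub>F n in sequentially. (d \<circ> s \<circ> s') n \<in> V \<and> (d' \<circ> s \<circ> s') n + cv2 (\<theta> - \<theta>') 0 \<in> V"
      using topological_tendstoD[OF l1 V(1,2)] topological_tendstoD[OF l2 V(1,2)] by eventually_elim simp
    then obtain n where n: "(d \<circ> s \<circ> s') n \<in> V" "(d' \<circ> s \<circ> s') n + cv2 (\<theta> - \<theta>') 0 \<in> V"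
      using eventually_happens' sequentially_bot by blast
    define m where "m = s (s' n)"
    have m: "d m \<in> V" "d' m + cv2 (\<theta> - \<theta>') 0 \<in> V" using n by (simp_all add: m_def)
    have "H (d' m + cv2 (\<theta> - \<theta>') 0) = H (d m)"
      using H_shift[OF G] d(3)[of m] by simp
    then have e: "d m = d' m + cv2 (\<theta> - \<theta>') 0"
      using V(3) m by (metis inj_onD)
    have "G (rev2 (d m)) = G (rev2 (d' m))" "imv2 (d m) = imv2 (d' m)"
      unfolding e using per_G G unfolding periodic_wrt_def by simp_all
    then show False using d(3)[of m] by blast
  qed
  then obtain n where n: "\<forall>c c'. \<not> ?bad (1 / real (Suc n)) c c'" ..
  have "1 / real (Suc n) > 0" by simp
  with n show ?thesis by blast
qed

end

section \<open>Tangent planes, frame bounds and the projection along the frame\<close>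

context periodic_surface
begin

abbreviation "DG \<theta> \<equiv> frechet_derivative G (at \<theta>)"

lemma DG: "(G has_derivative DG \<theta>) (at \<theta>)"
  by (rule smooth_on_has_derivative[OF smooth_G UNIV_I])

lemma range_subset_tangent_space: "range (DG \<theta>) \<subseteq> tangent_space (range G) (G \<theta>)"
proof
  fix v assume "v \<in> range (DG \<theta>)"
  then obtain a where a: "v = DG \<theta> a" by blast
  have l: "smooth_on (\<lambda>t::real. \<theta> + t *\<^sub>R a) {-1<..<1}"
    by (intro smooth_on_add smooth_on_const smooth_on_scaleR smooth_on_ident open_greaterThanLessThan)
  have "((\<lambda>t. \<theta> + t *\<^sub>R a) has_derivative (\<lambda>t. t *\<^sub>R a)) (at 0)"
    by (auto intro!: derivative_eq_intros)
  moreover have "(G has_derivative DG \<theta>) (at (\<theta> + 0 *\<^sub>R a))" using DG by simp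
  ultimately have "((\<lambda>t. G (\<theta> + t *\<^sub>R a)) has_derivative (\<lambda>t. DG \<theta> (t *\<^sub>R a))) (at 0)"
    by (rule has_derivative_compose)
  then have "((\<lambda>t. G (\<theta> + t *\<^sub>R a)) has_vector_derivative v) (at 0)"
    unfolding has_vector_derivative_def a linear_scale[OF has_derivative_linear[OF DG]] .
  moreover have "smooth_on (\<lambda>t. G (\<theta> + t *\<^sub>R a)) {-1<..<1}"
    by (rule smooth_on_compose_UNIV[OF open_greaterThanLessThan smooth_G l])
  ultimately show "v \<in> tangent_space (range G) (G \<theta>)"
    unfolding tangent_space_def
    by (intro CollectI exI[of _ 1] conjI exI[of _ "\<lambda>t. G (\<theta> + t *\<^sub>R a)"]) auto
qed

abbreviation "X k \<theta> \<equiv> DG \<theta> (axis k 1)"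

lemma DG_expand: "DG \<theta> a = a $ 1 *\<^sub>R X 1 \<theta> + a $ 2 *\<^sub>R X 2 \<theta>"
proof -
  have "a = a $ 1 *\<^sub>R axis 1 1 + a $ 2 *\<^sub>R axis 2 1"
    by (simp add: vec_eq_iff forall_2 axis_def)
  then show ?thesis
    using linear_add[OF has_derivative_linear[OF DG]] linear_scale[OF has_derivative_linear[OF DG]] by metis
qed

lemma smooth_X: "smooth_on (X k) UNIV"
  by (rule smooth_on_derivative[OF smooth_G])

lemma per_X: "periodic_wrt G (X k)"
  by (rule periodic_frechet_derivative[OF per_G smooth_G])

end

context framed_surface
begin

lemma DH: "(H has_derivative frechet_derivative H (at c)) (at c)"
  by (rule smooth_on_has_derivative[OF smooth_H UNIV_I])

lemma H_cv2: "H (cv2 \<theta> b) = G \<theta> + frame_sum Y \<theta> b"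
  by (simp add: frame_map_def)

text \<open>On the compact set of parameters in \<open>Q\<close> and unit vectors \<open>b\<close>
  the frame sum is continuous and never 0; homogeneity in \<open>b\<close> and periodicity extend
  the bounds. They translate between the length of a fibre vector and that of its
  coefficients.\<close>

lemma frame_sum_bounds:
  obtains m M where "m > 0" "M > 0" "\<And>\<theta> b. m * norm b \<le> norm (frame_sum Y \<theta> b)"
    "\<And>\<theta> b. norm (frame_sum Y \<theta> b) \<le> M * norm b"
proof -
  let ?S = "Q \<times> sphere (0::real^2) 1" and ?f = "\<lambda>(\<theta>, b). norm (frame_sum Y \<theta> b)"
  have "smooth_on (\<lambda>p. frame_sum Y (fst p) (snd p)) UNIV"
    by (intro smooth_on_frame_sum smooth_Y smooth_on_fst smooth_on_snd smooth_on_ident open_UNIV)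
  then have "continuous_on ?S (\<lambda>p. frame_sum Y (fst p) (snd p))"
    using smooth_on_imp_continuous_on continuous_on_subset by blast
  then have c: "continuous_on ?S ?f"
    by (auto simp: case_prod_unfold intro: continuous_on_norm)
  have S: "compact ?S" by (intro compact_Times compact_Q compact_sphere)
  have ne: "?S \<noteq> {}"
  proof -
    have "axis 1 1 \<in> sphere (0::real^2) 1" by (simp add: norm_axis_1)
    moreover obtain \<theta> where "\<theta> \<in> Q" using cover_Q by blast
    ultimately show ?thesis by blast
  qed
  obtain p where p: "p \<in> ?S" "\<And>q. q \<in> ?S \<Longrightarrow> ?f p \<le> ?f q"
    using continuous_attains_inf[OF S ne c] by blast
  obtain p' where p': "p' \<in> ?S" "\<And>q. q \<in> ?S \<Longrightarrow> ?f q \<le> ?f p'"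
    using continuous_attains_sup[OF S ne c] by blast
  have pos: "?f q > 0" if qS: "q \<in> ?S" for q
  proof -
    obtain \<theta> b where q: "q = (\<theta>, b)" "norm b = 1" using qS by (cases q) auto
    have "frame_sum Y \<theta> b \<noteq> 0"
      using compl[of \<theta>] q(2) linear_0[OF has_derivative_linear[OF DG]] unfolding complementary_def
      by (metis add_0 norm_zero zero_neq_one)
    then show ?thesis using q by simp
  qed
  have b: "?f p * norm b \<le> norm (frame_sum Y \<theta> b) \<and> norm (frame_sum Y \<theta> b) \<le> ?f p' * norm b" for \<theta> b
  proof (cases "b = 0")
    case False
    obtain \<theta>' where \<theta>': "\<theta>' \<in> Q" "G \<theta>' = G \<theta>" using cover_Q by blast
    let ?u = "(1 / norm b) *\<^sub>R b"
    have in_S: "(\<theta>', ?u) \<in> ?S" using \<theta>' False by simp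
    have e: "frame_sum Y \<theta>' ?u = (1 / norm b) *\<^sub>R frame_sum Y \<theta> b"
      unfolding linear_scale[OF linear_frame_sum] using frame_sum_eq[OF \<theta>'(2)] by simp
    show ?thesis
      using p(2)[OF in_S] p'(2)[OF in_S] False unfolding prod.case e by (simp add: field_simps case_prod_unfold)
  qed simp
  show ?thesis
    using that[of "?f p" "?f p'"] pos[OF p(1)] pos[OF p'(1)] b by blast
qed

text \<open>In tube coordinates the projection is \<open>G\<close> after \<open>rev2\<close>, and
  \<open>fib\<close> lets it descend. Differentiating \<open>\<pi> (H c) = G (rev2 c)\<close> and
  cancelling the surjections \<open>rev2\<close> and the derivative of \<open>H\<close> leaves the
  two ranges.\<close>

lemma tubular_retraction:
  assumes "open S" and "local_diffeo_on H S"
    and fib: "\<And>c c'. c \<in> S \<Longrightarrow> c' \<in> S \<Longrightarrow> H c = H c' \<Longrightarrow> G (rev2 c) = G (rev2 c')"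
  obtains \<pi> where "smooth_on \<pi> (H ` S)" "\<And>c. c \<in> S \<Longrightarrow> \<pi> (H c) = G (rev2 c)"
    "\<And>c. c \<in> S \<Longrightarrow> range (frechet_derivative \<pi> (at (H c))) = range (DG (rev2 c))"
proof -
  have "smooth_on (\<lambda>c. G (rev2 c)) S"
    by (rule smooth_on_subset[OF smooth_on_compose_UNIV[OF open_UNIV smooth_G smooth_on_rev2]]) simp
  from smooth_descent[OF assms(2) this fib]
  obtain \<pi> where \<pi>: "smooth_on \<pi> (H ` S)" "\<And>c. c \<in> S \<Longrightarrow> \<pi> (H c) = G (rev2 c)"
    by blast
  have "range (frechet_derivative \<pi> (at (H c))) = range (DG (rev2 c))" if c: "c \<in> S" for c
  proof -
    let ?D = "frechet_derivative \<pi> (at (H c))" and ?DH = "frechet_derivative H (at c)"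
    have D\<pi>: "(\<pi> has_derivative ?D) (at (H c))"
      by (rule smooth_on_has_derivative[OF \<pi>(1)]) (use c in blast)
    have "((\<lambda>c. \<pi> (H c)) has_derivative (\<lambda>v. ?D (?DH v))) (at c)"
      by (rule has_derivative_compose[OF DH D\<pi>])
    then have "((\<lambda>c. G (rev2 c)) has_derivative (\<lambda>v. ?D (?DH v))) (at c)"
      by (rule has_derivative_transform_within_open[OF _ \<open>open S\<close> c]) (use \<pi>(2) in simp)
    moreover have "((\<lambda>c. G (rev2 c)) has_derivative (\<lambda>v. DG (rev2 c) (rev2 v))) (at c)"
      by (rule has_derivative_compose[OF bounded_linear_imp_has_derivative[OF bounded_linear_rev2] DG])
    ultimately have e: "(\<lambda>v. ?D (?DH v)) = (\<lambda>v. DG (rev2 c) (rev2 v))"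
      by (rule has_derivative_unique)
    have "surj ?DH"
      by (rule linear_injective_imp_surjective[OF has_derivative_linear[OF DH]])
        (use assms(2) c in \<open>auto simp: local_diffeo_on_def\<close>)
    then have "range ?D = range (\<lambda>v. ?D (?DH v))" by (metis image_image)
    also have "\<dots> = range (DG (rev2 c))"
    proof -
      have "range rev2 = UNIV" by (metis rev2_cv2 surj_def)
      then show ?thesis unfolding e by (metis image_image)
    qed
    finally show ?thesis .
  qed
  then show ?thesis using that \<pi> by blast
qed

lemma good_radius:
  obtains r where "r > 0" "local_diffeo_on H {c. norm (imv2 c) < r}"
    "\<And>c c'. norm (imv2 c) < r \<Longrightarrow> norm (imv2 c') < r \<Longrightarrow> H c = H c' \<Longrightarrow> G (rev2 c) = G (rev2 c') \<and> imv2 c = imv2 c'"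
proof -
  obtain r where r: "r > 0" "local_diffeo_on H {c. norm (imv2 c) < r}"
    using H_local_diffeo by blast
  obtain s where s: "s > 0" "\<And>c c'. norm (imv2 c) < s \<Longrightarrow> norm (imv2 c') < s \<Longrightarrow> H c = H c' \<Longrightarrow> G (rev2 c) = G (rev2 c') \<and> imv2 c = imv2 c'"
    using H_inj by metis
  have o: "open {c. norm (imv2 c) < min r s}"
    by (intro open_Collect_less continuous_intros linear_continuous_on[OF bounded_linear_imv2])
  have "local_diffeo_on H {c. norm (imv2 c) < min r s}"
    by (rule local_diffeo_on_subset[OF r(2) o]) auto
  then show ?thesis using that[of "min r s"] r(1) s by simp
qed

text \<open>No lift of curves to parameters is needed: a curve in the surface is fixed by the
  retraction \<open>\<pi>\<close>, so its velocity is fixed by the derivative of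
  \<open>\<pi>\<close>, whose range is that of \<open>DG \<theta>\<close>.\<close>

lemma tangent_space_range: "tangent_space (range G) (G \<theta>) = range (DG \<theta>)"
proof
  show "range (DG \<theta>) \<subseteq> tangent_space (range G) (G \<theta>)" by (rule range_subset_tangent_space)
  show "tangent_space (range G) (G \<theta>) \<subseteq> range (DG \<theta>)"
  proof
    fix v assume "v \<in> tangent_space (range G) (G \<theta>)"
    then obtain e \<gamma> where e: "e > 0" "\<gamma> ` {-e<..<e} \<subseteq> range G" "\<gamma> 0 = G \<theta>" "(\<gamma> has_vector_derivative v) (at 0)"
      unfolding tangent_space_def by blast
    obtain r where r: "r > 0" "local_diffeo_on H {c. norm (imv2 c) < r}"
      "\<And>c c'. norm (imv2 c) < r \<Longrightarrow> norm (imv2 c') < r \<Longrightarrow> H c = H c' \<Longrightarrow> G (rev2 c) = G (rev2 c') \<and> imv2 c = imv2 c'"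
      by (rule good_radius) blast
    let ?S = "{c. norm (imv2 c) < r}"
    obtain \<pi> where \<pi>: "smooth_on \<pi> (H ` ?S)" "\<And>c. c \<in> ?S \<Longrightarrow> \<pi> (H c) = G (rev2 c)"
      "\<And>c. c \<in> ?S \<Longrightarrow> range (frechet_derivative \<pi> (at (H c))) = range (DG (rev2 c))"
    proof (rule tubular_retraction[OF _ r(2)])
      show "open ?S" using r(2) unfolding local_diffeo_on_def by simp
      show "G (rev2 c) = G (rev2 c')" if "c \<in> ?S" "c' \<in> ?S" "H c = H c'" for c c'
        using r(3)[of c c'] that by simp
    qed blast
    have fix_G: "\<pi> (G \<theta>) = G \<theta>" "G \<theta> \<in> H ` ?S" for \<theta>
    proof -
      have "cv2 \<theta> 0 \<in> ?S" "G \<theta> = H (cv2 \<theta> 0)" using r(1) by (simp_all add: H_cv2)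
      then show "\<pi> (G \<theta>) = G \<theta>" "G \<theta> \<in> H ` ?S" using \<pi>(2) by (metis rev2_cv2, blast)
    qed
    let ?D = "frechet_derivative \<pi> (at (G \<theta>))"
    have D: "(\<pi> has_derivative ?D) (at (\<gamma> 0))"
      unfolding e(3) by (rule smooth_on_has_derivative[OF \<pi>(1) fix_G(2)])
    have "((\<lambda>t. \<pi> (\<gamma> t)) has_derivative (\<lambda>t. ?D (t *\<^sub>R v))) (at 0)"
      by (rule has_derivative_compose[OF e(4)[unfolded has_vector_derivative_def] D])
    then have "(\<gamma> has_derivative (\<lambda>t. ?D (t *\<^sub>R v))) (at 0)"
    proof (rule has_derivative_transform_within_open)
      show "\<pi> (\<gamma> t) = \<gamma> t" if "t \<in> {-e<..<e}" for t
      proof -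
        have "\<gamma> t \<in> range G" using e(2) that by blast
        then obtain x where "\<gamma> t = G x" by blast
        then show ?thesis using fix_G(1) by simp
      qed
    qed (use e(1) in simp_all)
    then have "(\<lambda>t. ?D (t *\<^sub>R v)) = (\<lambda>t. t *\<^sub>R v)"
      by (rule has_derivative_unique[OF _ e(4)[unfolded has_vector_derivative_def]])
    then have "v = ?D v" by (metis scaleR_one)
    then have "v \<in> range ?D" by blast
    moreover have "range ?D = range (DG \<theta>)"
      using \<pi>(3)[of "cv2 \<theta> 0"] r(1) by (simp add: H_cv2)
    ultimately show "v \<in> range (DG \<theta>)" by simp
  qed
qed

end

section \<open>The orthogonal frame and the tubular neighbourhood\<close>

context framed_surface
begin

text \<open>The Gram determinant of the tangent frame times the orthogonal projection of the frame
  \<open>Y\<close> to the normal spaces; the factor avoids division.\<close>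

definition gram :: "real ^ 2 \<Rightarrow> real" where
  "gram \<theta> = (X 1 \<theta> \<bullet> X 1 \<theta>) * (X 2 \<theta> \<bullet> X 2 \<theta>) - (X 1 \<theta> \<bullet> X 2 \<theta>) * (X 1 \<theta> \<bullet> X 2 \<theta>)"

definition normal_frame :: "2 \<Rightarrow> real ^ 2 \<Rightarrow> complex ^ 2" where
  "normal_frame k \<theta> = gram \<theta> *\<^sub>R Y k \<theta>
     - ((Y k \<theta> \<bullet> X 1 \<theta>) * (X 2 \<theta> \<bullet> X 2 \<theta>) - (Y k \<theta> \<bullet> X 2 \<theta>) * (X 1 \<theta> \<bullet> X 2 \<theta>)) *\<^sub>R X 1 \<theta>
     - ((Y k \<theta> \<bullet> X 2 \<theta>) * (X 1 \<theta> \<bullet> X 1 \<theta>) - (Y k \<theta> \<bullet> X 1 \<theta>) * (X 1 \<theta> \<bullet> X 2 \<theta>)) *\<^sub>R X 2 \<theta>"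

lemma inj_DG: "DG \<theta> a = 0 \<Longrightarrow> a = 0"
  using compl[of \<theta>] unfolding complementary_def by (metis add.right_neutral frame_sum_0)

text \<open>The vector \<open>?w\<close> has squared length
  \<open>X 2 \<theta> \<bullet> X 2 \<theta>\<close> times \<open>gram \<theta>\<close>. If
  \<open>gram \<theta>\<close> were 0, \<open>?w = 0\<close> would be a relation between the tangent
  vectors, whose first coefficient, the squared length of \<open>X 2 \<theta>\<close>, would have to
  vanish.\<close>

lemma gram_nonzero: "gram \<theta> \<noteq> 0"
proof
  assume g: "gram \<theta> = 0"
  let ?w = "(X 2 \<theta> \<bullet> X 2 \<theta>) *\<^sub>R X 1 \<theta> - (X 1 \<theta> \<bullet> X 2 \<theta>) *\<^sub>R X 2 \<theta>"
  have "?w \<bullet> ?w = (X 2 \<theta> \<bullet> X 2 \<theta>) * gram \<theta>"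
    by (simp add: gram_def inner_diff_left inner_diff_right inner_commute algebra_simps)
  then have w: "?w = 0" using g by simp
  let ?a = "(\<chi> k. if k = 1 then X 2 \<theta> \<bullet> X 2 \<theta> else - (X 1 \<theta> \<bullet> X 2 \<theta>)) :: real ^ 2"
  have "DG \<theta> ?a = 0" unfolding DG_expand[of \<theta> ?a] using w by simp
  then have "?a $ 1 = 0" using inj_DG[of \<theta> ?a] by simp
  then have "X 2 \<theta> = 0" by simp
  then have "axis 2 1 = (0::real^2)" by (rule inj_DG)
  then show False by simp
qed

lemma normal_frame_orthogonal: "normal_frame k \<theta> \<bullet> DG \<theta> a = 0"
proof -
  have "normal_frame k \<theta> \<bullet> X 1 \<theta> = 0" "normal_frame k \<theta> \<bullet> X 2 \<theta> = 0"
    by (simp_all add: normal_frame_def gram_def inner_diff_left inner_commute algebra_simps)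
  then show ?thesis unfolding DG_expand[of \<theta> a] by (simp add: inner_add_right)
qed

lemma frame_sum_normal_frame:
  "\<exists>a. frame_sum normal_frame \<theta> b = gram \<theta> *\<^sub>R frame_sum Y \<theta> b + DG \<theta> a"
proof -
  let ?p = "\<lambda>k. (Y k \<theta> \<bullet> X 1 \<theta>) * (X 2 \<theta> \<bullet> X 2 \<theta>) - (Y k \<theta> \<bullet> X 2 \<theta>) * (X 1 \<theta> \<bullet> X 2 \<theta>)"
  let ?q = "\<lambda>k. (Y k \<theta> \<bullet> X 2 \<theta>) * (X 1 \<theta> \<bullet> X 1 \<theta>) - (Y k \<theta> \<bullet> X 1 \<theta>) * (X 1 \<theta> \<bullet> X 2 \<theta>)"
  let ?a = "(\<chi> j. if j = 1 then - (b $ 1 * ?p 1 + b $ 2 * ?p 2) else - (b $ 1 * ?q 1 + b $ 2 * ?q 2)) :: real ^ 2"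
  have "frame_sum normal_frame \<theta> b = gram \<theta> *\<^sub>R frame_sum Y \<theta> b + DG \<theta> ?a"
    unfolding DG_expand[of \<theta> ?a] frame_sum_def sum_2 normal_frame_def
    by (simp add: algebra_simps scaleR_diff_right)
  then show ?thesis by blast
qed

text \<open>Scaling by the nonzero \<open>gram\<close> and subtracting tangent vectors keeps the
  frame complementary to the tangent plane. All results on framed surfaces thus hold for the
  orthogonal frame, to which the normal bundle refers.\<close>

lemma normal_framed_surface: "framed_surface G Q normal_frame"
proof
  show "smooth_on (normal_frame k) UNIV" for k
    unfolding normal_frame_def[abs_def] gram_def
    by (intro smooth_on_diff smooth_on_scaleR smooth_on_mult smooth_on_inner smooth_X smooth_Y open_UNIV)
  show "periodic_wrt G (normal_frame k)" for k
    using per_X[of 1] per_X[of 2] per_Y[of k]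
    unfolding normal_frame_def gram_def periodic_wrt_def by simp
  show "complementary G normal_frame \<theta>" for \<theta>
    unfolding complementary_def
  proof (intro allI impI)
    fix a b assume *: "DG \<theta> a + frame_sum normal_frame \<theta> b = 0"
    obtain a' where a': "frame_sum normal_frame \<theta> b = gram \<theta> *\<^sub>R frame_sum Y \<theta> b + DG \<theta> a'"
      using frame_sum_normal_frame by blast
    have "DG \<theta> (a + a') + frame_sum Y \<theta> (gram \<theta> *\<^sub>R b) = 0"
      using * unfolding a' linear_scale[OF linear_frame_sum] linear_add[OF has_derivative_linear[OF DG]]
      by (simp add: algebra_simps)
    then have "gram \<theta> *\<^sub>R b = 0"
      using compl[of \<theta>] unfolding complementary_def by blast
    then have "b = 0" using gram_nonzero by simp
    moreover from this have "a = 0" using * inj_DG by simp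
    ultimately show "a = 0 \<and> b = 0" by simp
  qed
qed

text \<open>Every vector is a tangent vector plus a combination of the normal frame. If it is
  orthogonal to the tangent plane, its tangent part is orthogonal to itself.\<close>

lemma normal_space:
  "orthogonal_comp (tangent_space (range G) (G \<theta>)) = range (frame_sum normal_frame \<theta>)"
proof -
  interpret N: framed_surface G Q normal_frame by (rule normal_framed_surface)
  have orth: "orthogonal (DG \<theta> a) (frame_sum normal_frame \<theta> b)" for a b
    unfolding orthogonal_def frame_sum_def inner_sum_right
    by (simp add: normal_frame_orthogonal inner_commute[of "DG \<theta> a"])
  show ?thesis
    unfolding tangent_space_range
  proof
    show "range (frame_sum normal_frame \<theta>) \<subseteq> orthogonal_comp (range (DG \<theta>))"
      using orth by (auto simp: orthogonal_comp_def)
    show "orthogonal_comp (range (DG \<theta>)) \<subseteq> range (frame_sum normal_frame \<theta>)"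
    proof
      fix v assume v: "v \<in> orthogonal_comp (range (DG \<theta>))"
      have "surj (frechet_derivative N.H (at (cv2 \<theta> 0)))"
        by (rule linear_injective_imp_surjective[OF has_derivative_linear[OF N.DH]
            complementary_imp_inj[OF smooth_G N.smooth_Y N.compl]]) (rule refl)
      then obtain c where c: "v = frechet_derivative N.H (at (cv2 \<theta> 0)) c" by blast
      let ?t = "DG \<theta> (rev2 c)"
      have v': "v = ?t + frame_sum normal_frame \<theta> (imv2 c)"
        unfolding c by (rule frechet_derivative_frame_map[OF smooth_G N.smooth_Y])
      have "?t \<bullet> v = 0" using v unfolding orthogonal_comp_def orthogonal_def by blast
      then have "?t \<bullet> ?t = 0" using orth[of "rev2 c" "imv2 c"] unfolding v' orthogonal_def by (simp add: inner_add_right)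
      then have "?t = 0" by simp
      then show "v \<in> range (frame_sum normal_frame \<theta>)" unfolding v' by simp
    qed
  qed
qed

text \<open>One parameter set \<open>S\<close> is mapped by two tube maps: by that of
  \<open>normal_frame\<close> to the orthogonal tube, and by that of \<open>Y\<close> to the
  neighbourhood \<open>U\<close>. \<open>S\<close> is cut out by the length of the normal vector,
  not of its coefficients, so it corresponds to a disc bundle \<open>W\<close>, which is
  star-shaped. The projection has the directions of \<open>Y\<close> as fibres, as the perturbation
  requires. The last clause supplies smaller open tubes, between which the perturbation will act as
  a diffeomorphism.\<close>

lemma frame_tubular:
  obtains U \<pi> \<rho> where "tubular_neighbourhood (range G) U" "smooth_submersion U (range G) \<pi>"
    "\<And>\<theta>. \<pi> (G \<theta>) = G \<theta>" "\<rho> > 0"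
    "\<And>\<theta> b. norm b < \<rho> \<Longrightarrow> G \<theta> + frame_sum Y \<theta> b \<in> U \<and> \<pi> (G \<theta> + frame_sum Y \<theta> b) = G \<theta>"
    "\<And>\<rho>'. \<rho>' \<le> \<rho> \<Longrightarrow> open {y. \<exists>\<theta> b. norm b < \<rho>' \<and> y = G \<theta> + frame_sum Y \<theta> b}"
proof -
  interpret N: framed_surface G Q normal_frame by (rule normal_framed_surface)
  obtain r1 where r1: "r1 > 0" "local_diffeo_on H {c. norm (imv2 c) < r1}"
    "\<And>c c'. norm (imv2 c) < r1 \<Longrightarrow> norm (imv2 c') < r1 \<Longrightarrow> H c = H c' \<Longrightarrow> G (rev2 c) = G (rev2 c') \<and> imv2 c = imv2 c'"
    by (rule good_radius) blast
  obtain r2 where r2: "r2 > 0" "local_diffeo_on N.H {c. norm (imv2 c) < r2}"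
    "\<And>c c'. norm (imv2 c) < r2 \<Longrightarrow> norm (imv2 c') < r2 \<Longrightarrow> N.H c = N.H c' \<Longrightarrow> G (rev2 c) = G (rev2 c') \<and> imv2 c = imv2 c'"
    by (rule N.good_radius) blast
  obtain m M where m: "m > 0" "M > 0" "\<And>\<theta> b. m * norm b \<le> norm (frame_sum normal_frame \<theta> b)"
    "\<And>\<theta> b. norm (frame_sum normal_frame \<theta> b) \<le> M * norm b"
    by (rule N.frame_sum_bounds) blast
  \<comment> \<open>By the lower frame bound, a normal vector shorter than \<open>r\<close> has
    coefficients shorter than both \<open>r1\<close> and \<open>r2\<close>, so both tube maps behave
    well.\<close>
  define r where "r = m * min r1 r2"
  have "r > 0" using m(1) r1(1) r2(1) by (simp add: r_def)
  define nu where "nu c = frame_sum normal_frame (rev2 c) (imv2 c)" for c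
  have smooth_nu: "smooth_on nu UNIV"
    unfolding nu_def[abs_def]
    by (intro smooth_on_frame_sum N.smooth_Y smooth_on_rev2 smooth_on_imv2 open_UNIV)
  define S where "S = {c. norm (nu c) < r}"
  have openS: "open S"
    unfolding S_def using smooth_on_imp_continuous_on[OF smooth_nu] by (intro open_Collect_less continuous_intros)
  have S: "norm (imv2 c) < r1" "norm (imv2 c) < r2" if "c \<in> S" for c
  proof -
    have "m * norm (imv2 c) < m * min r1 r2"
      using that m(3)[of "imv2 c" "rev2 c"] unfolding S_def nu_def r_def by simp
    then show "norm (imv2 c) < r1" "norm (imv2 c) < r2" using m(1) by simp_all
  qed
  have dH: "local_diffeo_on H S" by (rule local_diffeo_on_subset[OF r1(2) openS]) (use S in auto)
  have dN: "local_diffeo_on N.H S" by (rule local_diffeo_on_subset[OF r2(2) openS]) (use S in auto)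
  have fibH: "G (rev2 c) = G (rev2 c') \<and> imv2 c = imv2 c'" if "c \<in> S" "c' \<in> S" "H c = H c'" for c c'
    by (rule r1(3)) (use S that in auto)
  have fibN: "G (rev2 c) = G (rev2 c') \<and> imv2 c = imv2 c'" if "c \<in> S" "c' \<in> S" "N.H c = N.H c'" for c c'
    by (rule r2(3)) (use S that in auto)
  obtain \<pi> where \<pi>: "smooth_on \<pi> (H ` S)" "\<And>c. c \<in> S \<Longrightarrow> \<pi> (H c) = G (rev2 c)"
    "\<And>c. c \<in> S \<Longrightarrow> range (frechet_derivative \<pi> (at (H c))) = range (DG (rev2 c))"
    by (rule tubular_retraction[OF openS dH]) (use fibH in blast)+
  obtain \<Phi>' where \<Phi>': "smooth_on \<Phi>' (N.H ` S)" "\<And>c. c \<in> S \<Longrightarrow> \<Phi>' (N.H c) = H c"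
  proof (rule smooth_descent[OF dN smooth_on_subset[OF smooth_H subset_UNIV]])
    fix c c' assume "c \<in> S" "c' \<in> S" "N.H c = N.H c'"
    then have "G (rev2 c) = G (rev2 c') \<and> imv2 c = imv2 c'" by (rule fibN)
    then show "H c = H c'" unfolding frame_map_def using frame_sum_eq by metis
  qed blast
  define w where "w c = (G (rev2 c), nu c)" for c
  have smooth_w: "smooth_on w S"
    unfolding w_def[abs_def]
    by (rule smooth_on_subset[OF smooth_on_Pair[OF open_UNIV smooth_on_compose_UNIV[OF open_UNIV smooth_G smooth_on_rev2] smooth_nu]]) simp
  obtain \<Psi> where \<Psi>: "smooth_on \<Psi> (H ` S)" "\<And>c. c \<in> S \<Longrightarrow> \<Psi> (H c) = w c"
  proof (rule smooth_descent[OF dH smooth_w])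
    fix c c' assume "c \<in> S" "c' \<in> S" "H c = H c'"
    then have "G (rev2 c) = G (rev2 c') \<and> imv2 c = imv2 c'" by (rule fibH)
    then show "w c = w c'" unfolding w_def nu_def using N.frame_sum_eq by metis
  qed blast
  \<comment> \<open>The pair \<open>p\<close> is read as a point of the orthogonal tube;
    \<open>\<Phi>'\<close> then moves it to the tube of \<open>Y\<close>, keeping parameter and
    coefficients.\<close>
  define \<Phi> where "\<Phi> p = \<Phi>' (fst p + snd p)" for p
  define W where "W = normal_bundle (range G) \<inter> {p. norm (snd p) < r}"
  have W: "W = w ` S"
  proof
    show "w ` S \<subseteq> W"
      unfolding W_def normal_bundle_def w_def S_def nu_def by (auto simp: normal_space)
    show "W \<subseteq> w ` S"
    proof
      fix p assume p: "p \<in> W"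
      then obtain \<theta> where \<theta>: "fst p = G \<theta>" unfolding W_def normal_bundle_def by auto
      have "snd p \<in> range (frame_sum normal_frame \<theta>)"
        using p unfolding W_def normal_bundle_def normal_space[symmetric] \<theta>[symmetric] by auto
      then obtain b where b: "snd p = frame_sum normal_frame \<theta> b" by blast
      have "w (cv2 \<theta> b) = p" "cv2 \<theta> b \<in> S"
        using \<theta> b p by (auto simp: w_def nu_def S_def W_def prod_eq_iff)
      then show "p \<in> w ` S" by blast
    qed
  qed
  have \<Phi>w: "\<Phi> (w c) = H c" if "c \<in> S" for c
    using \<Phi>'(2)[OF that] by (simp add: \<Phi>_def w_def nu_def frame_map_def)
  have zero_S: "cv2 \<theta> 0 \<in> S" for \<theta>
    using \<open>r > 0\<close> by (simp add: S_def nu_def)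
  have openU: "open (H ` S)" by (rule open_local_diffeo_image[OF dH])
  have openUN: "open (N.H ` S)" by (rule open_local_diffeo_image[OF dN])
  have "tubular_neighbourhood (range G) (H ` S)"
    unfolding tubular_neighbourhood_def
  proof (intro conjI exI)
    show "open (H ` S)" by fact
    show "openin (top_of_set (normal_bundle (range G))) W"
      unfolding W_def by (intro openin_open_Int open_Collect_less continuous_intros)
    show "\<forall>p\<in>range G. (p, 0) \<in> W"
    proof safe
      fix \<theta>
      have "w (cv2 \<theta> 0) = (G \<theta>, 0)" by (simp add: w_def nu_def)
      then show "(G \<theta>, 0) \<in> W" unfolding W using zero_S by (metis imageI)
    qed
    show "\<forall>p v. \<forall>t\<in>{0..1}. (p, v) \<in> W \<longrightarrow> (p, t *\<^sub>R v) \<in> W"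
    proof (intro allI ballI impI)
      fix p v and t :: real assume t: "t \<in> {0..1}" and pv: "(p, v) \<in> W"
      have "norm (t *\<^sub>R v) \<le> norm v" using t by (simp add: mult_left_le_one_le)
      then show "(p, t *\<^sub>R v) \<in> W"
        using pv by (auto simp: W_def normal_bundle_def orthogonal_comp_def orthogonal_def)
    qed
    show "\<forall>p\<in>range G. \<Phi> (p, 0) = p"
    proof safe
      fix \<theta>
      have "w (cv2 \<theta> 0) = (G \<theta>, 0)" by (simp add: w_def nu_def)
      then show "\<Phi> (G \<theta>, 0) = G \<theta>" using \<Phi>w[OF zero_S] by (metis H_cv2 add.right_neutral frame_sum_0)
    qed
    show "diffeomorphism W (H ` S) \<Phi> \<Psi>"
      unfolding diffeomorphism_def
    proof (intro conjI)
      have sum_smooth: "smooth_on (\<lambda>p. fst p + snd p) (UNIV :: ((complex ^ 2) \<times> (complex ^ 2)) set)"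
        by (intro smooth_on_add smooth_on_fst smooth_on_snd smooth_on_ident open_UNIV)
      have oP: "open {p. fst p + snd p \<in> N.H ` S}"
        using open_vimage[OF openUN smooth_on_imp_continuous_on[OF sum_smooth]] by (simp add: vimage_def)
      have sm: "smooth_on \<Phi> {p. fst p + snd p \<in> N.H ` S}"
        unfolding \<Phi>_def
        by (rule smooth_on_compose[OF oP openUN _ smooth_on_subset[OF sum_smooth subset_UNIV] \<Phi>'(1)]) auto
      have "w c \<in> {p. fst p + snd p \<in> N.H ` S}" if "c \<in> S" for c
        using that by (auto simp: w_def nu_def frame_map_def)
      then have "W \<subseteq> {p. fst p + snd p \<in> N.H ` S}" unfolding W by blast
      then show "smooth_map \<Phi> W"
        unfolding smooth_map_def using oP sm by blast
      show "\<Phi> ` W = H ` S" unfolding W using \<Phi>w by (auto simp: image_iff)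
      show "\<forall>x\<in>W. \<Psi> (\<Phi> x) = x" unfolding W using \<Phi>w \<Psi>(2) by simp
      show "smooth_map \<Psi> (H ` S)"
        unfolding smooth_map_def using openU \<Psi>(1) by blast
      show "\<Psi> ` (H ` S) = W" unfolding W using \<Psi>(2) by (auto simp: image_iff)
      show "\<forall>y\<in>H ` S. \<Phi> (\<Psi> y) = y" using \<Phi>w \<Psi>(2) by simp
    qed
  qed
  moreover have "smooth_submersion (H ` S) (range G) \<pi>"
    unfolding smooth_submersion_def
    using openU \<pi> tangent_space_range by auto
  moreover have "\<pi> (G \<theta>) = G \<theta>" for \<theta>
    using \<pi>(2)[OF zero_S[of \<theta>]] by (simp add: H_cv2)
  moreover have "r / M > 0" using \<open>r > 0\<close> m(2) by simp
  moreover have ball_S: "cv2 \<theta> b \<in> S" if "norm b < r / M" for \<theta> b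
  proof -
    have "norm (frame_sum normal_frame \<theta> b) \<le> M * norm b" by (rule m(4))
    also have "\<dots> < r" using that m(2) by (simp add: field_simps)
    finally show ?thesis by (simp add: S_def nu_def)
  qed
  moreover have "G \<theta> + frame_sum Y \<theta> b \<in> H ` S \<and> \<pi> (G \<theta> + frame_sum Y \<theta> b) = G \<theta>"
    if "norm b < r / M" for \<theta> b
    using \<pi>(2) ball_S[OF that] unfolding H_cv2[symmetric] by (metis imageI rev2_cv2)
  moreover have "open {y. \<exists>\<theta> b. norm b < \<rho>' \<and> y = G \<theta> + frame_sum Y \<theta> b}" if le: "\<rho>' \<le> r / M" for \<rho>'
  proof -
    have o: "open {c. norm (imv2 c) < \<rho>'}"
      by (intro open_Collect_less continuous_intros linear_continuous_on[OF bounded_linear_imv2])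
    have "{c. norm (imv2 c) < \<rho>'} \<subseteq> S"
    proof
      fix c assume "c \<in> {c. norm (imv2 c) < \<rho>'}"
      then show "c \<in> S" using ball_S[of "imv2 c" "rev2 c"] le by simp
    qed
    from open_local_diffeo_image[OF local_diffeo_on_subset[OF dH o this]]
    have "open (H ` {c. norm (imv2 c) < \<rho>'})" .
    moreover have "H ` {c. norm (imv2 c) < \<rho>'} = {y. \<exists>\<theta> b. norm b < \<rho>' \<and> y = G \<theta> + frame_sum Y \<theta> b}"
    proof safe
      fix \<theta> b :: "real ^ 2" assume "norm b < \<rho>'"
      then show "G \<theta> + frame_sum Y \<theta> b \<in> H ` {c. norm (imv2 c) < \<rho>'}"
        by (intro image_eqI[of _ _ "cv2 \<theta> b"]) (simp_all add: H_cv2)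
    qed (auto simp: frame_map_def)
    ultimately show ?thesis by simp
  qed
  ultimately show ?thesis using that[of "H ` S" \<pi> "r / M"] by blast
qed

end

section \<open>Tori and their perturbations\<close>

lemma smooth_on_imp_smooth_map: "smooth_on f U \<Longrightarrow> open U \<Longrightarrow> S \<subseteq> U \<Longrightarrow> smooth_map f S"
  unfolding smooth_map_def by blast

lemma smooth_map_compose_smooth_on:
  assumes "open V" and e: "smooth_on e V" and g: "smooth_map g S" and eS: "e ` V \<subseteq> S"
  shows "smooth_on (\<lambda>x. g (e x)) V"
proof (rule smooth_on_local)
  fix x assume x: "x \<in> V"
  then have "e x \<in> S" using eS by blast
  then obtain W h where W: "open W" "e x \<in> W" "smooth_on h W" "\<forall>y\<in>S \<inter> W. h y = g y"
    using g unfolding smooth_map_def by meson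
  have o: "open (V \<inter> e -` W)"
    by (rule continuous_open_preimage[OF smooth_on_imp_continuous_on[OF e] assms(1) W(1)])
  have "smooth_on (\<lambda>x. h (e x)) (V \<inter> e -` W)"
    by (rule smooth_on_compose[OF o W(1) _ smooth_on_subset[OF e] W(3)]) auto
  then have "smooth_on (\<lambda>x. g (e x)) (V \<inter> e -` W)"
    by (rule smooth_on_cong[OF o, rotated]) (use W(4) eS in blast)
  then show "\<exists>V'. open V' \<and> x \<in> V' \<and> smooth_on (\<lambda>x. g (e x)) V'"
    using o x W(2) by blast
qed

lemma smooth_map_open: "open U \<Longrightarrow> smooth_map f U \<Longrightarrow> smooth_on f U"
  using smooth_map_compose_smooth_on[OF _ smooth_on_ident[of U], of f U] by simp

text \<open>\<open>G\<close> is the inverse diffeomorphism after the angle map \<open>e\<close>, so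
  parameters have the same image iff \<open>e\<close> agrees on them, which yields the periods. It
  is immersive because \<open>f\<close> after \<open>G\<close> is \<open>e\<close>, whose derivative
  is injective.\<close>

lemma torus_parametrization:
  fixes T :: "(complex ^ 2) set"
  assumes "diffeomorphic T (sphere 0 1 \<times> sphere 0 1 :: (complex \<times> complex) set)"
  obtains G Q where "periodic_surface G Q" "range G = T" "\<And>\<theta> a. frechet_derivative G (at \<theta>) a = 0 \<Longrightarrow> a = 0"
proof -
  let ?S = "sphere 0 1 \<times> sphere 0 1 :: (complex \<times> complex) set"
  obtain f g where fg: "smooth_map f T" "f ` T = ?S" "\<forall>x\<in>T. g (f x) = x"
    "smooth_map g ?S" "g ` ?S = T" "\<forall>y\<in>?S. f (g y) = y"
    using assms unfolding diffeomorphic_def diffeomorphism_def by blast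
  define e :: "real ^ 2 \<Rightarrow> complex \<times> complex" where "e \<theta> = (cis (\<theta> $ 1), cis (\<theta> $ 2))" for \<theta>
  have e_S: "e \<theta> \<in> ?S" for \<theta> by (simp add: e_def)
  have smooth_e: "smooth_on e UNIV"
    unfolding e_def[abs_def]
    by (intro smooth_on_Pair smooth_on_compose_UNIV[OF _ smooth_on_cis] smooth_on_vec_nth smooth_on_ident open_UNIV)
  define G where "G \<theta> = g (e \<theta>)" for \<theta>
  have smooth_G: "smooth_on G UNIV"
    unfolding G_def[abs_def] by (rule smooth_map_compose_smooth_on[OF open_UNIV smooth_e fg(4)]) (use e_S in blast)
  have fG: "f (G \<theta>) = e \<theta>" for \<theta> using fg(6) e_S unfolding G_def by blast
  have G_eq: "G \<theta> = G \<theta>' \<longleftrightarrow> e \<theta> = e \<theta>'" for \<theta> \<theta>'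
    using fG G_def by metis
  have per: "periodic_wrt G G"
    unfolding periodic_wrt_def G_eq
  proof (intro allI impI)
    fix \<theta> \<theta>' x assume "e \<theta> = e \<theta>'"
    then have "cis (\<theta> $ 1) = cis (\<theta>' $ 1)" "cis (\<theta> $ 2) = cis (\<theta>' $ 2)" by (simp_all add: e_def)
    then show "e (x + (\<theta>' - \<theta>)) = e x"
      by (simp add: e_def flip: cis_mult cis_divide)
  qed
  define Q where "Q = cbox (0 :: real ^ 2) (\<chi> k. 2 * pi)"
  have cover: "\<exists>\<theta>'\<in>Q. G \<theta>' = G \<theta>" for \<theta>
  proof -
    let ?t = "(\<chi> k. Arg2pi (cis (\<theta> $ k))) :: real ^ 2"
    have "cis (Arg2pi (cis t)) = cis t" for t
      using Arg2pi_eq[of "cis t"] by (simp add: cis_conv_exp)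
    then have "G ?t = G \<theta>" unfolding G_eq by (simp add: e_def)
    moreover have "?t \<in> Q"
      unfolding Q_def mem_box_cart by (auto simp: Arg2pi_ge_0 intro: less_imp_le Arg2pi_lt_2pi)
    ultimately show ?thesis by blast
  qed
  have "periodic_surface G Q"
    by (rule periodic_surface.intro[OF smooth_G per _ cover]) (simp add: Q_def compact_cbox)
  moreover have "range G = T"
  proof
    show "range G \<subseteq> T" using fg(5) e_S unfolding G_def by blast
    show "T \<subseteq> range G"
    proof
      fix x assume "x \<in> T"
      then obtain y where y: "x = g y" "y \<in> ?S" using fg(5) by blast
      have "cis (Arg2pi z) = z" if "norm z = 1" for z
        using Arg2pi_eq[of z] that by (simp add: cis_conv_exp)
      then have "e (\<chi> k. if k = 1 then Arg2pi (fst y) else Arg2pi (snd y)) = y"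
        using y(2) by (auto simp: e_def prod_eq_iff)
      then show "x \<in> range G" using y(1) unfolding G_def by (metis rangeI)
    qed
  qed
  moreover have "a = 0" if a: "frechet_derivative G (at \<theta>) a = 0" for \<theta> a
  proof -
    have "G \<theta> \<in> T" using \<open>range G = T\<close> by blast
    \<comment> \<open>\<open>f\<close> is smooth along \<open>T\<close> only; the chain rule is
      applied to its extension \<open>h\<close> to an open set.\<close>
    then obtain W h where W: "open W" "G \<theta> \<in> W" "smooth_on h W" "\<forall>y\<in>T \<inter> W. h y = f y"
      using fg(1) unfolding smooth_map_def by meson
    have DG: "(G has_derivative frechet_derivative G (at \<theta>)) (at \<theta>)"
      by (rule smooth_on_has_derivative[OF smooth_G UNIV_I])
    have Dh: "(h has_derivative frechet_derivative h (at (G \<theta>))) (at (G \<theta>))"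
      by (rule smooth_on_has_derivative[OF W(3,2)])
    have "open (G -` W)"
      by (rule open_vimage[OF W(1) smooth_on_imp_continuous_on[OF smooth_G]])
    from has_derivative_transform_within_open[OF has_derivative_compose[OF DG Dh] this, of e]
    have "(e has_derivative (\<lambda>v. frechet_derivative h (at (G \<theta>)) (frechet_derivative G (at \<theta>) v))) (at \<theta>)"
      using W(2,4) fG \<open>range G = T\<close> by auto
    moreover have "(e has_derivative (\<lambda>v. (v $ 1 *\<^sub>R (\<i> * cis (\<theta> $ 1)), v $ 2 *\<^sub>R (\<i> * cis (\<theta> $ 2))))) (at \<theta>)"
      unfolding e_def
      by (intro has_derivative_Pair has_derivative_compose[OF bounded_linear_imp_has_derivative[OF bounded_linear_vec_nth] has_derivative_cis])
    ultimately have "(\<lambda>v. frechet_derivative h (at (G \<theta>)) (frechet_derivative G (at \<theta>) v))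
      = (\<lambda>v. (v $ 1 *\<^sub>R (\<i> * cis (\<theta> $ 1)), v $ 2 *\<^sub>R (\<i> * cis (\<theta> $ 2))))"
      by (rule has_derivative_unique)
    from fun_cong[OF this, of a] have "a $ 1 *\<^sub>R (\<i> * cis (\<theta> $ 1)) = 0 \<and> a $ 2 *\<^sub>R (\<i> * cis (\<theta> $ 2)) = 0"
      using linear_0[OF has_derivative_linear[OF Dh]] a by (simp add: prod_eq_iff)
    then show "a = 0" by (simp add: vec_eq_iff forall_2)
  qed
  ultimately show ?thesis using that by blast
qed

context periodic_surface
begin

text \<open>The set \<open>S\<close> of parameters that have a representative near
  \<open>\<theta>0\<close> is open, since representatives can be moved along by a period. What
  remains of \<open>Q\<close> is compact, and its image is a closed set that misses
  \<open>G \<theta>0\<close>.\<close>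

lemma nearby_parameter:
  assumes "\<delta> > 0"
  obtains \<eta> where "\<eta> > 0" "\<And>\<theta>. dist (G \<theta>) (G \<theta>0) < \<eta> \<Longrightarrow> \<exists>\<theta>'. G \<theta>' = G \<theta> \<and> dist \<theta>' \<theta>0 < \<delta>"
proof -
  define S where "S = {\<theta>. \<exists>\<theta>'. G \<theta>' = G \<theta> \<and> dist \<theta>' \<theta>0 < \<delta>}"
  have "open S"
    unfolding open_dist
  proof
    fix \<theta> assume "\<theta> \<in> S"
    then obtain \<theta>' where \<theta>': "G \<theta> = G \<theta>'" "dist \<theta>' \<theta>0 < \<delta>" unfolding S_def by (auto simp: eq_commute[of "G \<theta>"])
    have "y \<in> S" if y: "dist y \<theta> < \<delta> - dist \<theta>' \<theta>0" for y
    proof -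
      have "G (y + (\<theta>' - \<theta>)) = G y" using per_G \<theta>'(1) unfolding periodic_wrt_def by blast
      moreover have "dist (y + (\<theta>' - \<theta>)) \<theta>0 < \<delta>"
      proof -
        have "dist (y + (\<theta>' - \<theta>)) \<theta>0 \<le> dist (y + (\<theta>' - \<theta>)) \<theta>' + dist \<theta>' \<theta>0" by (rule dist_triangle)
        moreover have "dist (y + (\<theta>' - \<theta>)) \<theta>' = dist y \<theta>" by (simp add: dist_norm algebra_simps)
        ultimately show ?thesis using y by linarith
      qed
      ultimately show ?thesis unfolding S_def by blast
    qed
    then show "\<exists>e>0. \<forall>y. dist y \<theta> < e \<longrightarrow> y \<in> S"
      using \<theta>'(2) by (intro exI[of _ "\<delta> - dist \<theta>' \<theta>0"]) simp
  qed
  have contG: "continuous_on A G" for A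
    using smooth_on_imp_continuous_on[OF smooth_G] continuous_on_subset by blast
  have "compact (Q - S)" by (rule compact_diff[OF compact_Q \<open>open S\<close>])
  then have "closed (G ` (Q - S))"
    using compact_continuous_image[OF contG] compact_imp_closed by blast
  moreover have "G \<theta>0 \<notin> G ` (Q - S)"
    proof
    assume "G \<theta>0 \<in> G ` (Q - S)"
    then obtain \<theta> where "\<theta> \<notin> S" "G \<theta>0 = G \<theta>" by blast
    then show False using assms unfolding S_def by (metis (mono_tags, lifting) dist_self mem_Collect_eq)
  qed
  ultimately have "open (- G ` (Q - S))" "G \<theta>0 \<in> - G ` (Q - S)" by auto
  then obtain \<eta> where \<eta>: "\<eta> > 0" "ball (G \<theta>0) \<eta> \<subseteq> - G ` (Q - S)"
    by (meson open_contains_ball)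
  show ?thesis
  proof (rule that[OF \<eta>(1)])
    fix \<theta> assume d: "dist (G \<theta>) (G \<theta>0) < \<eta>"
    obtain \<theta>1 where \<theta>1: "\<theta>1 \<in> Q" "G \<theta>1 = G \<theta>" using cover_Q by blast
    have "G \<theta>1 \<in> ball (G \<theta>0) \<eta>" using d \<theta>1(2) by (simp add: dist_commute)
    then have "\<theta>1 \<in> S" using \<eta>(2) \<theta>1(1) by blast
    then show "\<exists>\<theta>'. G \<theta>' = G \<theta> \<and> dist \<theta>' \<theta>0 < \<delta>"
      unfolding S_def using \<theta>1(2) by auto
  qed
qed

lemma periodic_close:
  assumes f: "periodic_wrt G f" "smooth_on f UNIV" and "\<epsilon> > 0"
  obtains \<eta> where "\<eta> > 0" "\<And>\<theta>. dist (G \<theta>) (G \<theta>0) < \<eta> \<Longrightarrow> dist (f \<theta>) (f \<theta>0) < \<epsilon>"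
proof -
  have "isCont f \<theta>0"
    using smooth_on_imp_continuous_on[OF f(2)] by (simp add: continuous_on_eq_continuous_at)
  then obtain \<delta> where \<delta>: "\<delta> > 0" "\<And>\<theta>. dist \<theta> \<theta>0 < \<delta> \<Longrightarrow> dist (f \<theta>) (f \<theta>0) < \<epsilon>"
    using \<open>\<epsilon> > 0\<close> unfolding continuous_at_eps_delta by metis
  obtain \<eta> where \<eta>: "\<eta> > 0" "\<And>\<theta>. dist (G \<theta>) (G \<theta>0) < \<eta> \<Longrightarrow> \<exists>\<theta>'. G \<theta>' = G \<theta> \<and> dist \<theta>' \<theta>0 < \<delta>"
    by (rule nearby_parameter[OF \<delta>(1)]) blast
  show ?thesis
  proof (rule that[OF \<eta>(1)])
    fix \<theta> assume "dist (G \<theta>) (G \<theta>0) < \<eta>"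
    then obtain \<theta>' where "G \<theta>' = G \<theta>" "dist \<theta>' \<theta>0 < \<delta>" using \<eta>(2) by blast
    then show "dist (f \<theta>) (f \<theta>0) < \<epsilon>" using \<delta>(2) periodic_wrt_eq[OF f(1)] by metis
  qed
qed

end

section \<open>Ambient diffeomorphisms and graphs over the surface\<close>

lemma linear_complex_combination: "linear (\<lambda>z::complex^2. z $ 1 *s x + z $ 2 *s (y :: complex ^ 2))"
  by (rule linearI) (simp_all add: vec_eq_iff algebra_simps)

lemma det2_bounded_below:
  assumes "det2 x y \<noteq> 0"
  obtains m where "m > 0" "\<And>z :: complex ^ 2. m * norm z \<le> norm (z $ 1 *s x + z $ 2 *s y)"
proof -
  have "inj (\<lambda>z::complex^2. z $ 1 *s x + z $ 2 *s y)"
    unfolding linear_injective_0[OF linear_complex_combination]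
    using det2_eq_0_iff[OF assms] by (simp add: vec_eq_iff forall_2)
  then show ?thesis
    by (rule linear_inj_bounded_below_pos[OF linear_complex_combination]) (rule that, assumption, blast)
qed

lemma smooth_map_compose:
  assumes "open U" "open V" "smooth_on f U" "f ` U \<subseteq> V" "smooth_on g V"
  shows "smooth_map (\<lambda>x. g (f x)) U"
  using smooth_on_compose[OF assms(1,2,4,3,5)] smooth_on_imp_smooth_map assms(1) by blast

lemma smooth_submanifold_image:
  fixes M :: "'a::euclidean_space set" and f g :: "'a \<Rightarrow> 'a"
  assumes M: "smooth_submanifold d M" "M \<subseteq> A" and "open A" "open B"
    and f: "smooth_on f A" "f ` A \<subseteq> B" and g: "smooth_on g B" "g ` B \<subseteq> A"
    and gf: "\<And>x. x \<in> A \<Longrightarrow> g (f x) = x" and fg: "\<And>y. y \<in> B \<Longrightarrow> f (g y) = y"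
  shows "smooth_submanifold d (f ` M)"
  unfolding smooth_submanifold_def
proof
  fix y assume "y \<in> f ` M"
  then obtain q where q: "q \<in> M" "y = f q" by blast
  from bspec[OF M(1)[unfolded smooth_submanifold_def] q(1)]
  obtain U V L and \<phi> \<psi> :: "'a \<Rightarrow> 'a" where c: "open U" "q \<in> U" "open V" "diffeomorphism U V \<phi> \<psi>"
    "subspace L" "dim L = d" "\<phi> ` (M \<inter> U) = L \<inter> V"
    by (elim exE conjE) (rule that, assumption+)
  have \<phi>: "smooth_on \<phi> U" "\<phi> ` U = V" "\<And>x. x \<in> U \<Longrightarrow> \<psi> (\<phi> x) = x"
    and \<psi>: "smooth_on \<psi> V" "\<psi> ` V = U" "\<And>y. y \<in> V \<Longrightarrow> \<phi> (\<psi> y) = y"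
    using c(1,3,4) smooth_map_open unfolding diffeomorphism_def by blast+
  \<comment> \<open>The new chart is \<open>\<phi>\<close> after \<open>g\<close>. Its inverse,
    \<open>f\<close> after \<open>\<psi>\<close>, makes sense only where \<open>\<psi>\<close> lands
    in \<open>A\<close>, so both ends are cut down.\<close>
  define U' where "U' = B \<inter> g -` U"
  define V' where "V' = V \<inter> \<psi> -` A"
  have oU: "open U'" unfolding U'_def
    by (rule continuous_open_preimage[OF smooth_on_imp_continuous_on[OF g(1)] \<open>open B\<close> c(1)])
  have oV: "open V'" unfolding V'_def
    by (rule continuous_open_preimage[OF smooth_on_imp_continuous_on[OF \<psi>(1)] c(3) \<open>open A\<close>])
  have gU: "g ` U' \<subseteq> U" and \<psi>V: "\<psi> ` V' \<subseteq> A" by (auto simp: U'_def V'_def)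
  have a: "\<phi> (g u) \<in> V'" if "u \<in> U'" for u
    using that g(2) \<phi>(2,3) unfolding U'_def V'_def by auto
  have b: "f (\<psi> v) \<in> U'" if "v \<in> V'" for v
    using that f(2) \<psi>(2) gf unfolding U'_def V'_def by auto
  have ab: "f (\<psi> (\<phi> (g u))) = u" if "u \<in> U'" for u
    using that \<phi>(3) fg unfolding U'_def by auto
  have ba: "\<phi> (g (f (\<psi> v))) = v" if "v \<in> V'" for v
    using that \<psi>(3) gf unfolding V'_def by auto
  have d1: "diffeomorphism U' V' (\<lambda>u. \<phi> (g u)) (\<lambda>v. f (\<psi> v))"
    unfolding diffeomorphism_def
  proof (intro conjI ballI)
    show "smooth_map (\<lambda>u. \<phi> (g u)) U'"
      by (rule smooth_map_compose[OF oU c(1) smooth_on_subset[OF g(1)] gU \<phi>(1)]) (auto simp: U'_def)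
    show "smooth_map (\<lambda>v. f (\<psi> v)) V'"
      by (rule smooth_map_compose[OF oV \<open>open A\<close> smooth_on_subset[OF \<psi>(1)] \<psi>V f(1)]) (auto simp: V'_def)
    show "(\<lambda>u. \<phi> (g u)) ` U' = V'"
      using a b ba by (auto simp: image_iff) (metis)
    show "(\<lambda>v. f (\<psi> v)) ` V' = U'"
      using a b ab by (auto simp: image_iff) (metis)
  qed (use ab ba in auto)
  have d2: "(\<lambda>u. \<phi> (g u)) ` (f ` M \<inter> U') = L \<inter> V'"
  proof
    show "(\<lambda>u. \<phi> (g u)) ` (f ` M \<inter> U') \<subseteq> L \<inter> V'"
    proof
      fix v assume "v \<in> (\<lambda>u. \<phi> (g u)) ` (f ` M \<inter> U')"
      then obtain x where x: "x \<in> M" "f x \<in> U'" "v = \<phi> (g (f x))" by blast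
      have "g (f x) = x" using gf M(2) x(1) by blast
      then have "x \<in> M \<inter> U" using x unfolding U'_def by simp
      then have "v \<in> L" using c(7) x(3) \<open>g (f x) = x\<close> by auto
      then show "v \<in> L \<inter> V'" using a[OF x(2)] x(3) by simp
    qed
    show "L \<inter> V' \<subseteq> (\<lambda>u. \<phi> (g u)) ` (f ` M \<inter> U')"
    proof
      fix v assume v: "v \<in> L \<inter> V'"
      then have "v \<in> \<phi> ` (M \<inter> U)" unfolding c(7) V'_def by blast
      then obtain x where x: "x \<in> M" "x \<in> U" "v = \<phi> x" by blast
      have "f x = f (\<psi> v)" using \<phi>(3) x by simp
      then have "f x \<in> f ` M \<inter> U'" using b[of v] v imageI[OF x(1), of f] by simp
      moreover have "v = \<phi> (g (f x))" using gf M(2) x by auto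
      ultimately show "v \<in> (\<lambda>u. \<phi> (g u)) ` (f ` M \<inter> U')" by blast
    qed
  qed
  have d3: "y \<in> U'"
    using q c(2) f(2) gf M(2) unfolding U'_def by auto
  show "\<exists>U V L (\<phi> :: 'a \<Rightarrow> 'a) \<psi>. open U \<and> y \<in> U \<and> open V \<and> diffeomorphism U V \<phi> \<psi> \<and>
        subspace L \<and> dim L = d \<and> \<phi> ` (f ` M \<inter> U) = L \<inter> V"
  proof (intro exI conjI)
    show "diffeomorphism U' V' (\<lambda>u. \<phi> (g u)) (\<lambda>v. f (\<psi> v))" by (rule d1)
    show "(\<lambda>u. \<phi> (g u)) ` (f ` M \<inter> U') = L \<inter> V'" by (rule d2)
  qed (rule oU d3 oV c(5) c(6))+
qed

context framed_surface
begin

text \<open>The translation \<open>u \<mapsto> u + s (\<pi> u)\<close> along the fibres of \<open>\<pi>\<close> is a diffeomorphism near the surface and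
  carries the surface to its perturbation \<open>N\<close>.\<close>

lemma graph_perturbation:
  fixes s :: "complex ^ 2 \<Rightarrow> complex ^ 2"
  assumes sub: "smooth_submersion U (range G) \<pi>" and \<pi>G: "\<And>\<theta>. \<pi> (G \<theta>) = G \<theta>" and "\<rho> > 0"
    and \<pi>: "\<And>\<theta> b. norm b < \<rho> \<Longrightarrow> G \<theta> + frame_sum Y \<theta> b \<in> U \<and> \<pi> (G \<theta> + frame_sum Y \<theta> b) = G \<theta>"
    and op: "\<And>\<rho>'. \<rho>' \<le> \<rho> \<Longrightarrow> open {y. \<exists>\<theta> b. norm b < \<rho>' \<and> y = G \<theta> + frame_sum Y \<theta> b}"
    and M: "smooth_submanifold d (range G)"
    and s: "smooth_on s UNIV" and s_frame: "\<And>\<theta>. \<exists>b. norm b < \<rho> / 4 \<and> s (G \<theta>) = frame_sum Y \<theta> b"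
  defines "N \<equiv> (\<lambda>q. q + s q) ` range G"
  shows "smooth_submanifold d N" and "N \<subseteq> U" and "diffeomorphism N (range G) \<pi> (\<lambda>q. q + s q)"
    and "\<And>v \<theta>. v \<in> tangent_space N (G \<theta> + s (G \<theta>)) \<Longrightarrow>
      \<exists>a. v = DG \<theta> a + frechet_derivative s (at (G \<theta>)) (DG \<theta> a)"
proof -
  have U: "open U" "smooth_on \<pi> U" "\<pi> ` U \<subseteq> range G" using sub unfolding smooth_submersion_def by auto
  \<comment> \<open>A shift shorter than \<open>\<rho> / 4\<close> takes the tube \<open>A\<close>
    into the tube \<open>B'\<close> of radius \<open>\<rho> / 2\<close>, and shifting back from
    there stays below \<open>\<rho>\<close>, where the projection is known.\<close>
  define A where "A = {y. \<exists>\<theta> b. norm b < \<rho> / 4 \<and> y = G \<theta> + frame_sum Y \<theta> b}"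
  define B' where "B' = {y. \<exists>\<theta> b. norm b < \<rho> / 2 \<and> y = G \<theta> + frame_sum Y \<theta> b}"
  have oA: "open A" and oB': "open B'" using op[of "\<rho>/4"] op[of "\<rho>/2"] \<open>\<rho> > 0\<close> by (simp_all add: A_def B'_def)
  have AU: "A \<subseteq> U" and B'U: "B' \<subseteq> U" using \<pi> \<open>\<rho> > 0\<close> unfolding A_def B'_def by auto
  define f where "f u = u + s (\<pi> u)" for u
  define g where "g u = u - s (\<pi> u)" for u
  have sm: "smooth_on (\<lambda>u. s (\<pi> u)) U" by (rule smooth_on_compose_UNIV[OF U(1) s U(2)])
  have smf: "smooth_on f U" and smg: "smooth_on g U"
    unfolding f_def[abs_def] g_def[abs_def] by (intro smooth_on_add smooth_on_diff smooth_on_ident U(1) sm)+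
  \<comment> \<open>Points of \<open>B'\<close> need not be images of points of \<open>A\<close>;
    the intersection makes \<open>f\<close> a bijection of \<open>A\<close> onto
    \<open>B\<close>.\<close>
  define B where "B = B' \<inter> g -` A"
  have oB: "open B"
    unfolding B_def
    by (rule continuous_open_preimage[OF continuous_on_subset[OF smooth_on_imp_continuous_on[OF smg] B'U] oB' oA])
  have f_B: "f u \<in> B \<and> g (f u) = u" if uA: "u \<in> A" for u
  proof -
    obtain \<theta> b where u: "norm b < \<rho> / 4" "u = G \<theta> + frame_sum Y \<theta> b" using uA unfolding A_def by blast
    obtain b' where b': "norm b' < \<rho> / 4" "s (G \<theta>) = frame_sum Y \<theta> b'" using s_frame by blast
    have "\<pi> u = G \<theta>" using \<pi>[of b \<theta>] u \<open>\<rho> > 0\<close> by simp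
    then have fu: "f u = G \<theta> + frame_sum Y \<theta> (b + b')"
      by (simp add: f_def u(2) b'(2) linear_add[OF linear_frame_sum])
    have n: "norm (b + b') < \<rho> / 2" using norm_triangle_ineq[of b b'] u(1) b'(1) by linarith
    have "\<pi> (f u) = G \<theta>" using \<pi>[of "b + b'" \<theta>] n fu \<open>\<rho> > 0\<close> by simp
    then have "g (f u) = u" using \<open>\<pi> u = G \<theta>\<close> by (simp add: g_def f_def)
    moreover have "f u \<in> B'" unfolding B'_def using n fu by blast
    ultimately show ?thesis using uA unfolding B_def by simp
  qed
  have g_A: "g y \<in> A \<and> f (g y) = y" if "y \<in> B" for y
  proof -
    have "y \<in> B'" and gA: "g y \<in> A" using that by (auto simp: B_def)
    then obtain \<theta> b where y: "norm b < \<rho> / 2" "y = G \<theta> + frame_sum Y \<theta> b" unfolding B'_def by blast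
    obtain b' where b': "norm b' < \<rho> / 4" "s (G \<theta>) = frame_sum Y \<theta> b'" using s_frame by blast
    have "\<pi> y = G \<theta>" using \<pi>[of b \<theta>] y \<open>\<rho> > 0\<close> by simp
    then have gy: "g y = G \<theta> + frame_sum Y \<theta> (b - b')"
      by (simp add: g_def y(2) b'(2) linear_diff[OF linear_frame_sum])
    have "norm (b - b') < \<rho>" using norm_triangle_ineq4[of b b'] y(1) b'(1) \<open>\<rho> > 0\<close> by linarith
    then have "\<pi> (g y) = G \<theta>" using \<pi>[of "b - b'" \<theta>] gy by simp
    then show ?thesis using gA \<open>\<pi> y = G \<theta>\<close> by (simp add: g_def f_def)
  qed
  have GA: "range G \<subseteq> A"
  proof safe
    fix \<theta> show "G \<theta> \<in> A"
      unfolding A_def using \<open>\<rho> > 0\<close> by (intro CollectI exI[of _ \<theta>] exI[of _ 0]) simp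
  qed
  have fN: "f ` range G = N" by (simp add: N_def f_def image_image \<pi>G)
  have "smooth_submanifold d (f ` range G)"
  proof (rule smooth_submanifold_image[OF M GA oA oB])
    show "smooth_on f A" by (rule smooth_on_subset[OF smf AU])
    show "smooth_on g B" by (rule smooth_on_subset[OF smg]) (use B'U in \<open>auto simp: B_def\<close>)
  qed (use f_B g_A in auto)
  then show "smooth_submanifold d N" by (simp add: fN)
  have \<pi>s: "G \<theta> + s (G \<theta>) \<in> U \<and> \<pi> (G \<theta> + s (G \<theta>)) = G \<theta>" for \<theta>
  proof -
    obtain b' where b': "norm b' < \<rho> / 4" "s (G \<theta>) = frame_sum Y \<theta> b'" using s_frame by blast
    show ?thesis using \<pi>[of b' \<theta>] b' \<open>\<rho> > 0\<close> by simp
  qed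
  then show NU: "N \<subseteq> U" unfolding N_def by blast
  show "diffeomorphism N (range G) \<pi> (\<lambda>q. q + s q)"
    unfolding diffeomorphism_def
  proof (intro conjI)
    show "smooth_map \<pi> N" by (rule smooth_on_imp_smooth_map[OF U(2,1) NU])
    show "smooth_map (\<lambda>q. q + s q) (range G)"
      by (rule smooth_on_imp_smooth_map[OF smooth_on_add[OF open_UNIV smooth_on_ident[OF open_UNIV] s] open_UNIV]) simp
    show "\<pi> ` N = range G" unfolding N_def using \<pi>s by (auto simp: image_iff)
    show "(\<lambda>q. q + s q) ` range G = N" by (simp add: N_def)
    show "\<forall>x\<in>N. \<pi> x + s (\<pi> x) = x" unfolding N_def using \<pi>s by auto
    show "\<forall>y\<in>range G. \<pi> (y + s y) = y" using \<pi>s by auto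
  qed
  fix v \<theta> assume "v \<in> tangent_space N (G \<theta> + s (G \<theta>))"
  then obtain e \<gamma> where e: "e > 0" "smooth_on \<gamma> {-e<..<e}" "\<gamma> ` {-e<..<e} \<subseteq> N" "\<gamma> 0 = G \<theta> + s (G \<theta>)"
    "(\<gamma> has_vector_derivative v) (at 0)"
    unfolding tangent_space_def by blast
  \<comment> \<open>The shadow of the curve on the surface. As
    \<open>\<gamma> t = \<beta> t + s (\<beta> t)\<close>, the velocity of \<open>\<gamma>\<close>
    is a tangent vector of the surface plus its image under the derivative of
    \<open>s\<close>.\<close>
  define \<beta> where "\<beta> t = \<pi> (\<gamma> t)" for t
  have smb: "smooth_on \<beta> {-e<..<e}"
    unfolding \<beta>_def[abs_def] by (rule smooth_on_compose[OF open_greaterThanLessThan U(1) _ e(2) U(2)]) (use e(3) NU in blast)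
  have \<beta>0: "\<beta> 0 = G \<theta>" using \<pi>s e(4) by (simp add: \<beta>_def)
  have g\<beta>: "\<beta> t + s (\<beta> t) = \<gamma> t" and \<beta>G: "\<beta> t \<in> range G" if "t \<in> {-e<..<e}" for t
  proof -
    have "\<gamma> t \<in> N" using e(3) that by blast
    then obtain \<theta>' where "\<gamma> t = G \<theta>' + s (G \<theta>')" unfolding N_def by blast
    then show "\<beta> t + s (\<beta> t) = \<gamma> t" "\<beta> t \<in> range G" using \<pi>s by (simp_all add: \<beta>_def)
  qed
  define \<tau> where "\<tau> = frechet_derivative \<beta> (at 0) 1"
  have d\<beta>: "(\<beta> has_derivative frechet_derivative \<beta> (at 0)) (at 0)"
    by (rule smooth_on_has_derivative[OF smb]) (use e(1) in simp)
  have "frechet_derivative \<beta> (at 0) = (\<lambda>t. t *\<^sub>R \<tau>)"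
  proof
    fix t :: real
    show "frechet_derivative \<beta> (at 0) t = t *\<^sub>R \<tau>"
      using linear_scale[OF has_derivative_linear[OF d\<beta>], of t 1] by (simp add: \<tau>_def)
  qed
  with d\<beta> have D\<beta>: "(\<beta> has_vector_derivative \<tau>) (at 0)"
    by (simp add: has_vector_derivative_def)
  then have "\<tau> \<in> tangent_space (range G) (G \<theta>)"
    unfolding tangent_space_def using e(1) smb \<beta>0 \<beta>G by blast
  then obtain a where a: "\<tau> = DG \<theta> a" unfolding tangent_space_range by blast
  have Ds: "(s has_derivative frechet_derivative s (at (G \<theta>))) (at (\<beta> 0))"
    unfolding \<beta>0 by (rule smooth_on_has_derivative[OF s UNIV_I])
  have "((\<lambda>t. \<beta> t + s (\<beta> t)) has_derivative (\<lambda>t. t *\<^sub>R \<tau> + frechet_derivative s (at (G \<theta>)) (t *\<^sub>R \<tau>))) (at 0)"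
    using D\<beta>[unfolded has_vector_derivative_def]
    by (rule has_derivative_add[OF _ has_derivative_compose[OF D\<beta>[unfolded has_vector_derivative_def] Ds]])
  then have "(\<gamma> has_derivative (\<lambda>t. t *\<^sub>R \<tau> + frechet_derivative s (at (G \<theta>)) (t *\<^sub>R \<tau>))) (at 0)"
    by (rule has_derivative_transform_within_open[OF _ open_greaterThanLessThan[of "-e" e]]) (use e(1) g\<beta> in simp_all)
  then have "(\<lambda>t. t *\<^sub>R \<tau> + frechet_derivative s (at (G \<theta>)) (t *\<^sub>R \<tau>)) = (\<lambda>t. t *\<^sub>R v)"
    by (rule has_derivative_unique[OF _ e(5)[unfolded has_vector_derivative_def]])
  from fun_cong[OF this, of 1] show "\<exists>a. v = DG \<theta> a + frechet_derivative s (at (G \<theta>)) (DG \<theta> a)"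
    unfolding a by (intro exI[of _ a]) simp
qed

end

section \<open>A frame that is constant near a point\<close>

lemma linear_vector_smult: "linear (\<lambda>x::complex^2. c *s x)"
  by (rule linearI) (simp_all add: vec_eq_iff algebra_simps)

lemma norm_vector_smult: "norm (c *s (x::complex^2)) = norm c * norm x"
  by (simp add: norm_vec_def L2_set_def norm_mult power_mult_distrib real_sqrt_mult sum_2 flip: distrib_left)

context periodic_surface
begin

text \<open>The frame is \<open>i\<close> times the tangent frame, modified near one point so as to be constant there. A
  perturbation in the constant directions then moves points within the fibres of the projection.\<close>

lemma surface_frame:
  assumes det: "\<And>\<theta>. det2 (X 1 \<theta>) (X 2 \<theta>) \<noteq> 0"
  obtains Y r where "framed_surface G Q Y" "r > 0"
    "\<And>k \<theta>. dist (G \<theta>) (G \<theta>0) < r \<Longrightarrow> Y k \<theta> = \<i> *s X k \<theta>0"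
proof -
  obtain m where m: "m > 0" "\<And>z :: complex ^ 2. m * norm z \<le> norm (z $ 1 *s X 1 \<theta>0 + z $ 2 *s X 2 \<theta>0)"
    by (rule det2_bounded_below[OF det[of \<theta>0]]) blast
  \<comment> \<open>Four error terms will arise, each at most a fifth of the lower bound, so
    together they cannot cancel the main term.\<close>
  have m5: "m / 5 > 0" using m(1) by simp
  obtain \<delta>1 where \<delta>1: "\<delta>1 > 0" "\<And>\<theta>. dist (G \<theta>) (G \<theta>0) < \<delta>1 \<Longrightarrow> dist (X 1 \<theta>) (X 1 \<theta>0) < m / 5"
    by (rule periodic_close[OF per_X[of 1] smooth_X m5, of \<theta>0]) blast
  obtain \<delta>2 where \<delta>2: "\<delta>2 > 0" "\<And>\<theta>. dist (G \<theta>) (G \<theta>0) < \<delta>2 \<Longrightarrow> dist (X 2 \<theta>) (X 2 \<theta>0) < m / 5"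
    by (rule periodic_close[OF per_X[of 2] smooth_X m5, of \<theta>0]) blast
  \<comment> \<open>Within distance \<open>r\<close> the cutoff has an argument of at most 1 and
    equals 1; from distance \<open>2 * r\<close> on, its argument is at least 4 and it vanishes.
    Thus the frame is modified only where both bounds by \<open>m / 5\<close> are available.\<close>
  define r where "r = min \<delta>1 \<delta>2 / 2"
  have "r > 0" using \<delta>1 \<delta>2 by (simp add: r_def)
  define q where "q \<theta> = (1 / r\<^sup>2) * ((G \<theta> - G \<theta>0) \<bullet> (G \<theta> - G \<theta>0))" for \<theta>
  have q: "q \<theta> = (dist (G \<theta>) (G \<theta>0) / r)\<^sup>2" for \<theta>
    by (simp add: q_def dist_norm power_divide power2_norm_eq_inner)
  define V where "V k \<theta> = X k \<theta> + cutoff (q \<theta>) *\<^sub>R (X k \<theta>0 - X k \<theta>)" for k \<theta>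
  define Y where "Y k \<theta> = \<i> *s V k \<theta>" for k \<theta>
  have "framed_surface G Q Y"
  proof
    show "smooth_on (Y k) UNIV" for k
      unfolding Y_def[abs_def] V_def q_def
      by (intro smooth_on_linear[OF linear_vector_smult] smooth_on_add smooth_on_scaleR smooth_on_diff smooth_X smooth_on_const
          smooth_on_compose_UNIV[OF _ smooth_on_cutoff] smooth_on_mult smooth_on_inner smooth_G open_UNIV)
    show "periodic_wrt G (Y k)" for k
      using per_X[of k] per_G unfolding periodic_wrt_def Y_def V_def q_def by simp
    fix \<theta>
    have eq0: "DG \<theta> a + frame_sum Y \<theta> b =
        a $ 1 *\<^sub>R X 1 \<theta> + a $ 2 *\<^sub>R X 2 \<theta> + b $ 1 *\<^sub>R (\<i> *s V 1 \<theta>) + b $ 2 *\<^sub>R (\<i> *s V 2 \<theta>)" for a b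
      unfolding DG_expand[of \<theta> a] frame_sum_def sum_2 Y_def by simp
    show "complementary G Y \<theta>"
      unfolding complementary_def eq0
    proof (intro allI impI)
      fix a b :: "real ^ 2"
      assume *: "a $ 1 *\<^sub>R X 1 \<theta> + a $ 2 *\<^sub>R X 2 \<theta> + b $ 1 *\<^sub>R (\<i> *s V 1 \<theta>) + b $ 2 *\<^sub>R (\<i> *s V 2 \<theta>) = 0"
      let ?z = "cv2 a b"
      have "?z = 0"
      proof (cases "dist (G \<theta>) (G \<theta>0) < min \<delta>1 \<delta>2")
        case False
        then have "2 * r \<le> dist (G \<theta>) (G \<theta>0)" unfolding not_less by (simp add: r_def del: min_le_iff_disj min.bounded_iff)
        then have "2 \<le> dist (G \<theta>) (G \<theta>0) / r" using \<open>r > 0\<close> by (simp add: pos_le_divide_eq)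
        then have "2\<^sup>2 \<le> q \<theta>" unfolding q by (rule power_mono) simp
        then have V: "V k \<theta> = X k \<theta>" for k by (simp add: V_def cutoff_eq_0)
        \<comment> \<open>With an unmodified frame, the real relation among the
          \<open>X k \<theta>\<close> and their multiples by \<open>\<i>\<close> is a complex
          relation with coefficients \<open>a + i b\<close>.\<close>
        have "?z $ 1 *s X 1 \<theta> + ?z $ 2 *s X 2 \<theta> = 0"
          using * unfolding V scaleR_eq_vector_smult by (simp add: vec_eq_iff cv2_def complex_eq_iff algebra_simps)
        then show ?thesis
          using det2_eq_0_iff[OF det] by (simp add: vec_eq_iff forall_2)
      next
        case True
        have x: "norm (X k \<theta> - X k \<theta>0) \<le> m / 5" for k
        proof -
          have "dist (X 1 \<theta>) (X 1 \<theta>0) < m / 5" "dist (X 2 \<theta>) (X 2 \<theta>0) < m / 5"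
            using \<delta>1(2)[of \<theta>] \<delta>2(2)[of \<theta>] True by simp_all
          then show ?thesis using exhaust_2[of k] by (auto simp: dist_norm)
        qed
        have v: "norm (V k \<theta> - X k \<theta>0) \<le> m / 5" for k
        proof -
          have "V k \<theta> - X k \<theta>0 = (1 - cutoff (q \<theta>)) *\<^sub>R (X k \<theta> - X k \<theta>0)"
            by (simp add: V_def algebra_simps)
          then have "norm (V k \<theta> - X k \<theta>0) \<le> 1 * norm (X k \<theta> - X k \<theta>0)"
            using cutoff_01[of "q \<theta>"] by (simp add: mult_left_le_one_le)
          then show ?thesis using x[of k] by simp
        qed
        let ?w = "a $ 1 *\<^sub>R (X 1 \<theta> - X 1 \<theta>0) + a $ 2 *\<^sub>R (X 2 \<theta> - X 2 \<theta>0)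
            + b $ 1 *\<^sub>R (\<i> *s (V 1 \<theta> - X 1 \<theta>0)) + b $ 2 *\<^sub>R (\<i> *s (V 2 \<theta> - X 2 \<theta>0))"
        have e: "?z $ 1 *s X 1 \<theta>0 + ?z $ 2 *s X 2 \<theta>0 = - ?w"
          using * unfolding scaleR_eq_vector_smult by (simp add: vec_eq_iff cv2_def complex_eq_iff algebra_simps)
        have w: "norm ?w \<le> 4 * (norm ?z * (m / 5))"
        proof -
          have ab: "\<bar>a $ k\<bar> \<le> norm ?z" "\<bar>b $ k\<bar> \<le> norm ?z" for k
            using Finite_Cartesian_Product.norm_nth_le[of ?z k] abs_Re_le_cmod[of "?z $ k"] abs_Im_le_cmod[of "?z $ k"]
            by (simp_all add: cv2_def)
          have 1: "norm (a $ k *\<^sub>R (X k \<theta> - X k \<theta>0)) \<le> norm ?z * (m / 5)" for k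
            unfolding norm_scaleR using ab x by (intro mult_mono) auto
          have 2: "norm (b $ k *\<^sub>R (\<i> *s (V k \<theta> - X k \<theta>0))) \<le> norm ?z * (m / 5)" for k
            unfolding norm_scaleR norm_vector_smult using ab v by (intro mult_mono) auto
          have tri: "norm (A + B + C + D) \<le> norm A + norm B + norm C + norm D" for A B C D :: "complex ^ 2"
            using norm_triangle_ineq[of "A + B + C" D] norm_triangle_ineq[of "A + B" C] norm_triangle_ineq[of A B] by linarith
          show ?thesis
            by (rule order_trans[OF tri]) (use 1[of 1] 1[of 2] 2[of 1] 2[of 2] in linarith)
        qed
        have "m * norm ?z \<le> norm (- ?w)" using m(2)[of ?z] unfolding e .
        also have "\<dots> \<le> 4 * (norm ?z * (m / 5))" unfolding norm_minus_cancel by (rule w)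
        finally have "m * norm ?z \<le> 0" by (simp add: mult.commute)
        then show ?thesis using m(1) by (simp add: mult_le_0_iff)
      qed
      then show "a = 0 \<and> b = 0" by (simp add: cv2_def vec_eq_iff complex_eq_iff)
    qed
  qed
  moreover have "Y k \<theta> = \<i> *s X k \<theta>0" if "dist (G \<theta>) (G \<theta>0) < r" for k \<theta>
  proof -
    have "dist (G \<theta>) (G \<theta>0) / r \<le> 1" using that \<open>r > 0\<close> by simp
    then have "q \<theta> \<le> 1\<^sup>2" unfolding q using \<open>r > 0\<close> by (intro power_mono) auto
    then show ?thesis by (simp add: Y_def V_def cutoff_eq_1)
  qed
  ultimately show ?thesis using that \<open>r > 0\<close> by blast
qed

end

section \<open>The model under small deviations\<close>

lemma frechet_twist_eq_0:
  assumes "c \<bullet> c > 3" shows "frechet_derivative twist (at c) v = 0"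
proof -
  have o: "open {c::complex^2. c \<bullet> c > 3}"
    by (intro open_Collect_less continuous_intros)
  have "((\<lambda>_. 0) has_derivative (\<lambda>_. 0)) (at c)" by simp
  then have "(twist has_derivative (\<lambda>_. 0)) (at c)"
    by (rule has_derivative_transform_within_open[OF _ o]) (use assms in \<open>simp_all add: twist_eq_0\<close>)
  from frechet_derivative_at[OF this] show ?thesis by metis
qed

lemma twist_Lipschitz:
  obtains C where "C > 0" "\<And>c. norm (twist c) \<le> C" "\<And>c d. norm (twist c - twist d) \<le> C * norm (c - d)"
proof (rule compact_support_Lipschitz[OF smooth_on_twist, of 2])
  fix c :: "complex ^ 2" assume "norm c > 2"
  then have "2\<^sup>2 \<le> (norm c)\<^sup>2" by (intro power_mono) auto
  then show "twist c = 0" by (intro twist_eq_0) (simp add: power2_norm_eq_inner)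
qed (rule that)

text \<open>For real \<open>c\<close> and exact coordinate axes this is \<open>det2_twist\<close>.
  Such \<open>c\<close> of norm at most 2 form a compact set, so non-vanishing persists in a uniform
  neighbourhood, which is what a surface that is only almost flat requires. Radius 2 is enough
  because \<open>twist\<close> vanishes where \<open>c \<bullet> c \<ge> 3\<close>.\<close>

lemma det2_twist_nearby:
  obtains \<delta> where "\<delta> > 0" "\<And>c y1 y2. norm (rev2 c) \<le> 2 \<Longrightarrow> norm (imv2 c) < \<delta> \<Longrightarrow>
     norm (y1 - axis 1 1) < \<delta> \<Longrightarrow> norm (y2 - axis 2 1) < \<delta> \<Longrightarrow>
     det2 (y1 + frechet_derivative twist (at c) y1) (y2 + frechet_derivative twist (at c) y2) \<noteq> 0"
proof -
  let ?D = "\<lambda>c. frechet_derivative twist (at c)"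
  define F where "F p = det2 (fst (snd p) + ?D (fst p) (fst (snd p))) (snd (snd p) + ?D (fst p) (snd (snd p)))" for p
  \<comment> \<open>The derivative is known to be continuous in the base point for a fixed
    direction; the expansion reduces the varying directions in \<open>F\<close> to basis
    vectors.\<close>
  have expand: "?D c y = (\<Sum>b\<in>Basis. (y \<bullet> b) *\<^sub>R ?D c b)" for c y
    by (rule linear_expand[OF has_derivative_linear[OF smooth_on_has_derivative[OF smooth_on_twist UNIV_I]]])
  have contD: "continuous_on UNIV (\<lambda>p. ?D (fst p) b)" for b :: "complex ^ 2"
    by (rule continuous_on_compose2[OF smooth_on_imp_continuous_on[OF smooth_on_derivative[OF smooth_on_twist]] continuous_on_fst[OF continuous_on_id]]) auto
  have contF: "continuous_on UNIV F"
    unfolding F_def det2_def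
    by (subst (1 2 3 4) expand) (intro continuous_intros contD)
  let ?K = "(\<lambda>x. (cv2 x 0, axis 1 1, axis 2 1)) ` cball 0 2 :: ((complex^2) \<times> (complex^2) \<times> (complex^2)) set"
  have "continuous_on (cball 0 2) (\<lambda>x. (cv2 x 0, axis 1 1 :: complex^2, axis 2 1 :: complex^2))"
    unfolding cv2_def Complex_eq by (intro continuous_intros)
  then have "compact ?K" by (rule compact_continuous_image) simp
  moreover have "open {p. F p \<noteq> 0}"
    by (intro open_Collect_neq contF continuous_on_const)
  moreover have "?K \<subseteq> {p. F p \<noteq> 0}"
  proof safe
    fix x assume "F (cv2 x 0, axis 1 1, axis 2 1) = 0"
    moreover have "cv2 x 0 = real_vec2 (x $ 1) (x $ 2)"
      by (simp add: cv2_def vec_eq_iff forall_2 complex_eq_iff)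
    ultimately show False using det2_twist by (simp add: F_def)
  qed
  ultimately obtain e where e: "e > 0" "(\<Union>x\<in>?K. ball x e) \<subseteq> {p. F p \<noteq> 0}"
    by (rule compact_subset_open_imp_ball_epsilon_subset)
  show ?thesis
  proof (rule that[of "e / 3"])
    show "e / 3 > 0" using e(1) by simp
    fix c y1 y2 :: "complex ^ 2" assume *: "norm (rev2 c) \<le> 2" "norm (imv2 c) < e / 3" "norm (y1 - axis 1 1) < e / 3" "norm (y2 - axis 2 1) < e / 3"
    have "norm (c - cv2 (rev2 c) 0) = norm (imv2 c)"
    proof -
      have "c - cv2 (rev2 c) 0 = cv2 0 (imv2 c)"
        by (simp add: cv2_def rev2_def imv2_def vec_eq_iff complex_eq_iff)
      then have "(norm (c - cv2 (rev2 c) 0))\<^sup>2 = (norm (imv2 c))\<^sup>2" using norm_complex_vec2[of "cv2 0 (imv2 c)"] by simp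
      then show ?thesis by simp
    qed
    moreover have "norm ((c, y1, y2) - (cv2 (rev2 c) 0, axis 1 1, axis 2 1)) \<le>
      norm (c - cv2 (rev2 c) 0) + (norm (y1 - axis 1 1) + norm (y2 - axis 2 1))"
      using norm_Pair_le[of "c - cv2 (rev2 c) 0" "(y1 - axis 1 1, y2 - axis 2 1)"] norm_Pair_le[of "y1 - axis 1 1" "y2 - axis 2 1"]
      by simp
    ultimately have "norm ((c, y1, y2) - (cv2 (rev2 c) 0, axis 1 1, axis 2 1)) < e"
      using * by linarith
    then have "(c, y1, y2) \<in> ball (cv2 (rev2 c) 0, axis 1 1, axis 2 1) e"
      unfolding mem_ball by (subst dist_commute) (simp only: dist_norm)
    moreover have "(cv2 (rev2 c) 0, axis 1 1, axis 2 1) \<in> ?K"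
      by (rule imageI) (use *(1) in simp)
    ultimately have "(c, y1, y2) \<in> {p. F p \<noteq> 0}"
      using e(2) by (meson UN_I subsetD)
    then have "F (c, y1, y2) \<noteq> 0" by simp
    then show "det2 (y1 + ?D c y1) (y2 + ?D c y2) \<noteq> 0" by (simp add: F_def)
  qed
qed

section \<open>Grafting the model into the surface\<close>

locale flat_framed_surface = framed_surface +
  fixes \<theta>0 :: "real ^ 2" and r0 :: real
  assumes det: "\<And>\<theta>. det2 (X 1 \<theta>) (X 2 \<theta>) \<noteq> 0"
    and r0: "r0 > 0" and flat: "\<And>k \<theta>. dist (G \<theta>) (G \<theta>0) < r0 \<Longrightarrow> Y k \<theta> = \<i> *s X k \<theta>0"
begin

text \<open>The complex linear extension of the derivative of \<open>G\<close> at
  \<open>\<theta>0\<close>: it takes the real plane to the tangent plane there and the imaginary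
  plane to the constant fibre direction of the flat frame.\<close>

definition lin :: "complex ^ 2 \<Rightarrow> complex ^ 2" where
  "lin z = z $ 1 *s X 1 \<theta>0 + z $ 2 *s X 2 \<theta>0"

definition coord :: "complex ^ 2 \<Rightarrow> complex ^ 2" where
  "coord = inv lin"

lemma linear_lin: "linear lin"
  unfolding lin_def[abs_def] by (rule linear_complex_combination)

lemma lin_smult: "lin (c *s z) = c *s lin z"
  by (simp add: lin_def vec_eq_iff algebra_simps)

lemma inj_lin: "inj lin"
  unfolding linear_injective_0[OF linear_lin] lin_def
  using det2_eq_0_iff[OF det] by (simp add: vec_eq_iff forall_2)

lemma bij_lin: "bij lin"
  using inj_lin linear_injective_imp_surjective[OF linear_lin inj_lin] by (simp add: bij_def)

lemma coord_lin [simp]: "coord (lin z) = z" and lin_coord [simp]: "lin (coord q) = q"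
  using bij_lin by (simp_all add: coord_def inj_lin bij_is_surj surj_f_inv_f)

lemma linear_coord: "linear coord"
proof (rule linearI)
  fix x y c
  have "lin (coord (x + y)) = lin (coord x + coord y)" "lin (coord (c *\<^sub>R x)) = lin (c *\<^sub>R coord x)"
    by (simp_all add: linear_add[OF linear_lin] linear_scale[OF linear_lin])
  then show "coord (x + y) = coord x + coord y" "coord (c *\<^sub>R x) = c *\<^sub>R coord x"
    using inj_lin by (simp_all add: inj_eq)
qed

lemmas bl_lin = linear_lin[unfolded linear_conv_bounded_linear]
  and bl_coord = linear_coord[unfolded linear_conv_bounded_linear]

lemma lin_cv2_0: "lin (cv2 a 0) = DG \<theta>0 a"
  unfolding DG_expand[of \<theta>0 a] lin_def scaleR_eq_vector_smult by (simp add: cv2_def complex_of_real_def vec_eq_iff complex_eq_iff)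

lemma det2_lin: "det2 (lin u) (lin w) = det2 (X 1 \<theta>0) (X 2 \<theta>0) * det2 u w"
  by (simp add: lin_def det2_def algebra_simps)

definition local_coord :: "real ^ 2 \<Rightarrow> complex ^ 2" where
  "local_coord \<theta> = coord (G \<theta> - G \<theta>0)"

text \<open>The rescaling by \<open>\<epsilon>\<close> makes the perturbation of size \<open>\<epsilon>\<close> while its Lipschitz constant stays bounded,
  whence the restriction to Hoelder exponents below \<open>1\<close>.\<close>

definition push :: "real \<Rightarrow> complex ^ 2 \<Rightarrow> complex ^ 2" where
  "push \<epsilon> q = \<epsilon> *\<^sub>R lin (twist ((1 / \<epsilon>) *\<^sub>R coord (q - G \<theta>0)))"

lemma smooth_push: "smooth_on (push \<epsilon>) UNIV"
  unfolding push_def[abs_def]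
  by (intro smooth_on_scaleR smooth_on_const smooth_on_linear[OF linear_lin] smooth_on_compose_UNIV[OF _ smooth_on_twist]
      smooth_on_linear[OF linear_coord] smooth_on_diff smooth_on_ident open_UNIV)

text \<open>The factors \<open>\<epsilon>\<close> and \<open>1 / \<epsilon>\<close> cancel, so the
  tilt of the tangent planes is that of the model at the rescaled point, however small the
  perturbation is.\<close>

lemma frechet_push:
  assumes "\<epsilon> \<noteq> 0"
  shows "frechet_derivative (push \<epsilon>) (at q) v
    = lin (frechet_derivative twist (at ((1 / \<epsilon>) *\<^sub>R coord (q - G \<theta>0))) (coord v))"
proof -
  let ?D = "frechet_derivative twist (at ((1 / \<epsilon>) *\<^sub>R coord (q - G \<theta>0)))"
  have D: "(twist has_derivative ?D) (at ((1 / \<epsilon>) *\<^sub>R coord (q - G \<theta>0)))"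
    by (rule smooth_on_has_derivative[OF smooth_on_twist UNIV_I])
  have "((\<lambda>q. q - G \<theta>0) has_derivative (\<lambda>v. v)) (at q)"
    by (auto intro!: derivative_eq_intros)
  from has_derivative_scaleR_right[OF bounded_linear.has_derivative[OF bl_coord this], of "1 / \<epsilon>"]
  have "((\<lambda>q. (1 / \<epsilon>) *\<^sub>R coord (q - G \<theta>0)) has_derivative (\<lambda>v. (1 / \<epsilon>) *\<^sub>R coord v)) (at q)" .
  from has_derivative_scaleR_right[OF bounded_linear.has_derivative[OF bl_lin has_derivative_compose[OF this D]], of \<epsilon>]
  have "(push \<epsilon> has_derivative (\<lambda>v. \<epsilon> *\<^sub>R lin (?D ((1 / \<epsilon>) *\<^sub>R coord v)))) (at q)"
    by (simp add: push_def[abs_def])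
  from frechet_derivative_at[OF this]
  have "frechet_derivative (push \<epsilon>) (at q) v = \<epsilon> *\<^sub>R lin (?D ((1 / \<epsilon>) *\<^sub>R coord v))" by metis
  also have "\<dots> = lin (?D (coord v))"
    using assms by (simp add: linear_scale[OF linear_lin] linear_scale[OF has_derivative_linear[OF D]])
  finally show ?thesis .
qed

lemma lin_bound:
  obtains m where "m > 0" "\<And>z. norm (lin z) \<le> m * norm z" "\<And>z. norm (coord z) \<le> m * norm z"
proof -
  obtain a where a: "a > 0" "\<And>z. norm (lin z) \<le> norm z * a"
    using bounded_linear.pos_bounded[OF bl_lin] by blast
  obtain b where b: "b > 0" "\<And>z. norm (coord z) \<le> norm z * b"
    using bounded_linear.pos_bounded[OF bl_coord] by blast
  show ?thesis
  proof (rule that[of "max a b"])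
    fix z :: "complex ^ 2"
    have "norm z * a \<le> max a b * norm z" "norm z * b \<le> max a b * norm z"
      by (simp_all add: mult.commute[of "norm z"] mult_right_mono)
    then show "norm (lin z) \<le> max a b * norm z" "norm (coord z) \<le> max a b * norm z"
      using a(2)[of z] b(2)[of z] by linarith+
  qed (use a in simp)
qed

lemma push_bounds:
  obtains C where "C > 0" "\<And>\<epsilon> q. \<epsilon> > 0 \<Longrightarrow> norm (push \<epsilon> q) \<le> C * \<epsilon>"
    "\<And>\<epsilon> q q'. \<epsilon> > 0 \<Longrightarrow> norm (push \<epsilon> q - push \<epsilon> q') \<le> C * norm (q - q')"
proof -
  obtain m where m: "m > 0" "\<And>z. norm (lin z) \<le> m * norm z" "\<And>z. norm (coord z) \<le> m * norm z"
    by (rule lin_bound) blast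
  obtain C where C: "C > 0" "\<And>c. norm (twist c) \<le> C" "\<And>c d. norm (twist c - twist d) \<le> C * norm (c - d)"
    by (rule twist_Lipschitz) blast
  have 1: "norm (push \<epsilon> q) \<le> m * C * \<epsilon>" if "\<epsilon> > 0" for \<epsilon> q
  proof -
    have "norm (push \<epsilon> q) \<le> \<epsilon> * (m * C)"
      unfolding push_def norm_scaleR using that m(1) C(2)
      by (intro mult_mono order_trans[OF m(2)] mult_left_mono) auto
    then show ?thesis by (simp add: mult_ac)
  qed
  have 2: "norm (push \<epsilon> q - push \<epsilon> q') \<le> m * C * m * norm (q - q')" if "\<epsilon> > 0" for \<epsilon> q q'
  proof -
    let ?c = "(1 / \<epsilon>) *\<^sub>R coord (q - G \<theta>0)" and ?c' = "(1 / \<epsilon>) *\<^sub>R coord (q' - G \<theta>0)"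
    have "norm (push \<epsilon> q - push \<epsilon> q') = \<epsilon> * norm (lin (twist ?c - twist ?c'))"
      using that by (simp add: push_def linear_diff[OF linear_lin] flip: scaleR_diff_right)
    also have "\<dots> \<le> \<epsilon> * (m * (C * norm (?c - ?c')))"
      using that m(1) C(3) by (intro mult_left_mono order_trans[OF m(2)]) auto
    also have "?c - ?c' = (1 / \<epsilon>) *\<^sub>R coord (q - q')"
      by (simp add: linear_diff[OF linear_coord] algebra_simps)
    also have "\<epsilon> * (m * (C * norm ((1 / \<epsilon>) *\<^sub>R coord (q - q')))) = m * C * norm (coord (q - q'))"
      using that by simp
    also have "\<dots> \<le> m * C * (m * norm (q - q'))"
      using m(1) C(1) by (intro mult_left_mono m(3)) auto
    finally show ?thesis by (simp add: mult_ac)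
  qed
  define K where "K = m * C + m * C * m"
  have K: "m * C \<le> K" "m * C * m \<le> K" "K > 0" using m(1) C(1) by (simp_all add: K_def add_pos_pos)
  show ?thesis
  proof (rule that[OF K(3)])
    fix \<epsilon> :: real and q q' :: "complex ^ 2" assume e: "\<epsilon> > 0"
    have "m * C * \<epsilon> \<le> K * \<epsilon>" using K(1) e by (intro mult_right_mono) auto
    then show "norm (push \<epsilon> q) \<le> K * \<epsilon>" using 1[OF e, of q] by linarith
    have "m * C * m * norm (q - q') \<le> K * norm (q - q')" using K(2) by (intro mult_right_mono) auto
    then show "norm (push \<epsilon> q - push \<epsilon> q') \<le> K * norm (q - q')" using 2[OF e, of q q'] by linarith
  qed
qed

lemma support_small:
  assumes "\<eta> > 0"
  obtains \<epsilon>0 where "\<epsilon>0 > 0" "\<And>\<epsilon> q. 0 < \<epsilon> \<Longrightarrow> \<epsilon> < \<epsilon>0 \<Longrightarrow>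
    ((1 / \<epsilon>) *\<^sub>R coord (q - G \<theta>0)) \<bullet> ((1 / \<epsilon>) *\<^sub>R coord (q - G \<theta>0)) \<le> 3 \<Longrightarrow> dist q (G \<theta>0) < \<eta>"
proof -
  obtain m where m: "m > 0" "\<And>z. norm (lin z) \<le> m * norm z" "\<And>z. norm (coord z) \<le> m * norm z"
    by (rule lin_bound) blast
  show ?thesis
  proof (rule that[of "\<eta> / (2 * m)"])
    show "\<eta> / (2 * m) > 0" using m(1) assms by simp
    fix \<epsilon> :: real and q :: "complex ^ 2" assume e: "0 < \<epsilon>" "\<epsilon> < \<eta> / (2 * m)"
      and c: "((1 / \<epsilon>) *\<^sub>R coord (q - G \<theta>0)) \<bullet> ((1 / \<epsilon>) *\<^sub>R coord (q - G \<theta>0)) \<le> 3"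
    let ?c = "(1 / \<epsilon>) *\<^sub>R coord (q - G \<theta>0)"
    have "(norm ?c)\<^sup>2 \<le> 2\<^sup>2" using c by (simp only: power2_norm_eq_inner) simp
    then have n: "norm ?c \<le> 2" by (rule power2_le_imp_le) simp
    have "q - G \<theta>0 = lin (\<epsilon> *\<^sub>R ?c)" using e(1) by simp
    then have "norm (q - G \<theta>0) \<le> m * norm (\<epsilon> *\<^sub>R ?c)" using m(2) by metis
    also have "\<dots> = m * \<epsilon> * norm ?c" using e(1) by simp
    also have "\<dots> \<le> m * \<epsilon> * 2" using n e(1) m(1) by (intro mult_left_mono) auto
    also have "\<dots> < \<eta>" using e(2) m(1) by (simp add: field_simps)
    finally show "dist q (G \<theta>0) < \<eta>" by (simp add: dist_norm)
  qed
qed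

text \<open>Where the push can be nonzero, the frame is constant; \<open>twist\<close> is purely
  imaginary, so \<open>lin\<close> turns it into a real combination of the
  \<open>\<i> *s X k \<theta>0\<close>, that is, of the frame. Points therefore move within the
  fibres of the projection.\<close>

lemma push_frame:
  assumes "\<rho> > 0"
  obtains \<epsilon>0 where "\<epsilon>0 > 0" "\<And>\<epsilon> \<theta>. 0 < \<epsilon> \<Longrightarrow> \<epsilon> < \<epsilon>0 \<Longrightarrow> \<exists>b. norm b < \<rho> \<and> push \<epsilon> (G \<theta>) = frame_sum Y \<theta> b"
proof -
  obtain e1 where e1: "e1 > 0" "\<And>\<epsilon> q. 0 < \<epsilon> \<Longrightarrow> \<epsilon> < e1 \<Longrightarrow>
    ((1 / \<epsilon>) *\<^sub>R coord (q - G \<theta>0)) \<bullet> ((1 / \<epsilon>) *\<^sub>R coord (q - G \<theta>0)) \<le> 3 \<Longrightarrow> dist q (G \<theta>0) < r0"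
    by (rule support_small[OF r0]) blast
  obtain C where C: "C > 0" "\<And>c. norm (twist c) \<le> C" by (rule twist_Lipschitz) blast
  show ?thesis
  proof (rule that[of "min e1 (\<rho> / C)"])
    show "min e1 (\<rho> / C) > 0" using e1(1) C(1) assms by simp
    fix \<epsilon> :: real and \<theta> :: "real ^ 2" assume e: "0 < \<epsilon>" "\<epsilon> < min e1 (\<rho> / C)"
    let ?c = "(1 / \<epsilon>) *\<^sub>R coord (G \<theta> - G \<theta>0)"
    show "\<exists>b. norm b < \<rho> \<and> push \<epsilon> (G \<theta>) = frame_sum Y \<theta> b"
    proof (cases "?c \<bullet> ?c \<le> 3")
      case True
      then have Y: "Y k \<theta> = \<i> *s X k \<theta>0" for k using e1(2)[of \<epsilon> "G \<theta>"] e flat by simp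
      let ?b = "\<epsilon> *\<^sub>R imv2 (twist ?c)"
      have "norm ?b \<le> \<epsilon> * C"
        using e(1) C(2)[of ?c] norm_rev2_imv2_le(2)[of "twist ?c"] by (simp add: order_trans)
      also have "\<dots> < \<rho>" using e(2) C(1) by (simp add: field_simps)
      finally have "norm ?b < \<rho>" .
      moreover have "push \<epsilon> (G \<theta>) = frame_sum Y \<theta> ?b"
        unfolding push_def lin_def frame_sum_def sum_2 Y scaleR_eq_vector_smult
        by (simp add: vec_eq_iff complex_eq_iff Re_twist imv2_def algebra_simps)
      ultimately show ?thesis by blast
    next
      case False
      then have "push \<epsilon> (G \<theta>) = 0" using twist_eq_0[of ?c] linear_0[OF linear_lin] by (simp add: push_def)
      then show ?thesis using assms by (intro exI[of _ 0]) simp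
    qed
  qed
qed

end

text \<open>Two regimes meet at the scale \<open>\<epsilon>\<close>: up to this distance the
  Lipschitz bound gives \<open>C * d powr (1 - \<alpha>)\<close>, beyond it the uniform bound gives
  \<open>2 * C * \<epsilon> / \<epsilon> powr \<alpha>\<close>.\<close>

lemma hoelder_norm_le:
  assumes "\<epsilon> > 0" and "C > 0" and \<alpha>: "0 \<le> \<alpha>" "\<alpha> < 1"
    and sup: "\<And>x. norm (f x) \<le> C * \<epsilon>" and lip: "\<And>x y. norm (f x - f y) \<le> C * norm (x - y)"
  shows "hoelder_norm \<alpha> M f \<le> ennreal (C * \<epsilon> + 2 * C * \<epsilon> powr (1 - \<alpha>))"
proof -
  have q: "norm (f x - f y) / dist x y powr \<alpha> \<le> 2 * C * \<epsilon> powr (1 - \<alpha>)" if "x \<noteq> y" for x y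
  proof -
    define d where "d = dist x y"
    have d: "d > 0" using that by (simp add: d_def)
    have p: "t / t powr \<alpha> = t powr (1 - \<alpha>)" if "t > 0" for t
      using that by (simp add: powr_diff)
    show ?thesis
    proof (cases "d \<le> \<epsilon>")
      case True
      have "norm (f x - f y) / d powr \<alpha> \<le> C * d / d powr \<alpha>"
        using lip[of x y] d by (intro divide_right_mono) (auto simp: d_def dist_norm)
      also have "\<dots> = C * d powr (1 - \<alpha>)" using p[OF d] by (metis times_divide_eq_right)
      also have "\<dots> \<le> C * \<epsilon> powr (1 - \<alpha>)"
        using True d \<alpha> \<open>C > 0\<close> by (intro mult_left_mono powr_mono2) auto
      also have "\<dots> \<le> 2 * C * \<epsilon> powr (1 - \<alpha>)" using \<open>C > 0\<close> by (intro mult_right_mono) auto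
      finally show ?thesis by (simp add: d_def)
    next
      case False
      have "norm (f x - f y) \<le> 2 * C * \<epsilon>"
        using norm_triangle_ineq4[of "f x" "f y"] sup[of x] sup[of y] by linarith
      then have "norm (f x - f y) / d powr \<alpha> \<le> 2 * C * \<epsilon> / \<epsilon> powr \<alpha>"
        using False \<open>\<epsilon> > 0\<close> \<open>C > 0\<close> \<alpha> by (intro frac_le powr_mono2) auto
      also have "\<dots> = 2 * C * \<epsilon> powr (1 - \<alpha>)" using p[OF \<open>\<epsilon> > 0\<close>] by (metis times_divide_eq_right)
      finally show ?thesis by (simp add: d_def)
    qed
  qed
  have "(SUP x\<in>M. ennreal (norm (f x))) \<le> ennreal (C * \<epsilon>)"
    by (rule SUP_least) (use sup in \<open>simp add: ennreal_leI\<close>)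
  moreover have "(if \<alpha> = 0 then 0
      else (SUP (x, y)\<in>{(x, y). x \<in> M \<and> y \<in> M \<and> x \<noteq> y}.
              ennreal (norm (f x - f y) / dist x y powr \<alpha>))) \<le> ennreal (2 * C * \<epsilon> powr (1 - \<alpha>))"
    using q by (auto intro!: SUP_least ennreal_leI)
  ultimately have "hoelder_norm \<alpha> M f \<le> ennreal (C * \<epsilon>) + ennreal (2 * C * \<epsilon> powr (1 - \<alpha>))"
    unfolding hoelder_norm_def by (rule add_mono)
  also have "\<dots> = ennreal (C * \<epsilon> + 2 * C * \<epsilon> powr (1 - \<alpha>))"
    using \<open>\<epsilon> > 0\<close> \<open>C > 0\<close> by (subst ennreal_plus) auto
  finally show ?thesis .
qed

lemma smooth_on_line: "smooth_on (\<lambda>t::real. a + of_real t *s (b :: complex ^ 2)) {-e<..<e}"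
proof -
  have "smooth_on (\<lambda>t::real. a + t *\<^sub>R b) {-e<..<e}"
    by (intro smooth_on_add smooth_on_const smooth_on_scaleR smooth_on_ident open_greaterThanLessThan)
  then show ?thesis by (simp add: scaleR_eq_vector_smult)
qed

text \<open>If the whole disc lay in \<open>N\<close>, the straight lines through its centre would
  be curves in \<open>N\<close> whose velocities fill the complex line spanned by \<open>b\<close>.
  The point obtained is the one at which rational convexity fails.\<close>

lemma totally_real_contains_no_disc:
  assumes N: "totally_real N" and b: "b \<noteq> 0"
  shows "\<exists>w. norm w < 1 \<and> a + w *s b \<notin> (N :: (complex ^ 2) set)"
proof (rule ccontr)
  assume "\<not> ?thesis"
  then have in_N: "a + w *s b \<in> N" if "norm w < 1" for w using that by blast
  have "z *s b \<in> tangent_space N a" for z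
  proof -
    \<comment> \<open>For \<open>t\<close> in this interval the parameter \<open>t z\<close> stays
      in the unit disc, however large \<open>z\<close> is.\<close>
    define e where "e = 1 / (norm z + 1)"
    have e: "e > 0" by (simp add: e_def add_nonneg_pos)
    have "a + of_real t *s (z *s b) \<in> N" if "t \<in> {-e<..<e}" for t :: real
    proof -
      have "\<bar>t\<bar> * (norm z + 1) < 1"
      proof -
        have "\<bar>t\<bar> < e" using that by auto
        then have "\<bar>t\<bar> * (norm z + 1) < e * (norm z + 1)" by (rule mult_strict_right_mono) (simp add: add_nonneg_pos)
        also have "e * (norm z + 1) = 1" using e by (simp add: e_def)
        finally show ?thesis .
      qed
      then have "norm (of_real t * z) < 1" by (simp add: norm_mult distrib_left)
      from in_N[OF this] show ?thesis by (simp add: vector_smult_assoc)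
    qed
    moreover have "((\<lambda>t. a + of_real t *s (z *s b)) has_vector_derivative z *s b) (at (0::real))"
      unfolding scaleR_eq_vector_smult[symmetric] by (auto intro!: derivative_eq_intros)
    ultimately show ?thesis
      unfolding tangent_space_def using e
      by (intro CollectI exI[of _ e] conjI exI[of _ "\<lambda>t. a + of_real t *s (z *s b)"] smooth_on_line) auto
  qed
  then have "vec.span {b} \<subseteq> tangent_space N a" by (auto simp: vec.span_singleton)
  moreover have "vec.dim (vec.span {b}) = 1"
    using b by (simp add: vec.dim_span vec.dim_eq_card_independent)
  moreover have "a \<in> N" using in_N[of 0] by simp
  ultimately show False using N vec.subspace_span unfolding totally_real_def by blast
qed

section \<open>The grafted surface near the base point\<close>

context flat_framed_surface
begin

lemma smooth_local_coord: "smooth_on local_coord UNIV"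
  unfolding local_coord_def[abs_def]
  by (intro smooth_on_linear[OF linear_coord] smooth_on_diff smooth_G smooth_on_const open_UNIV)

lemma has_derivative_local_coord: "(local_coord has_derivative (\<lambda>a. cv2 a 0)) (at \<theta>0)"
proof -
  have "((\<lambda>\<theta>. G \<theta> - G \<theta>0) has_derivative DG \<theta>0) (at \<theta>0)"
    using has_derivative_diff[OF DG[of \<theta>0] has_derivative_const] by simp
  from bounded_linear.has_derivative[OF bl_coord this] show ?thesis
    unfolding local_coord_def[abs_def] lin_cv2_0[symmetric] by simp
qed

text \<open>In these coordinates the surface is tangent to the real plane at the origin, so the
  imaginary part is of lower order. The bound is relative to the real part because such a bound
  survives division by \<open>\<epsilon>\<close>.\<close>

lemma imaginary_part_small:
  assumes "\<kappa> > 0"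
  obtains \<delta> where "\<delta> > 0" "\<And>\<theta>. dist \<theta> \<theta>0 < \<delta> \<Longrightarrow> norm (imv2 (local_coord \<theta>)) \<le> \<kappa> * norm (rev2 (local_coord \<theta>))"
proof -
  \<comment> \<open>The bound 1/2 allows the distance of the parameters to be estimated by twice the
    real part, and \<open>\<kappa>/2\<close> pays for that factor.\<close>
  define e where "e = min (1/2) (\<kappa>/2)"
  have e: "e > 0" "e \<le> 1/2" "2 * e \<le> \<kappa>" using assms by (simp_all add: e_def)
  have z: "local_coord \<theta>0 = 0" by (simp add: local_coord_def linear_0[OF linear_coord])
  obtain \<delta> where \<delta>: "\<delta> > 0" "\<And>\<theta>. norm (\<theta> - \<theta>0) < \<delta> \<Longrightarrow>
      norm (local_coord \<theta> - local_coord \<theta>0 - cv2 (\<theta> - \<theta>0) 0) \<le> e * norm (\<theta> - \<theta>0)"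
    using has_derivative_local_coord e(1) unfolding has_derivative_at_alt by blast
  show ?thesis
  proof (rule that[OF \<delta>(1)])
    fix \<theta> :: "real ^ 2" assume "dist \<theta> \<theta>0 < \<delta>"
    then have *: "norm (local_coord \<theta> - cv2 (\<theta> - \<theta>0) 0) \<le> e * norm (\<theta> - \<theta>0)"
      using \<delta>(2)[of \<theta>] z by (simp add: dist_norm)
    let ?d = "local_coord \<theta> - cv2 (\<theta> - \<theta>0) 0"
    have im: "imv2 ?d = imv2 (local_coord \<theta>)" and re: "rev2 ?d = rev2 (local_coord \<theta>) - (\<theta> - \<theta>0)"
      by (simp_all add: linear_diff[OF linear_imv2] linear_diff[OF linear_rev2])
    have i: "norm (imv2 (local_coord \<theta>)) \<le> e * norm (\<theta> - \<theta>0)"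
      using norm_rev2_imv2_le(2)[of ?d] * unfolding im by linarith
    have "norm (rev2 (local_coord \<theta>) - (\<theta> - \<theta>0)) \<le> e * norm (\<theta> - \<theta>0)"
      using norm_rev2_imv2_le(1)[of ?d] * unfolding re by linarith
    moreover have "e * norm (\<theta> - \<theta>0) \<le> 1/2 * norm (\<theta> - \<theta>0)" using e by (intro mult_right_mono) auto
    ultimately have "norm (\<theta> - \<theta>0) \<le> 2 * norm (rev2 (local_coord \<theta>))"
      using norm_triangle_sub[of "\<theta> - \<theta>0" "rev2 (local_coord \<theta>)"]
        norm_minus_commute[of "\<theta> - \<theta>0" "rev2 (local_coord \<theta>)"] by linarith
    then have "e * norm (\<theta> - \<theta>0) \<le> e * (2 * norm (rev2 (local_coord \<theta>)))" using e by (intro mult_left_mono) auto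
    also have "\<dots> \<le> \<kappa> * norm (rev2 (local_coord \<theta>))"
      using mult_right_mono[OF e(3), of "norm (rev2 (local_coord \<theta>))"] by (simp add: mult_ac)
    finally show "norm (imv2 (local_coord \<theta>)) \<le> \<kappa> * norm (rev2 (local_coord \<theta>))" using i by linarith
  qed
qed

text \<open>After rescaling by \<open>\<epsilon>\<close>, the part of the surface that is moved has
  bounded real part, proportionally small imaginary part and a tangent frame close to the axes,
  uniformly in \<open>\<epsilon>\<close>. There \<open>det2_twist_nearby\<close> applies, up to the
  nonzero determinant of \<open>lin\<close>; elsewhere the tangent frame is unchanged.\<close>

lemma push_det2_nonzero:
  obtains \<epsilon>0 where "\<epsilon>0 > 0" "\<And>\<epsilon> \<theta>. 0 < \<epsilon> \<Longrightarrow> \<epsilon> < \<epsilon>0 \<Longrightarrow>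
    det2 (X 1 \<theta> + frechet_derivative (push \<epsilon>) (at (G \<theta>)) (X 1 \<theta>))
         (X 2 \<theta> + frechet_derivative (push \<epsilon>) (at (G \<theta>)) (X 2 \<theta>)) \<noteq> 0"
proof -
  obtain m where m: "m > 0" "\<And>z. norm (coord z) \<le> m * norm z" by (rule lin_bound) blast
  obtain \<delta> where \<delta>: "\<delta> > 0" "\<And>c y1 y2. norm (rev2 c) \<le> 2 \<Longrightarrow> norm (imv2 c) < \<delta> \<Longrightarrow>
     norm (y1 - axis 1 1) < \<delta> \<Longrightarrow> norm (y2 - axis 2 1) < \<delta> \<Longrightarrow>
     det2 (y1 + frechet_derivative twist (at c) y1) (y2 + frechet_derivative twist (at c) y2) \<noteq> 0"
    by (rule det2_twist_nearby) blast
  \<comment> \<open>\<open>coord\<close> stretches lengths by at most \<open>m\<close>, whence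
    \<open>\<delta> / m\<close> for the frame. The rescaled real part has norm at most 2, so the
    factor \<open>\<delta> / 4\<close> leaves an imaginary part of at most
    \<open>\<delta> / 2\<close>.\<close>
  have pos: "\<delta> / m > 0" "\<delta> / 4 > 0" using m(1) \<delta>(1) by simp_all
  obtain \<eta>1 where \<eta>1: "\<eta>1 > 0" "\<And>\<theta>. dist (G \<theta>) (G \<theta>0) < \<eta>1 \<Longrightarrow> dist (X 1 \<theta>) (X 1 \<theta>0) < \<delta> / m"
    by (rule periodic_close[OF per_X[of 1] smooth_X pos(1), of \<theta>0]) blast
  obtain \<eta>2 where \<eta>2: "\<eta>2 > 0" "\<And>\<theta>. dist (G \<theta>) (G \<theta>0) < \<eta>2 \<Longrightarrow> dist (X 2 \<theta>) (X 2 \<theta>0) < \<delta> / m"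
    by (rule periodic_close[OF per_X[of 2] smooth_X pos(1), of \<theta>0]) blast
  obtain d where d: "d > 0" "\<And>\<theta>. dist \<theta> \<theta>0 < d \<Longrightarrow> norm (imv2 (local_coord \<theta>)) \<le> \<delta> / 4 * norm (rev2 (local_coord \<theta>))"
    by (rule imaginary_part_small[OF pos(2)]) blast
  obtain \<eta>3 where \<eta>3: "\<eta>3 > 0" "\<And>\<theta>. dist (G \<theta>) (G \<theta>0) < \<eta>3 \<Longrightarrow> \<exists>\<theta>'. G \<theta>' = G \<theta> \<and> dist \<theta>' \<theta>0 < d"
    by (rule nearby_parameter[OF d(1), of \<theta>0]) blast
  have "min \<eta>1 (min \<eta>2 \<eta>3) > 0" using \<eta>1(1) \<eta>2(1) \<eta>3(1) by simp
  from support_small[OF this]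
  obtain e0 where e0: "e0 > 0" "\<And>\<epsilon> q. 0 < \<epsilon> \<Longrightarrow> \<epsilon> < e0 \<Longrightarrow>
    ((1 / \<epsilon>) *\<^sub>R coord (q - G \<theta>0)) \<bullet> ((1 / \<epsilon>) *\<^sub>R coord (q - G \<theta>0)) \<le> 3 \<Longrightarrow> dist q (G \<theta>0) < min \<eta>1 (min \<eta>2 \<eta>3)"
    by blast
  show ?thesis
  proof (rule that[OF e0(1)])
    fix \<epsilon> :: real and \<theta> :: "real ^ 2" assume e: "0 < \<epsilon>" "\<epsilon> < e0"
    define c where "c = (1 / \<epsilon>) *\<^sub>R coord (G \<theta> - G \<theta>0)"
    have D: "frechet_derivative (push \<epsilon>) (at (G \<theta>)) v = lin (frechet_derivative twist (at c) (coord v))" for v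
      unfolding c_def using e(1) by (intro frechet_push) simp
    show "det2 (X 1 \<theta> + frechet_derivative (push \<epsilon>) (at (G \<theta>)) (X 1 \<theta>))
         (X 2 \<theta> + frechet_derivative (push \<epsilon>) (at (G \<theta>)) (X 2 \<theta>)) \<noteq> 0"
    proof (cases "c \<bullet> c \<le> 3")
      case False
      then show ?thesis unfolding D using det[of \<theta>] by (simp add: frechet_twist_eq_0 linear_0[OF linear_lin])
    next
      case True
      then have near: "dist (G \<theta>) (G \<theta>0) < min \<eta>1 (min \<eta>2 \<eta>3)" using e0(2)[OF e, of "G \<theta>"] by (simp add: c_def)
      have "(norm c)\<^sup>2 \<le> 2\<^sup>2" using True by (simp only: power2_norm_eq_inner) simp
      then have "norm c \<le> 2" by (rule power2_le_imp_le) simp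
      then have r2: "norm (rev2 c) \<le> 2" using norm_rev2_imv2_le(1)[of c] by linarith
      obtain \<theta>' where \<theta>': "G \<theta>' = G \<theta>" "dist \<theta>' \<theta>0 < d" using \<eta>3(2)[of \<theta>] near by auto
      have c': "c = (1 / \<epsilon>) *\<^sub>R local_coord \<theta>'" by (simp add: c_def local_coord_def \<theta>'(1))
      have "norm (imv2 c) \<le> \<delta> / 4 * norm (rev2 c)"
        using d(2)[OF \<theta>'(2)] e(1) unfolding c' linear_scale[OF linear_imv2] linear_scale[OF linear_rev2]
        by (simp add: field_simps)
      also have "\<dots> \<le> \<delta> / 4 * 2" using r2 \<delta>(1) by (intro mult_left_mono) auto
      finally have im: "norm (imv2 c) < \<delta>" using \<delta>(1) by simp
      have lin_axis: "lin (axis 1 1) = X 1 \<theta>0" "lin (axis 2 1) = X 2 \<theta>0"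
        by (simp_all add: lin_def axis_def vec_eq_iff)
      have y: "norm (coord (X 1 \<theta>) - axis 1 1) < \<delta>" "norm (coord (X 2 \<theta>) - axis 2 1) < \<delta>"
      proof -
        have "coord (X 1 \<theta>) - axis 1 1 = coord (X 1 \<theta> - X 1 \<theta>0)" "coord (X 2 \<theta>) - axis 2 1 = coord (X 2 \<theta> - X 2 \<theta>0)"
          unfolding lin_axis[symmetric] linear_diff[OF linear_coord] by simp_all
        moreover have "m * norm (X 1 \<theta> - X 1 \<theta>0) < \<delta>" "m * norm (X 2 \<theta> - X 2 \<theta>0) < \<delta>"
          using \<eta>1(2)[of \<theta>] \<eta>2(2)[of \<theta>] near m(1) by (simp_all add: dist_norm field_simps)
        ultimately show "norm (coord (X 1 \<theta>) - axis 1 1) < \<delta>" "norm (coord (X 2 \<theta>) - axis 2 1) < \<delta>"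
          using m(2)[of "X 1 \<theta> - X 1 \<theta>0"] m(2)[of "X 2 \<theta> - X 2 \<theta>0"] by simp_all
      qed
      have dec: "v + frechet_derivative (push \<epsilon>) (at (G \<theta>)) v = lin (coord v + frechet_derivative twist (at c) (coord v))" for v
        unfolding D linear_add[OF linear_lin] by simp
      show ?thesis unfolding dec det2_lin using det[of \<theta>0] \<delta>(2)[OF r2 im y] by simp
    qed
  qed
qed

text \<open>The real part of \<open>local_coord\<close> has the identity as its derivative at
  \<open>\<theta>0\<close>, so a local inverse finds a parameter over every small real vector. The
  bound on the imaginary part keeps the rescaled point where the cutoff is 1.\<close>

lemma parameters_cover_disc:
  obtains \<epsilon>0 where "\<epsilon>0 > 0" "\<And>\<epsilon> u. 0 < \<epsilon> \<Longrightarrow> \<epsilon> < \<epsilon>0 \<Longrightarrow> norm u \<le> 1 \<Longrightarrow>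
    \<exists>\<theta>. rev2 (local_coord \<theta>) = \<epsilon> *\<^sub>R u \<and> norm (imv2 (local_coord \<theta>)) \<le> \<epsilon>"
proof -
  obtain \<delta> where \<delta>: "\<delta> > 0" "\<And>\<theta>. dist \<theta> \<theta>0 < \<delta> \<Longrightarrow> norm (imv2 (local_coord \<theta>)) \<le> 1 * norm (rev2 (local_coord \<theta>))"
    by (rule imaginary_part_small[of 1]) (simp, blast)
  define f where "f \<theta> = rev2 (local_coord \<theta>)" for \<theta>
  have sm: "smooth_on f UNIV"
    unfolding f_def[abs_def] by (rule smooth_on_linear[OF linear_rev2 open_UNIV smooth_local_coord])
  have "(f has_derivative (\<lambda>a. a)) (at \<theta>0)"
    using bounded_linear.has_derivative[OF bounded_linear_rev2 has_derivative_local_coord] by (simp add: f_def[abs_def])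
  from frechet_derivative_at[OF this] have inj: "inj (frechet_derivative f (at \<theta>0))" by (metis injI)
  obtain U' V g where g: "open U'" "U' \<subseteq> ball \<theta>0 \<delta>" "open V" "f \<theta>0 \<in> V" "homeomorphism U' V f g"
    by (rule smooth_local_inverse[OF open_ball[of \<theta>0 \<delta>] smooth_on_subset[OF sm subset_UNIV] _ inj])
      (use \<delta>(1) in simp, blast)
  have "f \<theta>0 = 0" by (simp add: f_def local_coord_def linear_0[OF linear_coord] linear_0[OF linear_rev2])
  then obtain e where e: "e > 0" "ball 0 e \<subseteq> V" using g(3,4) open_contains_ball by metis
  show ?thesis
  proof (rule that[OF e(1)])
    fix \<epsilon> :: real and u :: "real ^ 2" assume \<epsilon>: "0 < \<epsilon>" "\<epsilon> < e" "norm u \<le> 1"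
    have n: "norm (\<epsilon> *\<^sub>R u) \<le> \<epsilon>" using \<epsilon> by (simp add: mult_left_le)
    then have "\<epsilon> *\<^sub>R u \<in> V" using e(2) \<epsilon>(2) by (auto simp: subset_iff)
    then have *: "g (\<epsilon> *\<^sub>R u) \<in> ball \<theta>0 \<delta>" "f (g (\<epsilon> *\<^sub>R u)) = \<epsilon> *\<^sub>R u"
      using g(2,5) by (auto simp: homeomorphism_def)
    then have "norm (imv2 (local_coord (g (\<epsilon> *\<^sub>R u)))) \<le> 1 * norm (f (g (\<epsilon> *\<^sub>R u)))"
      unfolding f_def by (intro \<delta>(2)) (simp add: dist_commute)
    then show "\<exists>\<theta>. rev2 (local_coord \<theta>) = \<epsilon> *\<^sub>R u \<and> norm (imv2 (local_coord \<theta>)) \<le> \<epsilon>"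
      using *(2) n by (intro exI[of _ "g (\<epsilon> *\<^sub>R u)"]) (simp add: f_def)
  qed
qed

text \<open>Over the real unit disc the rescaled points satisfy
  \<open>c \<bullet> c \<le> 2\<close>, where \<open>twist\<close> overwrites the imaginary part.
  The pushed surface thus contains an exact copy of the model disc, although the surface itself is
  only approximately flat.\<close>

lemma push_not_rationally_convex:
  assumes "\<epsilon> > 0"
    and cover: "\<And>u. norm u \<le> 1 \<Longrightarrow> \<exists>\<theta>. rev2 (local_coord \<theta>) = \<epsilon> *\<^sub>R u \<and> norm (imv2 (local_coord \<theta>)) \<le> \<epsilon>"
    and N: "totally_real ((\<lambda>q. q + push \<epsilon> q) ` range G)"
  shows "\<not> rationally_convex ((\<lambda>q. q + push \<epsilon> q) ` range G)"
proof -
  define s where "s w = (Re w)\<^sup>2 + (Im w)\<^sup>2" for w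
  \<comment> \<open>The model graph over the unit disc, with \<open>w\<close> standing for the real
    point \<open>(Re w, Im w)\<close>. For \<open>s w = 1\<close> it is \<open>w\<close> times the
    vector \<open>(1, - \<i>)\<close>, from which \<open>b\<close> is made.\<close>
  define \<phi> where "\<phi> w = (\<chi> k::2. if k = 1 then of_real (Re w) + \<i> * of_real ((1 - s w) * Re w + Im w)
      else of_real (Im w) + \<i> * of_real ((1 - s w) * Im w - Re w))" for w
  define b where "b = \<epsilon> *\<^sub>R lin (\<chi> k::2. if k = 1 then 1 else - \<i>)"
  have b: "b \<noteq> 0"
  proof
    assume "b = 0"
    then have "lin (\<chi> k::2. if k = 1 then 1 else - \<i>) = lin 0" using \<open>\<epsilon> > 0\<close> by (simp add: b_def linear_0[OF linear_lin])
    then have "(\<chi> k::2. if k = 1 then 1 else - \<i>) = (0 :: complex ^ 2)" using inj_lin by (simp only: inj_eq)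
    then have "(\<chi> k::2. if k = 1 then 1 else - \<i>) $ 1 = (0 :: complex ^ 2) $ 1" by simp
    then show False by simp
  qed
  obtain w0 where w0: "norm w0 < 1" "G \<theta>0 + w0 *s b \<notin> (\<lambda>q. q + push \<epsilon> q) ` range G"
    using totally_real_contains_no_disc[OF N b] by blast
  show ?thesis
  proof (rule not_rationally_convex_if_disc[where \<phi>="\<lambda>w. G \<theta>0 + \<epsilon> *\<^sub>R lin (\<phi> w)" and a="G \<theta>0" and b=b and ?w0.0=w0])
    have "continuous_on (cball 0 1) (\<lambda>w. \<phi> w $ k)" for k :: 2
      unfolding \<phi>_def s_def using exhaust_2[of k] by (auto intro!: continuous_intros)
    then have "continuous_on (cball 0 1) \<phi>"
      using continuous_on_vec_lambda[of "cball 0 1" "\<lambda>k w. \<phi> w $ k"] by simp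
    then show "continuous_on (cball 0 1) (\<lambda>w. G \<theta>0 + \<epsilon> *\<^sub>R lin (\<phi> w))"
      by (intro continuous_intros bounded_linear.continuous_on[OF bl_lin])
    show "(\<lambda>w. G \<theta>0 + \<epsilon> *\<^sub>R lin (\<phi> w)) ` cball 0 1 \<subseteq> (\<lambda>q. q + push \<epsilon> q) ` range G"
    proof safe
      fix w :: complex assume w: "w \<in> cball 0 1"
      define u where "u = (\<chi> k::2. if k = 1 then Re w else Im w)"
      have "(norm u)\<^sup>2 = (norm w)\<^sup>2"
        by (simp add: u_def power2_norm_eq_inner inner_vec_def sum_2 inner_complex_def)
      then have u: "norm u \<le> 1" using w by simp
      obtain \<theta> where \<theta>: "rev2 (local_coord \<theta>) = \<epsilon> *\<^sub>R u" "norm (imv2 (local_coord \<theta>)) \<le> \<epsilon>"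
        using cover[OF u] by blast
      define c where "c = (1 / \<epsilon>) *\<^sub>R local_coord \<theta>"
      have re: "rev2 c = u" and im: "norm (imv2 c) \<le> 1"
        using \<theta> \<open>\<epsilon> > 0\<close> by (simp_all add: c_def linear_scale[OF linear_rev2] linear_scale[OF linear_imv2])
      have "(norm (rev2 c))\<^sup>2 \<le> 1" "(norm (imv2 c))\<^sup>2 \<le> 1"
        using u im re by (simp_all add: power_le_one)
      then have c2: "c \<bullet> c \<le> 2" using norm_complex_vec2[of c] by (simp add: power2_norm_eq_inner)
      have rc: "Re (c $ 1) = Re w" "Re (c $ 2) = Im w"
        using re by (simp_all add: rev2_def u_def vec_eq_iff forall_2)
      have "s w = (Re (c $ 1))\<^sup>2 + (Re (c $ 2))\<^sup>2" by (simp add: s_def rc)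
      from twist_eq[OF c2 this] have "c + twist c = \<phi> w"
        by (simp add: vec_eq_iff forall_2 \<phi>_def rc complex_eq_iff)
      moreover have "G \<theta> + push \<epsilon> (G \<theta>) = G \<theta>0 + \<epsilon> *\<^sub>R lin (c + twist c)"
      proof -
        have "\<epsilon> *\<^sub>R lin c = G \<theta> - G \<theta>0"
          using \<open>\<epsilon> > 0\<close> by (simp add: c_def local_coord_def linear_scale[OF linear_lin])
        moreover have "push \<epsilon> (G \<theta>) = \<epsilon> *\<^sub>R lin (twist c)" by (simp add: push_def c_def local_coord_def)
        ultimately show ?thesis by (simp add: linear_add[OF linear_lin] scaleR_add_right)
      qed
      ultimately have "G \<theta>0 + \<epsilon> *\<^sub>R lin (\<phi> w) = G \<theta> + push \<epsilon> (G \<theta>)" by simp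
      then show "G \<theta>0 + \<epsilon> *\<^sub>R lin (\<phi> w) \<in> (\<lambda>q. q + push \<epsilon> q) ` range G" by blast
    qed
    show "G \<theta>0 + \<epsilon> *\<^sub>R lin (\<phi> w) = G \<theta>0 + w *s b" if "norm w = 1" for w
    proof -
      have "s w = 1" using that by (simp add: s_def cmod_def)
      then have "\<phi> w = w *s (\<chi> k::2. if k = 1 then 1 else - \<i>)"
        by (simp add: \<phi>_def vec_eq_iff forall_2 complex_eq_iff)
      then show ?thesis by (simp add: b_def lin_smult scaleR_eq_vector_smult vector_smult_assoc mult.commute)
    qed
  qed (use w0 in auto)
qed

end

section \<open>Assembly of the perturbed tori\<close>

lemma (in periodic_surface) det2_nonzero:
  assumes inj: "\<And>\<theta> a. DG \<theta> a = 0 \<Longrightarrow> a = 0" and real: "totally_real (range G)"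
  shows "det2 (X 1 \<theta>) (X 2 \<theta>) \<noteq> 0"
proof (rule det2_nonzero_if_no_complex_line[where S="range (DG \<theta>)"])
  show "X 1 \<theta> \<noteq> 0" using inj[of \<theta> "axis 1 1"] by auto
  show "X 2 \<theta> \<noteq> a *\<^sub>R X 1 \<theta>" for a
  proof
    assume "X 2 \<theta> = a *\<^sub>R X 1 \<theta>"
    then have "DG \<theta> (axis 2 1 - a *\<^sub>R axis 1 1) = 0"
      by (simp add: linear_diff[OF has_derivative_linear[OF DG]] linear_scale[OF has_derivative_linear[OF DG]])
    then have "(axis 2 1 - a *\<^sub>R axis 1 1 :: real ^ 2) $ 2 = 0" using inj by (metis zero_index)
    then show False by (simp add: axis_def)
  qed
  show "a *\<^sub>R X 1 \<theta> + b *\<^sub>R X 2 \<theta> \<in> range (DG \<theta>)" for a b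
  proof -
    have "a *\<^sub>R X 1 \<theta> + b *\<^sub>R X 2 \<theta> = DG \<theta> (\<chi> k. if k = 1 then a else b)"
      using DG_expand[of \<theta> "\<chi> k. if k = 1 then a else b"] by simp
    then show ?thesis by simp
  qed
  have "\<not> (\<exists>L. vec.subspace L \<and> vec.dim L = 1 \<and> L \<subseteq> tangent_space (range G) (G \<theta>))"
    using real unfolding totally_real_def by blast
  then show "\<not> (\<exists>L. vec.subspace L \<and> vec.dim L = 1 \<and> L \<subseteq> range (DG \<theta>))"
    using range_subset_tangent_space[of \<theta>] by blast
qed
lemma (in flat_framed_surface) small_perturbation:
  assumes M: "smooth_submanifold 2 (range G)" and \<alpha>: "0 \<le> \<alpha>" "\<alpha> < 1"
  shows "admits_small_perturbation \<alpha> 2 (range G) (\<lambda>S. totally_real S \<and> \<not> rationally_convex S)"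
proof -
  obtain U \<pi> \<rho> where U: "tubular_neighbourhood (range G) U" "smooth_submersion U (range G) \<pi>"
    "\<And>\<theta>. \<pi> (G \<theta>) = G \<theta>" "\<rho> > 0"
    "\<And>\<theta> b. norm b < \<rho> \<Longrightarrow> G \<theta> + frame_sum Y \<theta> b \<in> U \<and> \<pi> (G \<theta> + frame_sum Y \<theta> b) = G \<theta>"
    "\<And>\<rho>'. \<rho>' \<le> \<rho> \<Longrightarrow> open {y. \<exists>\<theta> b. norm b < \<rho>' \<and> y = G \<theta> + frame_sum Y \<theta> b}"
    by (rule frame_tubular) blast
  have "\<rho> / 4 > 0" using U(4) by simp
  then obtain e1 where e1: "e1 > 0" "\<And>\<epsilon> \<theta>. 0 < \<epsilon> \<Longrightarrow> \<epsilon> < e1 \<Longrightarrow> \<exists>b. norm b < \<rho> / 4 \<and> push \<epsilon> (G \<theta>) = frame_sum Y \<theta> b"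
    by (rule push_frame) blast
  obtain e2 where e2: "e2 > 0" "\<And>\<epsilon> \<theta>. 0 < \<epsilon> \<Longrightarrow> \<epsilon> < e2 \<Longrightarrow>
    det2 (X 1 \<theta> + frechet_derivative (push \<epsilon>) (at (G \<theta>)) (X 1 \<theta>))
         (X 2 \<theta> + frechet_derivative (push \<epsilon>) (at (G \<theta>)) (X 2 \<theta>)) \<noteq> 0"
    by (rule push_det2_nonzero) blast
  obtain e3 where e3: "e3 > 0" "\<And>\<epsilon> u. 0 < \<epsilon> \<Longrightarrow> \<epsilon> < e3 \<Longrightarrow> norm u \<le> 1 \<Longrightarrow>
    \<exists>\<theta>. rev2 (local_coord \<theta>) = \<epsilon> *\<^sub>R u \<and> norm (imv2 (local_coord \<theta>)) \<le> \<epsilon>"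
    by (rule parameters_cover_disc) blast
  obtain C where C: "C > 0" "\<And>\<epsilon> q. \<epsilon> > 0 \<Longrightarrow> norm (push \<epsilon> q) \<le> C * \<epsilon>"
    "\<And>\<epsilon> q q'. \<epsilon> > 0 \<Longrightarrow> norm (push \<epsilon> q - push \<epsilon> q') \<le> C * norm (q - q')"
    by (rule push_bounds) blast
  define E where "E = min e1 (min e2 e3)"
  have E: "E > 0" "E \<le> e1" "E \<le> e2" "E \<le> e3" using e1(1) e2(1) e3(1) by (auto simp: E_def)
  \<comment> \<open>The shift by 2 makes even the first member strictly smaller than
    \<open>E\<close>, as the strict bounds \<open>e1\<close>, \<open>e2\<close>, \<open>e3\<close>
    require.\<close>
  define \<epsilon> where "\<epsilon> j = E / real (j + 2)" for j
  have \<epsilon>: "0 < \<epsilon> j" "\<epsilon> j < E" for j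
    using E(1) by (simp_all add: \<epsilon>_def divide_less_eq)
  define N where "N j = (\<lambda>q. q + push (\<epsilon> j) q) ` range G" for j
  have graph: "smooth_submanifold 2 (N j)" "N j \<subseteq> U" "diffeomorphism (N j) (range G) \<pi> (\<lambda>q. q + push (\<epsilon> j) q)"
    and tangent: "\<And>v \<theta>. v \<in> tangent_space (N j) (G \<theta> + push (\<epsilon> j) (G \<theta>)) \<Longrightarrow>
      \<exists>a. v = DG \<theta> a + frechet_derivative (push (\<epsilon> j)) (at (G \<theta>)) (DG \<theta> a)" for j
  proof -
    have fr: "\<exists>b. norm b < \<rho> / 4 \<and> push (\<epsilon> j) (G \<theta>) = frame_sum Y \<theta> b" for \<theta>
      by (rule e1(2)[OF \<epsilon>(1) less_le_trans[OF \<epsilon>(2) E(2)]])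
    note * = graph_perturbation[where s="push (\<epsilon> j)", OF U(2,3,4,5,6) M smooth_push fr]
    show "smooth_submanifold 2 (N j)" unfolding N_def by (rule *(1))
    show "N j \<subseteq> U" unfolding N_def by (rule *(2))
    show "diffeomorphism (N j) (range G) \<pi> (\<lambda>q. q + push (\<epsilon> j) q)" unfolding N_def by (rule *(3))
    show "\<exists>a. v = DG \<theta> a + frechet_derivative (push (\<epsilon> j)) (at (G \<theta>)) (DG \<theta> a)"
      if "v \<in> tangent_space (N j) (G \<theta> + push (\<epsilon> j) (G \<theta>))" for v \<theta>
      by (rule *(4)[OF _ _ that[unfolded N_def]])
  qed
  have real: "totally_real (N j)" for j
    unfolding totally_real_def
  proof
    fix p assume "p \<in> N j"
    then obtain \<theta> where p: "p = G \<theta> + push (\<epsilon> j) (G \<theta>)" unfolding N_def by blast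
    let ?D = "frechet_derivative (push (\<epsilon> j)) (at (G \<theta>))"
    have lin: "linear ?D"
      by (rule has_derivative_linear[OF smooth_on_has_derivative[OF smooth_push UNIV_I]])
    have d: "det2 (X 1 \<theta> + ?D (X 1 \<theta>)) (X 2 \<theta> + ?D (X 2 \<theta>)) \<noteq> 0"
      by (rule e2(2)[OF \<epsilon>(1) less_le_trans[OF \<epsilon>(2) E(3)]])
    show "\<not> (\<exists>L. vec.subspace L \<and> vec.dim L = 1 \<and> L \<subseteq> tangent_space (N j) p)"
    proof (rule no_complex_line[OF d])
      fix v assume "v \<in> tangent_space (N j) p"
      then obtain a where v: "v = DG \<theta> a + ?D (DG \<theta> a)" using tangent unfolding p by blast
      have "v = a $ 1 *\<^sub>R (X 1 \<theta> + ?D (X 1 \<theta>)) + a $ 2 *\<^sub>R (X 2 \<theta> + ?D (X 2 \<theta>))"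
        unfolding v DG_expand[of \<theta> a] linear_add[OF lin] linear_scale[OF lin] by (simp add: algebra_simps)
      then show "\<exists>a b. v = a *\<^sub>R (X 1 \<theta> + ?D (X 1 \<theta>)) + b *\<^sub>R (X 2 \<theta> + ?D (X 2 \<theta>))" by blast
    qed
  qed
  have nrc: "\<not> rationally_convex (N j)" for j
    unfolding N_def
  proof (rule push_not_rationally_convex)
    show "\<epsilon> j > 0" by (rule \<epsilon>)
    show "\<exists>\<theta>. rev2 (local_coord \<theta>) = \<epsilon> j *\<^sub>R u \<and> norm (imv2 (local_coord \<theta>)) \<le> \<epsilon> j" if "norm u \<le> 1" for u
      by (rule e3(2)[OF \<epsilon>(1) less_le_trans[OF \<epsilon>(2) E(4)] that])
    show "totally_real ((\<lambda>q. q + push (\<epsilon> j) q) ` range G)" using real[of j] by (simp add: N_def)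
  qed
  have "(\<lambda>j. hoelder_norm \<alpha> (range G) (\<lambda>x. (x + push (\<epsilon> j) x) - x)) \<longlonglongrightarrow> 0"
  proof (rule tendsto_sandwich)
    show "\<forall>\<^sub>F j in sequentially. (0::ennreal) \<le> hoelder_norm \<alpha> (range G) (\<lambda>x. (x + push (\<epsilon> j) x) - x)" by simp
    have "hoelder_norm \<alpha> (range G) (\<lambda>x. (x + push (\<epsilon> j) x) - x) \<le> ennreal (C * \<epsilon> j + 2 * C * \<epsilon> j powr (1 - \<alpha>))" for j
      using hoelder_norm_le[OF \<epsilon>(1)[of j] C(1) \<alpha> C(2)[OF \<epsilon>(1)] C(3)[OF \<epsilon>(1)]] by simp
    then show "\<forall>\<^sub>F j in sequentially. hoelder_norm \<alpha> (range G) (\<lambda>x. (x + push (\<epsilon> j) x) - x)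
        \<le> ennreal (C * \<epsilon> j + 2 * C * \<epsilon> j powr (1 - \<alpha>))" by simp
    have "\<epsilon> \<longlonglongrightarrow> 0"
      using LIMSEQ_ignore_initial_segment[OF tendsto_mult_right_zero[OF lim_1_over_n, of E], of 2] by (simp add: \<epsilon>_def[abs_def])
    then have "(\<lambda>j. C * \<epsilon> j + 2 * C * \<epsilon> j powr (1 - \<alpha>)) \<longlonglongrightarrow> C * 0 + 2 * C * 0 powr (1 - \<alpha>)"
      using \<alpha>(2) less_imp_le[OF \<epsilon>(1)] by (intro tendsto_intros tendsto_powr') auto
    then show "(\<lambda>j. ennreal (C * \<epsilon> j + 2 * C * \<epsilon> j powr (1 - \<alpha>))) \<longlonglongrightarrow> 0"
      using tendsto_ennrealI by fastforce
  qed simp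
  then show ?thesis
    unfolding admits_small_perturbation_def
    using U(1,2,3) graph real nrc
    by (intro exI[of _ U] exI[of _ \<pi>] exI[of _ N] exI[of _ "\<lambda>j q. q + push (\<epsilon> j) q"]) simp
qed

theorem theorem1p2:
  fixes T :: "(complex ^ 2) set" and \<alpha> :: real
  assumes "smooth_submanifold 2 T" and "compact T"
    and "diffeomorphic T (sphere 0 1 \<times> sphere 0 1 :: (complex \<times> complex) set)"
    and "totally_real T" and "rationally_convex T"
    and "0 \<le> \<alpha>" and "\<alpha> < 1"
  shows "admits_small_perturbation \<alpha> 2 T (\<lambda>S. totally_real S \<and> \<not> rationally_convex S)"
proof -
  obtain G Q where GQ: "periodic_surface G Q" "range G = T" "\<And>\<theta> a. frechet_derivative G (at \<theta>) a = 0 \<Longrightarrow> a = 0"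
    by (rule torus_parametrization[OF assms(3)]) blast
  interpret P: periodic_surface G Q by (rule GQ(1))
  have det: "det2 (P.X 1 \<theta>) (P.X 2 \<theta>) \<noteq> 0" for \<theta>
    by (rule P.det2_nonzero[OF GQ(3)]) (use assms(4) GQ(2) in simp_all)
  \<comment> \<open>The model is grafted in at the parameter 0; the choice of the point is
    arbitrary.\<close>
  obtain Y r where Y: "framed_surface G Q Y" "r > 0" "\<And>k \<theta>. dist (G \<theta>) (G 0) < r \<Longrightarrow> Y k \<theta> = \<i> *s P.X k 0"
    by (rule P.surface_frame[OF det, of 0]) blast
  have "flat_framed_surface G Q Y 0 r"
    by (intro flat_framed_surface.intro flat_framed_surface_axioms.intro Y det)
  from flat_framed_surface.small_perturbation[OF this _ assms(6,7)] assms(1) show ?thesis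
    unfolding GQ(2) by blast
qed

end
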